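(* Let $\alpha=(\alpha_k)_{k\ge1}$ and $q=(q_k)_{k\ge1}$ be families of parameters in $[0,1)$ related by the transformation $q=q(\alpha)$, $$q_1:=\alpha_1,\qquad q_k:=\frac{\alpha_k}{\prod_{j=1}^{k-1}(1-q_j)^{2(k-j)}}\quad(k\ge2),$$ equivalently by the transformation $\alpha=\alpha(q)$, $$\alpha_k:=q_k\prod_{\ell=1}^{k-1}(1-q_\ell)^{2(k-\ell)}\quad(k\ge1).$$ Then $\alpha\in\mathcal A$ if and only if $q\in\mathcal Q$, and $\alpha\in\mathcal A^+$ if and only if $q\in\mathcal Q^+$. In particular, the transformations $\alpha\mapsto q(\alpha)$ and $q\mapsto\alpha(q)$ are inverse to one another and map bijectively $\mathcal A\leftrightarrow\mathcal Q$ and $\mathcal A^+\leftrightarrow\mathcal Q^+$. Furthermore, if $\alpha\in\mathcal A$ then $\nu_\alpha=\varphi_q$ as measures on the set $\mathcal E$ of excursions.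
   Context: Conventions: $\mathbb N=\{1,2,\dots\}$, $0^0=1$, $\max\emptyset=0$. Excursions. An excursion is a finite integer sequence $\varepsilon=(\varepsilon(0),\dots,\varepsilon(2n))$, $n=n(\varepsilon)\ge0$, with $\varepsilon(0)=\varepsilon(2n)=0$, $\varepsilon(z)\ge0$ for $0\le z\le 2n$ and $|\varepsilon(z)-\varepsilon(z-1)|=1$. The case $n=0$ is the empty excursion. $\mathcal E$ is the (countable) set of all excursions. The ball configuration of $\varepsilon$ is $\eta\in\{0,1\}^{\mathbb Z}$ with $\eta(z)=(\varepsilon(z)-\varepsilon(z-1)+1)/2$ for $1\le z\le 2n$ and $\eta(z)=0$ for all other $z$. Solitons (Takahashi-Satsuma algorithm). A run of a configuration is a maximal (possibly infinite) interval of consecutive boxes on which the configuration is constant. Starting from $\eta$, as long as there are finite runs: let $k$ be the smallest size of a run, take the leftmost run of size $k$, and declare the $k$ boxes of this run together with the first $k$ boxes of the next run to be a $k$-soliton; then delete (ignore) these $2k$ boxes, recompute the runs of the remaining configuration, and repeat. A $k$-soliton $\gamma$ thus consists of $k$ boxes with $\eta=1$, $h_0(\gamma)<\dots<h_{k-1}(\gamma)$ (head), and $k$ boxes with $\eta=0$, $t_0(\gamma)<\dots<t_{k-1}(\gamma)$ (tail); its support is the union of head and tail. $n_k(\varepsilon)$ denotes the number of $k$-solitons of $\varepsilon$. Slots and slot diagram of an excursion. Box $z$ is a $k$-slot of $\varepsilon$ if $z=0$ or $z\in\{h_i(\gamma),t_i(\gamma)\}$ for some $i\ge k$ and some $m$-soliton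 $\gamma$ with $m>k$. The number of $k$-slots is $s_k=1+\sum_{\ell>k}2(\ell-k)n_\ell(\varepsilon)$. Enumerate them increasingly, $0=\mathtt s_k(0)<\mathtt s_k(1)<\dots<\mathtt s_k(s_k-1)$, and put $\mathtt s_k(s_k):=2n(\varepsilon)+1$. A $k$-soliton is appended to $k$-slot $j$ if its support is contained in the open interval $(\mathtt s_k(j),\mathtt s_k(j+1))$. The slot diagram $x[\varepsilon]=(x_k[\varepsilon])_{k\ge1}$ consists of the vectors $x_k=(x_k(0),\dots,x_k(s_k-1))$, where $x_k(j)$ is the number of $k$-solitons appended to $k$-slot $j$. Write $|x_k|=\sum_{j=0}^{s_k-1}x_k(j)$ (so $|x_k[\varepsilon]|=n_k(\varepsilon)$) and $s_k(x[\varepsilon])=s_k$. First family. For $\alpha=(\alpha_k)_{k\ge1}$, $\alpha_k\in[0,1)$, let $Z_\alpha:=\sum_{\varepsilon\in\mathcal E}\prod_{k\ge1}\alpha_k^{n_k(\varepsilon)}$ and $\mathcal A:=\{\alpha: Z_\alpha<\infty\}$. For $\alpha\in\mathcal A$ let $\nu_\alpha(\varepsilon):=\frac1{Z_\alpha}\prod_{k\ge1}\alpha_k^{n_k(\varepsilon)}$, a probability on $\mathcal E$, and $\rho_k(\alpha):=\sum_{\varepsilon\in\mathcal E}n_k(\varepsilon)\nu_\alpha(\varepsilon)$. Let $\mathcal A^+:=\{\alpha\in\mathcal A:\sum_{k\ge1}2k\rho_k(\alpha)<\infty\}$ (finite mean excursion length). Second family. For $q=(q_k)_{k\ge1}$,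 $q_k\in[0,1)$, let $\mathcal Q:=\{q:\sum_{k\ge1}q_k<\infty\}$ and $\mathcal Q^+:=\{q:\sum_{k\ge1}kq_k<\infty\}$. For $q\in\mathcal Q$ let $\varphi_q(\varepsilon):=\prod_{k\ge1}q_k^{|x_k[\varepsilon]|}(1-q_k)^{s_k(x[\varepsilon])}$, a probability on $\mathcal E$. *)

theory Defs
  imports "HOL-Analysis.Analysis"
begin

text \<open>The value \<open>\<epsilon>(z)\<close> of an excursion is \<open>e ! z\<close>; the empty excursion is \<open>[0]\<close>, not \<open>[]\<close>.\<close>

definition excursions :: "int list set" where
  "excursions = {e. \<exists>n. length e = 2 * n + 1 \<and> e ! 0 = 0 \<and> e ! (2 * n) = 0 \<and>
     (\<forall>z \<in> {0..2 * n}. e ! z \<ge> 0) \<and> (\<forall>z \<in> {1..2 * n}. \<bar>e ! z - e ! (z - 1)\<bar> = 1)}"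

definition half_length :: "int list \<Rightarrow> nat" where
  "half_length e = (length e - 1) div 2"

definition ball_config :: "int list \<Rightarrow> int \<Rightarrow> int" where
  "ball_config e z =
     (if 1 \<le> z \<and> z \<le> 2 * int (half_length e)
      then (e ! nat z - e ! nat (z - 1) + 1) div 2 else 0)"

text \<open>
  Throughout, \<open>R\<close> is the set of boxes that have not been deleted yet, and boxes are consecutive
  if no element of \<open>R\<close> lies between them.
\<close>

definition constant_interval :: "(int \<Rightarrow> int) \<Rightarrow> int set \<Rightarrow> int set \<Rightarrow> bool" where
  "constant_interval \<eta> R A \<longleftrightarrow> A \<noteq> {} \<and> A \<subseteq> R \<and>
     (\<forall>a \<in> A. \<forall>b \<in> A. \<forall>z \<in> R. a \<le> z \<and> z \<le> b \<longrightarrow> z \<in> A) \<and>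
     (\<exists>c. \<forall>z \<in> A. \<eta> z = c)"

definition is_run :: "(int \<Rightarrow> int) \<Rightarrow> int set \<Rightarrow> int set \<Rightarrow> bool" where
  "is_run \<eta> R A \<longleftrightarrow> constant_interval \<eta> R A \<and>
     (\<forall>B. constant_interval \<eta> R B \<and> A \<subseteq> B \<longrightarrow> B = A)"

definition leftmost_smallest_run :: "(int \<Rightarrow> int) \<Rightarrow> int set \<Rightarrow> int set \<Rightarrow> bool" where
  "leftmost_smallest_run \<eta> R A \<longleftrightarrow> is_run \<eta> R A \<and> finite A \<and>
     (\<forall>C. is_run \<eta> R C \<and> finite C \<longrightarrow> card A \<le> card C) \<and>
     (\<forall>C. is_run \<eta> R C \<and> finite C \<and> card C = card A \<longrightarrow> Min A \<le> Min C)"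

definition next_run :: "(int \<Rightarrow> int) \<Rightarrow> int set \<Rightarrow> int set \<Rightarrow> int set \<Rightarrow> bool" where
  "next_run \<eta> R A B \<longleftrightarrow> is_run \<eta> R B \<and> (\<forall>a \<in> A. \<forall>b \<in> B. a < b) \<and>
     (\<forall>z \<in> R. (\<forall>a \<in> A. a < z) \<longrightarrow> (\<exists>b \<in> B. b \<le> z))"

text \<open>Only meaningful if \<open>B\<close> is bounded below, which holds whenever \<open>B\<close> is the next run after
  some other run; \<open>B\<close> may be infinite to the right.\<close>

definition first_boxes :: "nat \<Rightarrow> int set \<Rightarrow> int set" where
  "first_boxes k B = {z \<in> B. card {w \<in> B. w < z} < k}"

definition ts_step :: "(int \<Rightarrow> int) \<Rightarrow> int set \<Rightarrow> nat \<Rightarrow> int set \<Rightarrow> bool" where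
  "ts_step \<eta> R k S \<longleftrightarrow> (\<exists>A B. leftmost_smallest_run \<eta> R A \<and> card A = k \<and>
     next_run \<eta> R A B \<and> S = A \<union> first_boxes k B)"

inductive ts_remaining :: "(int \<Rightarrow> int) \<Rightarrow> int set \<Rightarrow> bool" for \<eta> where
  start: "ts_remaining \<eta> UNIV"
| step: "ts_remaining \<eta> R \<Longrightarrow> ts_step \<eta> R k S \<Longrightarrow> ts_remaining \<eta> (R - S)"

text \<open>A soliton is represented by its support; distinct solitons have disjoint supports.\<close>

definition solitons :: "int list \<Rightarrow> nat \<Rightarrow> int set set" where
  "solitons e k = {S. \<exists>R. ts_remaining (ball_config e) R \<and> ts_step (ball_config e) R k S}"

definition head_box :: "int list \<Rightarrow> int set \<Rightarrow> nat \<Rightarrow> int" where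
  "head_box e S i = sorted_list_of_set {z \<in> S. ball_config e z = 1} ! i"

definition tail_box :: "int list \<Rightarrow> int set \<Rightarrow> nat \<Rightarrow> int" where
  "tail_box e S i = sorted_list_of_set {z \<in> S. ball_config e z = 0} ! i"

definition num_solitons :: "nat \<Rightarrow> int list \<Rightarrow> nat" where
  "num_solitons k e = card (solitons e k)"

definition slots :: "int list \<Rightarrow> nat \<Rightarrow> int set" where
  "slots e k = {z. z = 0 \<or> (\<exists>m > k. \<exists>S \<in> solitons e m. \<exists>i. k \<le> i \<and> i < m \<and>
     (z = head_box e S i \<or> z = tail_box e S i))}"

definition num_slots :: "int list \<Rightarrow> nat \<Rightarrow> nat" where
  "num_slots e k = card (slots e k)"

definition slot_pos :: "int list \<Rightarrow> nat \<Rightarrow> nat \<Rightarrow> int" where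
  "slot_pos e k j =
     (if j < num_slots e k then sorted_list_of_set (slots e k) ! j
      else 2 * int (half_length e) + 1)"

definition slot_diagram :: "int list \<Rightarrow> nat \<Rightarrow> nat \<Rightarrow> nat" where
  "slot_diagram e k j =
     card {S \<in> solitons e k. S \<subseteq> {slot_pos e k j <..< slot_pos e k (Suc j)}}"

definition slot_diagram_norm :: "int list \<Rightarrow> nat \<Rightarrow> nat" where
  "slot_diagram_norm e k = (\<Sum>j < num_slots e k. slot_diagram e k j)"

text \<open>Families indexed by \<open>k \<ge> 1\<close> are extensional functions on \<open>{1..}\<close>, so that equality of
  functions is equality of families. Products over \<open>k \<ge> 1\<close> are shifted to start at \<open>0\<close>.\<close>

definition param_families :: "(nat \<Rightarrow> real) set" where
  "param_families = {1..} \<rightarrow>\<^sub>E {0..<1}"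

definition alpha_weight :: "(nat \<Rightarrow> real) \<Rightarrow> int list \<Rightarrow> ennreal" where
  "alpha_weight \<alpha> e = ennreal (\<Prod>k. \<alpha> (Suc k) ^ num_solitons (Suc k) e)"

definition partition_function :: "(nat \<Rightarrow> real) \<Rightarrow> ennreal" where
  "partition_function \<alpha> = (\<Sum>\<^sub>\<infinity>e \<in> excursions. alpha_weight \<alpha> e)"

definition A_set :: "(nat \<Rightarrow> real) set" where
  "A_set = {\<alpha> \<in> param_families. partition_function \<alpha> < \<infinity>}"

definition nu_weight :: "(nat \<Rightarrow> real) \<Rightarrow> int list \<Rightarrow> ennreal" where
  "nu_weight \<alpha> e = alpha_weight \<alpha> e / partition_function \<alpha>"

definition nu :: "(nat \<Rightarrow> real) \<Rightarrow> int list measure" where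
  "nu \<alpha> = point_measure excursions (nu_weight \<alpha>)"

definition rho :: "(nat \<Rightarrow> real) \<Rightarrow> nat \<Rightarrow> ennreal" where
  "rho \<alpha> k = (\<Sum>\<^sub>\<infinity>e \<in> excursions. of_nat (num_solitons k e) * nu_weight \<alpha> e)"

definition A_plus_set :: "(nat \<Rightarrow> real) set" where
  "A_plus_set = {\<alpha> \<in> A_set. (\<Sum>\<^sub>\<infinity>k \<in> {1..}. of_nat (2 * k) * rho \<alpha> k) < \<infinity>}"

definition Q_set :: "(nat \<Rightarrow> real) set" where
  "Q_set = {q \<in> param_families. q summable_on {1..}}"

definition Q_plus_set :: "(nat \<Rightarrow> real) set" where
  "Q_plus_set = {q \<in> param_families. (\<lambda>k. real k * q k) summable_on {1..}}"

definition phi_weight :: "(nat \<Rightarrow> real) \<Rightarrow> int list \<Rightarrow> ennreal" where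
  "phi_weight q e = ennreal (\<Prod>k. q (Suc k) ^ slot_diagram_norm e (Suc k) *
     (1 - q (Suc k)) ^ num_slots e (Suc k))"

definition phi :: "(nat \<Rightarrow> real) \<Rightarrow> int list measure" where
  "phi q = point_measure excursions (phi_weight q)"

fun q_rec :: "(nat \<Rightarrow> real) \<Rightarrow> nat \<Rightarrow> real" where
  "q_rec \<alpha> k = \<alpha> k / (\<Prod>j \<in> {1..<k}. (1 - q_rec \<alpha> j) ^ (2 * (k - j)))"

text \<open>The recursion makes \<open>q_rec.simps\<close> loop as a rewrite rule.\<close>

declare q_rec.simps [simp del]

definition q_of_alpha :: "(nat \<Rightarrow> real) \<Rightarrow> nat \<Rightarrow> real" where
  "q_of_alpha \<alpha> = restrict (q_rec \<alpha>) {1..}"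

definition alpha_of_q :: "(nat \<Rightarrow> real) \<Rightarrow> nat \<Rightarrow> real" where
  "alpha_of_q q = (\<lambda>k \<in> {1..}. q k * (\<Prod>l \<in> {1..<k}. (1 - q l) ^ (2 * (k - l))))"

end

theory Submission
  imports Defs
begin

text \<open>
  Record an excursion by the list of its run lengths, starting with the first ascent. If \<open>k\<close> is
  the smallest run length and occurs first in \<open>\<dots>, c, k, b, \<dots>\<close>, then one step of the
  Takahashi-Satsuma algorithm replaces these three entries by \<open>c + b - k\<close>; if it is the first
  entry, then the second entry is \<open>k\<close> as well, and both are dropped. Reversing this, an excursion whose runs all exceed
  \<open>k\<close> has \<open>s\<^sub>k\<close> places for a new \<open>k\<close>-soliton, and every further \<open>k\<close>-soliton has to be inserted
  weakly to the left of the previous one. Hence there are \<open>x + s\<^sub>k - 1\<close> choose \<open>x\<close> ways to insert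
  \<open>x\<close> of them, and summing \<open>q\<^sup>x\<close> over all of them gives \<open>(1 - q)\<close> to the power \<open>- s\<^sub>k\<close>. Since
  \<open>s\<^sub>k\<close> is affine in the numbers of larger solitons, summing out the solitons of size
  \<open>1, 2, \<dots>\<close> in turn keeps a product weight, whose parameters evolve exactly as in the
  transformation from \<open>\<alpha>\<close> to \<open>q\<close>. So \<open>Z\<^sub>\<alpha>\<close> is the product of all \<open>1 / (1 - q\<^sub>k)\<close>. The same
  summation maps affine functions of the soliton numbers to affine functions, which controls the mean
  length.
\<close>

text \<open>Deletion takes the leftmost shortest run, so a run of length \<open>k\<close> may only
  be put back where it becomes the first of its length. The place of an insertion, which can be read
  back as \<open>room\<close>, therefore bounds the next one. This memory is a single number, which
  is why iterated partial sums and binomial coefficients appear.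

  Two devices control the infinite families. The bound \<open>q_rec \<alpha> k < 1\<close> is not
  given for \<alpha> in \<open>A_set\<close>; it is extracted from finiteness, because for
  \<open>q_rec \<alpha> k \<ge> 1\<close> the configurations made of \<open>k\<close>-solitons alone
  already diverge. And the summation is never carried out infinitely often: \<alpha> is set to 0
  beyond \<open>M\<close>, after \<open>M\<close> summations only the empty excursion has weight,
  and monotone convergence lets \<open>M\<close> grow. For the mean length the constant of the
  affine function is not computed, only caught between 1 plus the sum of \<open>2 * k * q k\<close>
  and the product of \<open>1 + 2 * k * q k / (1 - q k)\<close>.

  Positions of solitons enter the measures only through one fact: the hull of a
  \<open>k\<close>-soliton contains no \<open>k\<close>-slot. Hence the entries of the slot diagram
  at level \<open>k\<close> add up to the number of \<open>k\<close>-solitons.\<close>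

section \<open>Run lengths of excursions\<close>

text \<open>\<open>dyck s h xs\<close>: the path that starts at height \<open>h\<close> and takes runs of lengths \<open>xs\<close>, the first
  one in direction \<open>s\<close> and then alternating, ends at height \<open>0\<close> without becoming negative.\<close>

fun dyck :: "int \<Rightarrow> int \<Rightarrow> nat list \<Rightarrow> bool" where
  "dyck s h [] = (h = 0)"
| "dyck s h (x # xs) = (h + s * int x \<ge> 0 \<and> dyck (- s) (h + s * int x) xs)"

definition run_lists :: "nat \<Rightarrow> nat list set" where
  "run_lists k = {xs. dyck 1 0 xs \<and> (\<forall>x \<in> set xs. k \<le> x)}"

text \<open>Inverse of the deletion step, at the \<open>j\<close>-th place. An entry \<open>x\<close> offers \<open>x - k\<close> places: it is
  split as \<open>c, k, b\<close> with \<open>c + b - k = x\<close> and \<open>k < c \<le> x\<close>.\<close>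

fun insert_run_aux :: "nat \<Rightarrow> nat \<Rightarrow> nat list \<Rightarrow> nat list" where
  "insert_run_aux k j [] = []"
| "insert_run_aux k j (x # xs) =
     (if j < x - k then (k + j + 1) # k # (x - j - 1) # xs else x # insert_run_aux k (j - (x - k)) xs)"

fun insert_run :: "nat \<Rightarrow> nat \<Rightarrow> nat list \<Rightarrow> nat list" where
  "insert_run k 0 xs = k # k # xs"
| "insert_run k (Suc j) xs = insert_run_aux k j xs"

text \<open>For \<open>j \<le> room k xs\<close> the run inserted by \<open>insert_run k j xs\<close> becomes the first one of length
  \<open>k\<close>; larger \<open>j\<close> are junk.\<close>

fun room :: "nat \<Rightarrow> nat list \<Rightarrow> nat" where
  "room k [] = 0"
| "room k (x # xs) = (if k < x then (x - k) + room k xs else 0)"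

text \<open>The default \<open>[]\<close> shortens the list for every \<open>k\<close>, so that
  \<open>soliton_sizes\<close> terminates on arbitrary lists. Deleting a shortest run of a run list
  never reaches it, since such a run always has a successor.\<close>

fun delete_run_aux :: "nat \<Rightarrow> nat list \<Rightarrow> nat list" where
  "delete_run_aux k (c # x # b # xs) = (if x = k then (c + b - k) # xs else c # delete_run_aux k (x # b # xs))"
| "delete_run_aux k xs = []"

fun delete_run :: "nat \<Rightarrow> nat list \<Rightarrow> nat list" where
  "delete_run k (x # y # xs) = (if x = k then xs else delete_run_aux k (x # y # xs))"
| "delete_run k xs = []"

section \<open>Soliton sizes by repeated deletion, and insertion as its inverse\<close>

lemma length_delete_run_aux: "length (delete_run_aux k xs) \<le> length xs - 2"
  by (induction k xs rule: delete_run_aux.induct) auto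

lemma length_delete_run: "xs \<noteq> [] \<Longrightarrow> length (delete_run k xs) < length xs"
proof (cases "(k, xs)" rule: delete_run.cases)
  case (1 k' x y zs)
  then show ?thesis using length_delete_run_aux[of k "x # y # zs"] by auto
qed auto

function soliton_sizes :: "nat list \<Rightarrow> nat list" where
  "soliton_sizes xs = (if xs = [] then [] else Min (set xs) # soliton_sizes (delete_run (Min (set xs)) xs))"
  by pat_completeness auto
termination by (relation "Wellfounded.measure length") (auto simp: length_delete_run)

declare soliton_sizes.simps [simp del]

lemma soliton_sizes_Nil [simp]: "soliton_sizes [] = []"
  by (simp add: soliton_sizes.simps)

text \<open>The runs \<open>c, k, b\<close> that replace \<open>x\<close> end at the same height,
  and their lowest new point is safe: in an ascent it is \<open>h + j + 1\<close>, in a descent it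
  is \<open>h - c\<close>, where \<open>c \<le> x\<close>.\<close>

lemma insert_run_aux_dyck:
  assumes "j < room k xs" "dyck s h xs" "s = 1 \<or> s = -1" "h \<ge> 0"
  shows "dyck s h (insert_run_aux k j xs)"
  using assms
proof (induction xs arbitrary: j s h)
  case (Cons x xs)
  show ?case
  proof (cases "j < x - k")
    case True
    then have "int (x - Suc j) = int x - int j - 1" by auto
    then show ?thesis using True Cons.prems by (auto simp: algebra_simps)
  next
    case False
    then have "j - (x - k) < room k xs" using Cons.prems by (auto split: if_splits)
    then have "dyck (- s) (h + s * int x) (insert_run_aux k (j - (x - k)) xs)"
      using Cons.prems by (intro Cons.IH) auto
    then show ?thesis using False Cons.prems by auto
  qed
qed auto

text \<open>Entries that are passed over keep their contribution \<open>x - k\<close>, the piece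
  before the inserted \<open>k\<close> contributes the rest of \<open>j + 1\<close>, and the
  \<open>k\<close> itself stops the count.\<close>

lemma insert_run_aux_props:
  assumes "j < room k xs" "\<forall>x \<in> set xs. k \<le> x"
  shows "(\<forall>x \<in> set (insert_run_aux k j xs). k \<le> x) \<and> k \<in> set (insert_run_aux k j xs) \<and>
    room k (insert_run_aux k j xs) = Suc j"
  using assms
proof (induction xs arbitrary: j)
  case (Cons x xs)
  show ?case
  proof (cases "j < x - k")
    case False
    then have j: "j - (x - k) < room k xs" "k < x" using Cons.prems by (auto split: if_splits)
    show ?thesis using Cons.IH[OF j(1)] Cons.prems False j by auto
  qed (use Cons.prems in auto)
qed auto

text \<open>The shape that unfolds a deletion after an insertion: three entries are present, and the
  leading one exceeds \<open>k\<close>, so the search goes past it.\<close>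

lemma insert_run_aux_Cons:
  assumes "j < room k xs"
  shows "\<exists>c x b zs. insert_run_aux k j xs = c # x # b # zs \<and> k < c"
  using assms 
proof (induction xs arbitrary: j)
  case (Cons x xs)
  show ?case
  proof (cases "j < x - k")
    case False
    then have j: "j - (x - k) < room k xs" "k < x" using Cons.prems by (auto split: if_splits)
    obtain c y b zs where "insert_run_aux k (j - (x - k)) xs = c # y # b # zs"
      using Cons.IH[OF j(1)] by blast
    then show ?thesis using False j(2) by auto
  qed auto
qed auto

lemma delete_insert_run_aux: "j < room k xs \<Longrightarrow> delete_run_aux k (insert_run_aux k j xs) = xs"
proof (induction xs arbitrary: j)
  case (Cons x xs)
  show ?case
  proof (cases "j < x - k")
    case False
    then have j: "j - (x - k) < room k xs" "k < x" using Cons.prems by (auto split: if_splits)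
    obtain c y b zs where "insert_run_aux k (j - (x - k)) xs = c # y # b # zs" "k < c"
      using insert_run_aux_Cons[OF j(1)] by blast
    then show ?thesis using Cons.IH[OF j(1)] False by auto
  qed auto
qed auto

lemma delete_insert_run: "j \<le> room k xs \<Longrightarrow> delete_run k (insert_run k j xs) = xs"
proof (cases j)
  case (Suc i)
  assume "j \<le> room k xs"
  with Suc have i: "i < room k xs" by auto
  obtain c y b zs where "insert_run_aux k i xs = c # y # b # zs" "k < c"
    using insert_run_aux_Cons[OF i(1)] by blast
  then show ?thesis using delete_insert_run_aux[OF i] Suc by auto
qed auto

lemma room_insert_run: "j \<le> room k xs \<Longrightarrow> xs \<in> run_lists k \<Longrightarrow> room k (insert_run k j xs) = j"
  using insert_run_aux_props[of "j - 1" k xs] by (cases j) (auto simp: run_lists_def)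

lemma insert_run_in_run_lists:
  assumes "j \<le> room k xs" "xs \<in> run_lists k"
  shows "insert_run k j xs \<in> run_lists k" "k \<in> set (insert_run k j xs)"
proof -
  have "insert_run k j xs \<in> run_lists k \<and> k \<in> set (insert_run k j xs)"
  proof (cases j)
    case (Suc i)
    then show ?thesis
      using assms insert_run_aux_props[of i k xs] insert_run_aux_dyck[of i k xs 1 0] by (simp add: run_lists_def)
  qed (use assms in \<open>auto simp: run_lists_def\<close>)
  then show "insert_run k j xs \<in> run_lists k" "k \<in> set (insert_run k j xs)" by auto
qed

text \<open>Merging \<open>c, k, b\<close> keeps the height after the three runs, and the merged
  entry is at least \<open>c\<close>, so all places to the left of the deleted run survive. A list
  of only two entries \<open>c, k\<close> with \<open>k < c\<close> is impossible: from a
  nonnegative height it would end strictly above 0.\<close>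

lemma delete_run_aux_props:
  assumes "dyck s h ys" "s = 1 \<or> s = -1" "h \<ge> 0" "\<forall>x \<in> set ys. k \<le> x" "k \<in> set ys" "k < hd ys" "0 < k"
  shows "dyck s h (delete_run_aux k ys) \<and> (\<forall>x \<in> set (delete_run_aux k ys). k \<le> x) \<and>
    0 < room k ys \<and> room k ys \<le> room k (delete_run_aux k ys) \<and>
    insert_run_aux k (room k ys - 1) (delete_run_aux k ys) = ys \<and>
    sum_list ys = sum_list (delete_run_aux k ys) + 2 * k \<and> length ys = length (delete_run_aux k ys) + 2"
  using assms
proof (induction k ys arbitrary: s h rule: delete_run_aux.induct)
  case (1 k c x b xs)
  show ?case
  proof (cases "x = k")
    case True
    then have "int (c + b - k) = int c + int b - int k" using 1(5) by auto
    then show ?thesis using True 1(2-) by (auto simp: algebra_simps)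
  next
    case False
    then have x: "k < x" using 1(5) by simp
    have IH: "dyck (- s) (h + s * int c) (delete_run_aux k (x # b # xs)) \<and>
      (\<forall>x \<in> set (delete_run_aux k (x # b # xs)). k \<le> x) \<and>
    0 < room k (x # b # xs) \<and> room k (x # b # xs) \<le> room k (delete_run_aux k (x # b # xs)) \<and>
    insert_run_aux k (room k (x # b # xs) - 1) (delete_run_aux k (x # b # xs)) = x # b # xs \<and>
    sum_list (x # b # xs) = sum_list (delete_run_aux k (x # b # xs)) + 2 * k \<and>
    length (x # b # xs) = length (delete_run_aux k (x # b # xs)) + 2"
      using False x 1(2-) by (intro 1(1)) auto
    have "room k (c # x # b # xs) = (c - k) + room k (x # b # xs)" using 1 by auto
    moreover have "delete_run_aux k (c # x # b # xs) = c # delete_run_aux k (x # b # xs)" using False by simp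
    moreover have "k < c" using 1 by auto
    ultimately show ?thesis using IH 1(2-) by auto
  qed
qed auto

lemma delete_run_props:
  assumes "ys \<in> run_lists k" "k \<in> set ys" "0 < k"
  shows "delete_run k ys \<in> run_lists k" "room k ys \<le> room k (delete_run k ys)" "insert_run k (room k ys) (delete_run k ys) = ys"
    "sum_list ys = sum_list (delete_run k ys) + 2 * k" "length ys = length (delete_run k ys) + 2"
proof -
  have "delete_run k ys \<in> run_lists k \<and> room k ys \<le> room k (delete_run k ys) \<and> insert_run k (room k ys) (delete_run k ys) = ys \<and>
    sum_list ys = sum_list (delete_run k ys) + 2 * k \<and> length ys = length (delete_run k ys) + 2"
  proof (cases "(k, ys)" rule: delete_run.cases)
    case (1 k' x y zs)
    show ?thesis
    proof (cases "x = k")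
      case False
      have "k \<le> x" using 1 assms(1) unfolding run_lists_def by simp
      then have "k < x" using 1 False by simp
      moreover have "delete_run k ys = delete_run_aux k ys" using 1 False by auto
      moreover have "insert_run k (room k ys) zs = insert_run_aux k (room k ys - 1) zs" if "0 < room k ys" for zs
        using that by (cases "room k ys") auto
      ultimately show ?thesis
        using 1 assms delete_run_aux_props[of 1 0 ys k] by (auto simp: run_lists_def simp del: room.simps)
    next
      case True
      \<comment> \<open>The first descent is at least \<open>k\<close> long and may not go below
        height 0.\<close>
      then have "y = k" using 1 assms unfolding run_lists_def by simp
      then show ?thesis using 1 assms True by (auto simp: run_lists_def)
    qed
  qed (use assms in \<open>auto simp: run_lists_def\<close>)
  then show "delete_run k ys \<in> run_lists k" "room k ys \<le> room k (delete_run k ys)" "insert_run k (room k ys) (delete_run k ys) = ys"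
    "sum_list ys = sum_list (delete_run k ys) + 2 * k" "length ys = length (delete_run k ys) + 2" by auto
qed

section \<open>Soliton sizes of a run list\<close>

lemma Min_run_list:
  assumes "xs \<in> run_lists k" "k \<in> set xs"
  shows "Min (set xs) = k"
  using assms by (intro Min_eqI) (auto simp: run_lists_def)

lemma run_lists_antimono: "k \<le> l \<Longrightarrow> run_lists l \<subseteq> run_lists k"
  by (auto simp: run_lists_def)

lemma run_list_Min:
  assumes "xs \<in> run_lists k" "xs \<noteq> []"
  shows "xs \<in> run_lists (Min (set xs))" "Min (set xs) \<in> set xs" "k \<le> Min (set xs)"
  using assms by (auto simp: run_lists_def)

lemma soliton_sizes_insert_run:
  assumes "j \<le> room k xs" "xs \<in> run_lists k"
  shows "soliton_sizes (insert_run k j xs) = k # soliton_sizes xs"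
  using insert_run_in_run_lists[OF assms] delete_insert_run[OF assms(1)] Min_run_list[of "insert_run k j xs" k]
  by (subst soliton_sizes.simps) auto

text \<open>The bound \<open>k\<close> stays fixed although the shortest length grows: what remains
  after deleting \<open>m \<ge> k\<close> lies in \<open>run_lists m\<close>, hence again in
  \<open>run_lists k\<close>.\<close>

lemma run_list_induct [consumes 2, case_names Nil step]:
  assumes "xs \<in> run_lists k" "0 < k"
    and "P []"
    and "\<And>xs m. xs \<in> run_lists m \<Longrightarrow> xs \<noteq> [] \<Longrightarrow> 0 < m \<Longrightarrow> k \<le> m \<Longrightarrow> m \<in> set xs \<Longrightarrow> delete_run m xs \<in> run_lists m \<Longrightarrow>
      soliton_sizes xs = m # soliton_sizes (delete_run m xs) \<Longrightarrow> P (delete_run m xs) \<Longrightarrow> P xs"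
  shows "P xs"
  using assms(1)
proof (induction xs rule: length_induct)
  case (1 xs)
  show ?case
  proof (cases "xs = []")
    case False
    let ?m = "Min (set xs)"
    note m = run_list_Min[OF 1(2) False]
    have d: "delete_run ?m xs \<in> run_lists ?m" using m assms(2) by (intro delete_run_props) auto
    have "P (delete_run ?m xs)"
      using 1(1) length_delete_run[OF False] d m(3) run_lists_antimono by blast
    then show ?thesis using assms(2,4) m d False by (simp add: soliton_sizes.simps)
  qed (simp add: assms)
qed

lemma set_soliton_sizes: "xs \<in> run_lists k \<Longrightarrow> 0 < k \<Longrightarrow> set (soliton_sizes xs) \<subseteq> {k..}"
  by (induction rule: run_list_induct) auto

text \<open>Each deletion of an \<open>m\<close> takes away two runs and total length
  \<open>2 * m\<close>.\<close>

lemma sum_list_length_soliton_sizes: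
  "xs \<in> run_lists k \<Longrightarrow> 0 < k \<Longrightarrow> sum_list xs = 2 * sum_list (soliton_sizes xs) \<and> length xs = 2 * length (soliton_sizes xs)"
proof (induction rule: run_list_induct)
  case (step xs m)
  then show ?case using delete_run_props(4,5)[of xs m] by auto
qed auto

text \<open>With all runs longer than \<open>k\<close> nothing stops the count, so
  \<open>room\<close> is the total length minus \<open>k\<close> times the number of runs, and the
  soliton sizes determine both. One more than this is the number of \<open>k\<close>-slots.\<close>

lemma room_run_list_Suc: "xs \<in> run_lists (Suc k) \<Longrightarrow> room k xs = (\<Sum>l\<leftarrow>soliton_sizes xs. 2 * (l - k))"
proof -
  assume xs: "xs \<in> run_lists (Suc k)"
  have "\<forall>x \<in> set ys. Suc k \<le> x \<Longrightarrow> room k ys + k * length ys = sum_list ys" for ys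
    by (induction ys) auto
  then have "room k xs + k * length xs = sum_list xs" using xs by (auto simp: run_lists_def)
  moreover have "\<forall>x \<in> set ys. Suc k \<le> x \<Longrightarrow> (\<Sum>l\<leftarrow>ys. 2 * (l - k)) + 2 * k * length ys = 2 * sum_list ys" for ys
    by (induction ys) auto
  then have "(\<Sum>l\<leftarrow>soliton_sizes xs. 2 * (l - k)) + 2 * k * length (soliton_sizes xs) = 2 * sum_list (soliton_sizes xs)"
    using set_soliton_sizes[OF xs] by auto
  ultimately show ?thesis using sum_list_length_soliton_sizes[OF xs] by simp
qed

section \<open>Run lists with a given number of solitons of the smallest size\<close>

definition run_lists_num :: "nat \<Rightarrow> nat \<Rightarrow> nat list set" where
  "run_lists_num k x = {xs \<in> run_lists k. count_list (soliton_sizes xs) k = x}"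

lemma run_lists_num_0:
  assumes "0 < k"
  shows "run_lists_num k 0 = run_lists (Suc k)"
proof -
  have "xs \<in> run_lists (Suc k)" if "xs \<in> run_lists k" "k \<notin> set (soliton_sizes xs)" for xs
  proof -
    have "k \<notin> set xs"
    proof
      assume k: "k \<in> set xs"
      then have "soliton_sizes xs = k # soliton_sizes (delete_run k xs)"
        using Min_run_list[OF that(1) k] by (subst soliton_sizes.simps) auto
      then show False using that(2) by auto
    qed
    then show ?thesis using that(1) by (auto simp: run_lists_def) (metis le_neq_implies_less less_eq_Suc_le)
  qed
  moreover have "k \<notin> set (soliton_sizes xs)" if "xs \<in> run_lists (Suc k)" for xs
    using set_soliton_sizes[OF that] by auto
  ultimately show ?thesis using run_lists_antimono[of k "Suc k"]
    by (auto simp: run_lists_num_def count_list_0_iff)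
qed

text \<open>The place of an insertion can be read off afterwards: the inserted run is the first of
  length \<open>k\<close>, hence \<open>room\<close> of the result is \<open>j\<close>. The next
  insertion has exactly the places up to \<open>j\<close>, so repeated insertions form weakly
  decreasing sequences of places.\<close>

lemma bij_betw_insert_run:
  assumes "0 < k"
  shows "bij_betw (\<lambda>(xs, j). insert_run k j xs) (Sigma (run_lists_num k x) (\<lambda>xs. {..room k xs}))
    (run_lists_num k (Suc x))"
proof (rule bij_betw_byWitness[where f' = "\<lambda>ys. (delete_run k ys, room k ys)"])
  show "\<forall>a \<in> Sigma (run_lists_num k x) (\<lambda>xs. {..room k xs}).
      (delete_run k (case a of (xs, j) \<Rightarrow> insert_run k j xs), room k (case a of (xs, j) \<Rightarrow> insert_run k j xs)) = a"
    by (auto simp: run_lists_num_def delete_insert_run room_insert_run)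
  \<comment> \<open>Some soliton has size \<open>k\<close>, and none is smaller than the current
    shortest run. As all runs are at least \<open>k\<close> long, the shortest one has length
    \<open>k\<close>, and the next deletion is the one to be undone.\<close>
  have *: "k \<in> set ys \<and> soliton_sizes ys = k # soliton_sizes (delete_run k ys)" if "ys \<in> run_lists_num k (Suc x)" for ys
  proof -
    have ys: "ys \<in> run_lists k" "count_list (soliton_sizes ys) k = Suc x" using that by (auto simp: run_lists_num_def)
    then have "ys \<noteq> []" by auto
    note m = run_list_Min[OF ys(1) this]
    have "k \<in> set (soliton_sizes ys)" using ys by (metis count_list_0_iff nat.distinct(1))
    then have "Min (set ys) \<le> k" using set_soliton_sizes[OF m(1)] m(3) assms by auto
    then have "Min (set ys) = k" using m by auto
    then show ?thesis using m \<open>ys \<noteq> []\<close> by (auto simp: soliton_sizes.simps[of ys])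
  qed
  show "\<forall>ys \<in> run_lists_num k (Suc x). (case (delete_run k ys, room k ys) of (xs, j) \<Rightarrow> insert_run k j xs) = ys"
    using * assms by (auto simp: run_lists_num_def delete_run_props)
  show "(\<lambda>(xs, j). insert_run k j xs) ` Sigma (run_lists_num k x) (\<lambda>xs. {..room k xs}) \<subseteq> run_lists_num k (Suc x)"
    by (auto simp: run_lists_num_def soliton_sizes_insert_run insert_run_in_run_lists)
  show "(\<lambda>ys. (delete_run k ys, room k ys)) ` run_lists_num k (Suc x) \<subseteq> Sigma (run_lists_num k x) (\<lambda>xs. {..room k xs})"
  proof
    fix a assume "a \<in> (\<lambda>ys. (delete_run k ys, room k ys)) ` run_lists_num k (Suc x)"
    then obtain ys where ys: "a = (delete_run k ys, room k ys)" "ys \<in> run_lists_num k (Suc x)" by blast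
    have "ys \<in> run_lists k" "count_list (soliton_sizes (delete_run k ys)) k = x"
      using ys(2) *[OF ys(2)] by (auto simp: run_lists_num_def)
    then show "a \<in> Sigma (run_lists_num k x) (\<lambda>xs. {..room k xs})"
      using *[OF ys(2)] assms ys(1) delete_run_props(1,2)[of ys k] by (auto simp: run_lists_num_def)
  qed
qed

section \<open>One step of the Takahashi-Satsuma algorithm\<close>

lemma delete_run_aux_append:
  "k \<notin> set us \<Longrightarrow> delete_run_aux k (us @ c # k # b # vs) = us @ (c + b - k) # vs"
proof (induction us)
  case (Cons u us)
  then show ?case by (cases us; cases "tl us") auto
qed auto

text \<open>Before a last run \<open>k\<close> the path has either just risen by more than
  \<open>k\<close>, or has just descended to a height of at least 0; either way it ends above 0.
  This provides the first shortest run with a successor, which supplies the other half of the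
  soliton.\<close>

lemma not_dyck_snoc:
  assumes "dyck s h (us @ [k])" "s = 1 \<or> s = -1" "h \<ge> 0" "\<forall>u \<in> set us. k < u" "us \<noteq> []" "0 < k"
  shows False
  using assms
proof (induction us arbitrary: s h)
  case (Cons u us)
  show ?case
  proof (cases us)
    case Nil
    then show ?thesis using Cons by auto
  next
    case (Cons v ws)
    then show ?thesis using Cons.prems Cons.IH[of "- s" "h + s * int u"] by auto
  qed
qed auto

lemma run_list_split:
  assumes "us @ k # ws \<in> run_lists k" "k \<notin> set us" "0 < k"
  obtains b vs where "ws = b # vs" "k \<le> b"
    "us = [] \<Longrightarrow> b = k \<and> delete_run k (us @ k # ws) = vs"
    "\<And>us' c. us = us' @ [c] \<Longrightarrow> delete_run k (us @ k # ws) = us' @ (c + b - k) # vs"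
proof (cases ws)
  case Nil
  have "\<forall>u \<in> set us. k < u" using assms by (auto simp: run_lists_def le_less)
  then have False using assms Nil not_dyck_snoc[of 1 0 us k] by (cases "us = []") (auto simp: run_lists_def)
  then show ?thesis ..
next
  case (Cons b vs)
  have "delete_run k (us @ k # ws) = us' @ (c + b - k) # vs" if "us = us' @ [c]" for us' c
  proof -
    have "us @ k # ws = us' @ c # k # b # vs" using that Cons by simp
    moreover have "delete_run k (us' @ c # k # b # vs) = delete_run_aux k (us' @ c # k # b # vs)"
      using assms(2) that by (cases us'; cases "tl us'") auto
    ultimately show ?thesis using delete_run_aux_append[of k us' c b vs] assms(2) that by simp
  qed
  moreover have "b = k \<and> delete_run k (us @ k # ws) = vs" if "us = []"
    using assms(1) that Cons by (auto simp: run_lists_def)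
  moreover have "k \<le> b" using assms Cons by (auto simp: run_lists_def)
  ultimately show ?thesis using that Cons by blast
qed

section \<open>Runs of a configuration as an ordered list of blocks\<close>

definition block_less :: "int set \<Rightarrow> int set \<Rightarrow> bool" where
  "block_less A B \<longleftrightarrow> (\<forall>a \<in> A. \<forall>b \<in> B. a < b)"

fun alternating :: "(int \<Rightarrow> int) \<Rightarrow> int \<Rightarrow> int set list \<Rightarrow> bool" where
  "alternating \<eta> c [] = True"
| "alternating \<eta> c (B # Bs) = ((\<forall>z \<in> B. \<eta> z = c) \<and> alternating \<eta> (1 - c) Bs)"

text \<open>The blocks are meant to be the runs from left to right. Colour 0 comes first because the
  leftmost run is the infinite one of empty boxes.\<close>

definition run_partition :: "(int \<Rightarrow> int) \<Rightarrow> int set list \<Rightarrow> bool" where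
  "run_partition \<eta> Bs \<longleftrightarrow> (\<forall>B \<in> set Bs. B \<noteq> {}) \<and> sorted_wrt block_less Bs \<and> alternating \<eta> 0 Bs"

lemma alternating_append:
  "alternating \<eta> c (Xs @ Ys) \<longleftrightarrow>
     alternating \<eta> c Xs \<and> alternating \<eta> (if even (length Xs) then c else 1 - c) Ys"
  by (induction Xs arbitrary: c) auto

lemma alternating_nth:
  "alternating \<eta> c Bs \<Longrightarrow> i < length Bs \<Longrightarrow> z \<in> Bs ! i \<Longrightarrow> \<eta> z = (if even i then c else 1 - c)"
proof (induction Bs arbitrary: c i)
  case (Cons B Bs)
  then show ?case by (cases i) auto
qed auto

lemma run_partition_nth_less:
  assumes "run_partition \<eta> Bs" "i < j" "j < length Bs" "a \<in> Bs ! i" "b \<in> Bs ! j"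
  shows "a < b"
  using assms by (auto simp: run_partition_def block_less_def sorted_wrt_iff_nth_less)

lemma in_Union_set_nth: "z \<in> \<Union>(set Bs) \<longleftrightarrow> (\<exists>i < length Bs. z \<in> Bs ! i)"
  by (auto simp: set_conv_nth)

text \<open>Meeting blocks \<open>i < j\<close> would force a box of block \<open>i + 1\<close> into
  the interval, and that block has the other colour than block \<open>i\<close>.\<close>

lemma constant_interval_subset:
  assumes P: "run_partition \<eta> Bs" and A: "constant_interval \<eta> (\<Union>(set Bs)) A"
  shows "\<exists>B \<in> set Bs. A \<subseteq> B"
proof -
  have *: False if "a \<in> A" "b \<in> A" "a \<in> Bs ! i" "b \<in> Bs ! j" "i < j" "j < length Bs" for a b i j
  proof -
    have "Bs ! Suc i \<noteq> {}" using P that by (auto simp: run_partition_def)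
    \<comment> \<open>For neighbouring blocks \<open>z\<close> is \<open>b\<close> itself, so that
      \<open>a \<le> z\<close> and \<open>z \<le> b\<close> hold in all cases.\<close>
    then have "\<exists>z. z \<in> Bs ! Suc i \<and> (Suc i = j \<longrightarrow> z = b)" using that by (cases "Suc i = j") auto
    then obtain z where z: "z \<in> Bs ! Suc i" "Suc i = j \<longrightarrow> z = b" by blast
    have "a \<le> z" using run_partition_nth_less[OF P _ _ that(3) z(1)] that by auto
    moreover have "z \<le> b"
      using run_partition_nth_less[OF P _ _ z(1) that(4)] that z by (cases "Suc i = j") auto
    moreover have "z \<in> \<Union>(set Bs)"
      unfolding in_Union_set_nth using z that by (intro exI[of _ "Suc i"]) auto
    ultimately have "z \<in> A" using A that unfolding constant_interval_def by blast
    then have "\<eta> z = \<eta> a" using A that unfolding constant_interval_def by metis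
    moreover have "\<eta> a = (if even i then 0 else 1 - 0)" "\<eta> z = (if even (Suc i) then 0 else 1 - 0)"
      using P z(1) that alternating_nth[of \<eta> 0 Bs i a] alternating_nth[of \<eta> 0 Bs "Suc i" z]
      by (simp_all add: run_partition_def)
    ultimately show False by (auto split: if_splits)
  qed
  obtain a where a: "a \<in> A" using A by (auto simp: constant_interval_def)
  moreover have AR: "A \<subseteq> \<Union>(set Bs)" using A by (auto simp: constant_interval_def)
  ultimately have "a \<in> \<Union>(set Bs)" by blast
  then obtain i where i: "i < length Bs" "a \<in> Bs ! i" unfolding in_Union_set_nth by blast
  have "b \<in> Bs ! i" if "b \<in> A" for b
  proof -
    have "b \<in> \<Union>(set Bs)" using that AR by blast
    then obtain j where "j < length Bs" "b \<in> Bs ! j" unfolding in_Union_set_nth by blast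
    then show ?thesis using *[OF a that] *[OF that a] i by (metis linorder_neqE_nat)
  qed
  then show ?thesis using i by (meson nth_mem subsetI)
qed

lemma constant_interval_block:
  assumes P: "run_partition \<eta> Bs" and "B \<in> set Bs"
  shows "constant_interval \<eta> (\<Union>(set Bs)) B"
proof -
  obtain i where i: "i < length Bs" "B = Bs ! i" using assms(2) by (metis in_set_conv_nth)
  have "z \<in> B" if ab: "a \<in> B" "b \<in> B" "z \<in> \<Union>(set Bs)" "a \<le> z" "z \<le> b" for a b z
  proof -
    obtain j where "j < length Bs" "z \<in> Bs ! j" using ab(3) unfolding in_Union_set_nth by blast
    moreover have "\<not> j < i" "\<not> i < j"
      using i ab calculation run_partition_nth_less[OF P, of j i z a] run_partition_nth_less[OF P, of i j b z] by auto
    ultimately show ?thesis using i by (metis linorder_neqE_nat)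
  qed
  moreover have "B \<noteq> {}" using assms by (auto simp: run_partition_def)
  moreover have "\<exists>c. \<forall>z \<in> B. \<eta> z = c"
    using P i alternating_nth[of \<eta> 0 Bs i] by (auto simp: run_partition_def)
  ultimately show ?thesis using assms(2) unfolding constant_interval_def by blast
qed

lemma block_unique:
  assumes "run_partition \<eta> Bs" "B \<in> set Bs" "C \<in> set Bs" "z \<in> B" "z \<in> C"
  shows "B = C"
  using assms run_partition_nth_less[OF assms(1)] by (metis in_set_conv_nth less_irrefl linorder_neqE_nat)

lemma is_run_iff:
  assumes P: "run_partition \<eta> Bs"
  shows "is_run \<eta> (\<Union>(set Bs)) A \<longleftrightarrow> A \<in> set Bs"
proof
  assume A: "is_run \<eta> (\<Union>(set Bs)) A"
  then have "constant_interval \<eta> (\<Union>(set Bs)) A" by (simp add: is_run_def)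
  then obtain B where "B \<in> set Bs" "A \<subseteq> B" using constant_interval_subset[OF P] by blast
  then show "A \<in> set Bs" using A constant_interval_block[OF P] by (auto simp: is_run_def)
next
  assume A: "A \<in> set Bs"
  have "B = A" if B: "constant_interval \<eta> (\<Union>(set Bs)) B" "A \<subseteq> B" for B
  proof -
    obtain C where C: "C \<in> set Bs" "B \<subseteq> C" using constant_interval_subset[OF P B(1)] by blast
    obtain a where "a \<in> A" using P A by (auto simp: run_partition_def)
    then have "C = A" using block_unique[OF P C(1) A] C B by blast
    then show ?thesis using C B by blast
  qed
  then show "is_run \<eta> (\<Union>(set Bs)) A" using constant_interval_block[OF P A] by (auto simp: is_run_def)
qed

text \<open>An infinite set has \<open>card\<close> 0, so finiteness below \<open>f\<close> is what
  makes the number of smaller boxes monotone.\<close>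

lemma first_boxes_initial:
  assumes "f \<in> first_boxes k B" "z \<in> B" "z \<le> f" "finite {w \<in> B. w < f}"
  shows "z \<in> first_boxes k B"
proof -
  have "card {w \<in> B. w < z} \<le> card {w \<in> B. w < f}" using assms by (intro card_mono) auto
  then show ?thesis using assms by (auto simp: first_boxes_def)
qed

text \<open>In the increasing enumeration of \<open>B\<close> exactly \<open>i\<close> boxes precede
  entry \<open>i\<close>, so the first boxes are the entries with index below
  \<open>k\<close>.\<close>

lemma card_first_boxes:
  assumes "finite B" "k \<le> card B"
  shows "card (first_boxes k B) = k"
proof -
  define bs where "bs = sorted_list_of_set B"
  have bs: "set bs = B" "sorted_wrt (<) bs" "length bs = card B" "distinct bs"
    using assms by (auto simp: bs_def)
  have less: "bs ! i < bs ! j \<longleftrightarrow> i < j" if "i < card B" "j < card B" for i j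
    using bs that by (metis linorder_neqE_nat not_less_iff_gr_or_eq sorted_wrt_nth_less)
  have mem: "w \<in> B \<longleftrightarrow> (\<exists>i < card B. w = bs ! i)" for w
    unfolding bs(1)[symmetric] in_set_conv_nth bs(3) by auto
  have card_less: "card {w \<in> B. w < bs ! i} = i" if i: "i < card B" for i
  proof -
    have "{w \<in> B. w < bs ! i} = (!) bs ` {..<i}"
    proof (intro set_eqI iffI)
      fix w assume "w \<in> {w \<in> B. w < bs ! i}"
      then show "w \<in> (!) bs ` {..<i}" using less i unfolding mem by auto
    next
      fix w assume "w \<in> (!) bs ` {..<i}"
      then obtain j where "j < i" "w = bs ! j" by auto
      then show "w \<in> {w \<in> B. w < bs ! i}" using less[of j i] i mem[of w] by (auto intro: exI[of _ j])
    qed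
    moreover have "inj_on ((!) bs) {..<i}" using i bs by (auto intro: inj_on_nth)
    ultimately show ?thesis by (simp add: card_image)
  qed
  have "first_boxes k B = (!) bs ` {..<k}"
  proof (intro set_eqI iffI)
    fix w assume "w \<in> first_boxes k B"
    then show "w \<in> (!) bs ` {..<k}" using card_less unfolding first_boxes_def mem by auto
  next
    fix w assume "w \<in> (!) bs ` {..<k}"
    then obtain j where "j < k" "w = bs ! j" by auto
    then show "w \<in> first_boxes k B"
      using card_less[of j] assms(2) mem[of w] by (auto simp: first_boxes_def intro: exI[of _ j])
  qed
  moreover have "inj_on ((!) bs) {..<k}" using assms bs by (auto intro: inj_on_nth)
  ultimately show ?thesis by (simp add: card_image)
qed

text \<open>A box beyond \<open>N\<close> has all of \<open>B\<close>, hence at least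
  \<open>k\<close> boxes, in front of it. A soliton therefore does not see whether the last run is
  cut off at \<open>N\<close>.\<close>

lemma first_boxes_extend:
  assumes "B \<subseteq> {1..N}" "k \<le> card B"
  shows "first_boxes k (B \<union> {N + 1..}) = first_boxes k B"
proof -
  have fin: "finite B" using assms(1) finite_subset by blast
  have "{w \<in> B \<union> {N + 1..}. w < z} = {w \<in> B. w < z}" if "z \<in> B" for z
    using that assms(1) by force
  moreover have "\<not> card {w \<in> B \<union> {N + 1..}. w < z} < k" if "z \<ge> N + 1" for z
  proof -
    have "finite {w \<in> B \<union> {N + 1..}. w < z}" by (rule finite_subset[of _ "B \<union> {N + 1..z}"]) (use fin in auto)
    moreover have "B \<subseteq> {w \<in> B \<union> {N + 1..}. w < z}" using assms(1) that by force
    ultimately show ?thesis using assms(2) card_mono by (metis leD order.trans)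
  qed
  ultimately show ?thesis unfolding first_boxes_def by auto
qed

text \<open>\<open>C\<close> and \<open>B\<close> have the same colour and lose the run
  \<open>A\<close> between them, so what is left of \<open>B\<close> joins \<open>C\<close>. For
  \<open>F = B\<close> just \<open>C\<close> remains, and the colours still alternate because two
  blocks have gone.\<close>

lemma run_partition_delete:
  assumes "run_partition \<eta> (Cs @ C # A # B # Ys)" "F \<subseteq> B"
  shows "run_partition \<eta> (Cs @ (C \<union> (B - F)) # Ys)"
    "\<Union>(set (Cs @ C # A # B # Ys)) - (A \<union> F) = \<Union>(set (Cs @ (C \<union> (B - F)) # Ys))"
proof -
  show "run_partition \<eta> (Cs @ (C \<union> (B - F)) # Ys)"
    using assms by (auto simp: run_partition_def sorted_wrt_append alternating_append block_less_def)
  have "z \<notin> A \<union> B" if "z \<in> X" "X \<in> set Cs \<union> set Ys \<union> {C}" for z X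
    using that assms by (fastforce simp: run_partition_def sorted_wrt_append block_less_def)
  moreover have "A \<inter> B = {}"
    using assms by (fastforce simp: run_partition_def sorted_wrt_append block_less_def)
  ultimately show "\<Union>(set (Cs @ C # A # B # Ys)) - (A \<union> F) = \<Union>(set (Cs @ (C \<union> (B - F)) # Ys))"
    using assms(2) by auto
qed

lemma next_run_iff:
  assumes P: "run_partition \<eta> (Xs @ A # B # Ys)"
  shows "next_run \<eta> (\<Union>(set (Xs @ A # B # Ys))) A X \<longleftrightarrow> X = B"
proof
  have ne: "A \<noteq> {}" "B \<noteq> {}" using P by (auto simp: run_partition_def)
  have less: "\<forall>a \<in> A. \<forall>b \<in> B. a < b" "\<forall>X \<in> set Xs. \<forall>x \<in> X. \<forall>a \<in> A. x < a" "\<forall>Y \<in> set Ys. \<forall>b \<in> B. \<forall>y \<in> Y. b < y"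
    using P by (auto simp: run_partition_def sorted_wrt_append block_less_def)
  { assume X: "next_run \<eta> (\<Union>(set (Xs @ A # B # Ys))) A X"
    then have "X \<in> set (Xs @ A # B # Ys)" and AX: "\<forall>a \<in> A. \<forall>b \<in> X. a < b"
      using is_run_iff[OF P] by (auto simp: next_run_def)
    moreover have "X \<noteq> {}" using P calculation(1) by (auto simp: run_partition_def)
    moreover have "X \<notin> set Xs"
      using less(2) AX ne \<open>X \<noteq> {}\<close> by (meson all_not_in_conv less_asym)
    moreover have "X \<noteq> A" using AX ne by blast
    moreover have "X \<notin> set Ys"
    proof
      assume Y: "X \<in> set Ys"
      obtain z where z: "z \<in> B" using ne by blast
      then have "\<forall>a \<in> A. a < z" using less by blast
      then obtain b where "b \<in> X" "b \<le> z" using X z unfolding next_run_def by auto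
      then show False using less(3) Y z by fastforce
    qed
    ultimately show "X = B" by auto }
  assume "X = B"
  moreover have "\<exists>b \<in> B. b \<le> z" if "z \<in> \<Union>(set (Xs @ A # B # Ys))" "\<forall>a \<in> A. a < z" for z
  proof -
    obtain b where b: "b \<in> B" using ne by blast
    obtain a where a: "a \<in> A" using ne by blast
    have "z \<notin> \<Union>(set Xs)" "z \<notin> A" using less(2) that(2) a by (meson UnionE less_asym less_irrefl)+
    then have "z \<in> B \<or> z \<in> \<Union>(set Ys)" using that(1) by auto
    then show ?thesis using b less(3) by (meson UnionE less_imp_le order_refl)
  qed
  ultimately show "next_run \<eta> (\<Union>(set (Xs @ A # B # Ys))) A X"
    using is_run_iff[OF P] less(1) unfolding next_run_def by auto
qed

text \<open>Blocks are cut off at \<open>N\<close>; the actual last run continues to infinity.\<close>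

definition extend_last :: "int \<Rightarrow> int set list \<Rightarrow> int set list" where
  "extend_last N Bs = butlast Bs @ [last Bs \<union> {N + 1..}]"

text \<open>Ties the geometry to the run lengths: \<open>{..0}\<close> is the infinite run on the
  left, and \<open>Fs\<close> are the finite parts of the other runs. For \<open>Fs = []\<close> one
  block receives both infinite ends; this is the final state of the algorithm.\<close>

definition ts_state :: "int \<Rightarrow> (int \<Rightarrow> int) \<Rightarrow> int set list \<Rightarrow> nat list \<Rightarrow> bool" where
  "ts_state N \<eta> Fs xs \<longleftrightarrow> xs \<in> run_lists 1 \<and> map card Fs = xs \<and> (\<forall>F \<in> set Fs. F \<subseteq> {1..N}) \<and>
     run_partition \<eta> (extend_last N ({..0} # Fs))"

definition boxes :: "int \<Rightarrow> int set list \<Rightarrow> int set" where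
  "boxes N Fs = \<Union>(set (extend_last N ({..0} # Fs)))"

section \<open>One step of the algorithm on the list of blocks\<close>

lemma extend_last_append: "Ys \<noteq> [] \<Longrightarrow> extend_last N (Xs @ Ys) = Xs @ extend_last N Ys"
  by (simp add: extend_last_def butlast_append)

lemma extend_last_Cons: "Ys \<noteq> [] \<Longrightarrow> extend_last N (X # Ys) = X # extend_last N Ys"
  by (simp add: extend_last_def)

lemma extend_last_superset:
  assumes "X \<in> set Bs"
  shows "\<exists>X' \<in> set (extend_last N Bs). X \<subseteq> X'"
proof -
  have "Bs \<noteq> []" using assms by auto
  then have "set Bs = set (butlast Bs) \<union> {last Bs}"
    by (metis append_butlast_last_id set_append list.simps(15) list.set(1))
  then show ?thesis using assms by (auto simp: extend_last_def)
qed

lemma infinite_atLeast_int: "infinite (X \<union> {n::int..})" "infinite {..n::int}"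
  using infinite_Ici[of n] infinite_Iic[of n] by (auto simp: infinite_Iic)

lemma finite_in_extend_last:
  assumes "X \<in> set (extend_last N ({..0} # Fs))" "finite X"
  shows "X \<in> set Fs"
  using assms infinite_atLeast_int
  by (cases "Fs = []") (auto simp: extend_last_def dest: in_set_butlastD)

text \<open>Every finite run is a block of \<open>Fs\<close>, and the first entry \<open>k\<close>
  belongs to a block with a successor, so this block is a finite run and the leftmost smallest one.
  The step is thus unique and acts on the lengths as \<open>delete_run\<close>. The last conjunct
  says that the removed boxes are consecutive at that time; it later keeps slots away from
  supports.\<close>

lemma ts_state_step:
  assumes st: "ts_state N \<eta> Fs xs" and "xs \<noteq> []" and k: "k = Min (set xs)"
  shows "\<exists>S Fs'. (\<forall>k' S'. ts_step \<eta> (boxes N Fs) k' S' \<longleftrightarrow> k' = k \<and> S' = S) \<and>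
    ts_state N \<eta> Fs' (delete_run k xs) \<and> boxes N Fs' = boxes N Fs - S \<and> S \<subseteq> boxes N Fs \<inter> {1..N} \<and>
    card {z \<in> S. \<eta> z = 1} = k \<and> card {z \<in> S. \<eta> z = 0} = k \<and>
    (\<forall>z \<in> boxes N Fs. \<forall>a \<in> S. \<forall>b \<in> S. a \<le> z \<and> z \<le> b \<longrightarrow> z \<in> S)"
proof -
  have xs1: "xs \<in> run_lists 1" using st by (simp add: ts_state_def)
  then have xs: "xs \<in> run_lists k" "k \<in> set xs" "1 \<le> k" using run_list_Min assms(2) k by auto
  then have k0: "0 < k" by simp
  obtain us ws where us: "xs = us @ k # ws" "k \<notin> set us" using split_list_first[OF xs(2)] by blast
  obtain b vs where ws: "ws = b # vs" "k \<le> b" "us = [] \<Longrightarrow> b = k \<and> delete_run k xs = vs"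
    "\<And>us' c. us = us' @ [c] \<Longrightarrow> delete_run k xs = us' @ (c + b - k) # vs"
    using run_list_split[of us k ws] xs us by auto
  have "map card Fs = us @ k # b # vs" using st us ws by (simp add: ts_state_def)
  then obtain Us A B Vs where Fs: "Fs = Us @ A # B # Vs" "map card Us = us" "card A = k" "card B = b" "map card Vs = vs"
    by (auto simp: map_eq_append_conv map_eq_Cons_conv)
  have sub: "F \<subseteq> {1..N}" if "F \<in> set Fs" for F using st that by (auto simp: ts_state_def)
  then have fin: "finite F" if "F \<in> set Fs" for F using that finite_subset by blast
  \<comment> \<open>\<open>B1 # Ys\<close> are the true runs from \<open>B\<close> on, with the
    unbounded end attached to the last one; \<open>C\<close> is the run before \<open>A\<close>,
    namely \<open>{..0}\<close> if \<open>A\<close> comes first.\<close>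
  define B1 where "B1 = (if Vs = [] then B \<union> {N + 1..} else B)"
  define Ys where "Ys = (if Vs = [] then [] else extend_last N Vs)"
  define Cs C where "Cs = butlast ({..0} # Us)" and "C = last ({..0} # Us)"
  have CC: "{..0} # Us = Cs @ [C]" by (simp add: Cs_def C_def)
  define E where "E = Cs @ C # A # B1 # Ys"
  have E': "extend_last N ({..0} # Fs) = ({..0} # Us) @ A # B1 # Ys"
    unfolding Fs(1) append_Cons[symmetric]
    by (cases "Vs = []") (simp_all add: extend_last_append extend_last_Cons B1_def Ys_def, simp_all add: extend_last_def)
  then have E: "extend_last N ({..0} # Fs) = E" by (simp only: CC E_def append_assoc append_Cons append_Nil)
  have P: "run_partition \<eta> E" using st E by (simp add: ts_state_def)
  have R: "boxes N Fs = \<Union>(set E)" by (simp add: boxes_def E)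
  define F where "F = first_boxes k B1"
  have B: "B \<subseteq> {1..N}" "finite B" using sub fin Fs by auto
  have Feq: "F = first_boxes k B" using first_boxes_extend[OF B(1)] ws Fs by (auto simp: F_def B1_def)
  have FB: "F \<subseteq> B" "F \<subseteq> B1" by (auto simp: Feq first_boxes_def B1_def)
  have cF: "card F = k" using card_first_boxes B ws Fs Feq by auto
  have A: "A \<subseteq> {1..N}" "finite A" using sub fin Fs by auto
  have Ane: "A \<noteq> {}" using Fs k0 by auto
  define S where "S = A \<union> F"
  have less: "\<forall>a \<in> A. \<forall>b \<in> B1. a < b" "\<forall>X \<in> set Cs \<union> {C}. \<forall>x \<in> X. \<forall>a \<in> A \<union> B1. x < a"
    "\<forall>Y \<in> set Ys. \<forall>b \<in> A \<union> B1. \<forall>y \<in> Y. b < y"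
    using P unfolding E_def by (auto simp: run_partition_def sorted_wrt_append block_less_def)
  have lessF: "\<forall>X \<in> set (B # Vs). \<forall>a \<in> A. \<forall>x \<in> X. a < x"
  proof -
    have "sorted_wrt block_less (extend_last N (({..0} # Us) @ A # B # Vs))"
      using P E Fs by (simp add: run_partition_def)
    then have "sorted_wrt block_less (A # extend_last N (B # Vs))"
      by (simp add: extend_last_append extend_last_Cons sorted_wrt_append)
    then have "\<forall>X \<in> set (extend_last N (B # Vs)). \<forall>a \<in> A. \<forall>x \<in> X. a < x"
      by (auto simp: block_less_def)
    then show ?thesis using extend_last_superset[of _ "B # Vs" N] by (meson subsetD)
  qed
  have later: "X \<in> set (A # B # Vs)" if "X \<in> set Fs" "card X = k" for X
  proof -
    have "X \<notin> set Us" using that(2) us(2) Fs(2) by force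
    then show ?thesis using that(1) Fs(1) by auto
  qed
  have Min_less: "Min A < Min X" if "X \<in> set (B # Vs)" "card X = k" for X
  proof -
    have "X \<in> set Fs" "X \<noteq> {}" using that Fs(1) k0 by auto
    moreover have "finite X" using fin calculation(1) .
    ultimately have "Min X \<in> X" "Min A \<in> A" using A Ane by auto
    then show ?thesis using lessF that(1) by blast
  qed
  have AE: "A \<in> set E" by (simp add: E_def)
  have run_Fs: "X \<in> set Fs" "k \<le> card X" if "is_run \<eta> (\<Union>(set E)) X" "finite X" for X
  proof -
    show "X \<in> set Fs" using that finite_in_extend_last[of X N Fs] E is_run_iff[OF P] by auto
    then show "k \<le> card X" using st xs(1) by (auto simp: ts_state_def run_lists_def)
  qed
  have Arun: "is_run \<eta> (\<Union>(set E)) A" using AE is_run_iff[OF P] by simp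
  have lsr: "leftmost_smallest_run \<eta> (\<Union>(set E)) X \<longleftrightarrow> X = A" for X
  proof
    assume X: "leftmost_smallest_run \<eta> (\<Union>(set E)) X"
    then have XF: "X \<in> set Fs" "k \<le> card X" using run_Fs by (auto simp: leftmost_smallest_run_def)
    have "card X \<le> k" using X Arun A Fs(3) by (auto simp: leftmost_smallest_run_def)
    then have cX: "card X = k" using XF by simp
    then have "Min X \<le> Min A" using X Arun A Fs(3) by (auto simp: leftmost_smallest_run_def)
    then show "X = A" using later[OF XF(1) cX] Min_less[OF _ cX] by (metis leD set_ConsD)
  next
    assume "X = A"
    moreover have "Min A \<le> Min Y" if "is_run \<eta> (\<Union>(set E)) Y" "finite Y" "card Y = k" for Y
      using later[OF run_Fs(1)[OF that(1,2)] that(3)] Min_less[OF _ that(3)]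
      by (metis dual_order.refl less_imp_le set_ConsD)
    ultimately show "leftmost_smallest_run \<eta> (\<Union>(set E)) X"
      using Arun A run_Fs Fs(3) by (auto simp: leftmost_smallest_run_def)
  qed
  have nxt: "next_run \<eta> (\<Union>(set E)) A X \<longleftrightarrow> X = B1" for X
    using next_run_iff[of \<eta> "Cs @ [C]" A B1 Ys X] P by (simp add: E_def)
  have step: "ts_step \<eta> (boxes N Fs) k' S' \<longleftrightarrow> k' = k \<and> S' = S" for k' S'
    unfolding ts_step_def R lsr using Fs(3) by (auto simp: nxt S_def F_def)
  have SR: "S \<subseteq> \<Union>(set E)" using FB by (auto simp: S_def E_def)
  have SN: "S \<subseteq> {1..N}" using A B FB by (auto simp: S_def)
  have colours: "\<exists>c \<in> {0, 1}. (\<forall>z \<in> A. \<eta> z = c) \<and> (\<forall>z \<in> F. \<eta> z = 1 - c)"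
  proof -
    have "alternating \<eta> 0 ((Cs @ [C]) @ A # B1 # Ys)" using P by (simp add: E_def run_partition_def)
    then show ?thesis using FB(2) unfolding alternating_append by (auto split: if_splits)
  qed
  have disj: "A \<inter> F = {}" using less(1) FB(2) by fastforce
  have cards: "card {z \<in> S. \<eta> z = 1} = k \<and> card {z \<in> S. \<eta> z = 0} = k"
  proof -
    obtain c where c: "c \<in> {0, 1}" "\<forall>z \<in> A. \<eta> z = c" "\<forall>z \<in> F. \<eta> z = 1 - c" using colours by blast
    have "{z \<in> S. \<eta> z = c} = A" "{z \<in> S. \<eta> z = 1 - c} = F"
      using c disj by (auto simp: S_def)
    then show ?thesis using c(1) Fs(3) cF by (elim insertE) simp_all
  qed
  \<comment> \<open>\<open>A\<close> and \<open>B1\<close> are neighbouring runs and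
    \<open>F\<close> is an initial part of \<open>B1\<close>, so a remaining box between two boxes
    of \<open>S\<close> cannot escape \<open>S\<close>.\<close>
  have hull: "z \<in> S" if z: "z \<in> \<Union>(set E)" "a \<in> S" "b \<in> S" "a \<le> z" "z \<le> b" for z a b
  proof -
    have ab: "a \<in> A \<union> B1" "b \<in> A \<union> B1" using z FB by (auto simp: S_def)
    consider X where "X \<in> set Cs \<union> {C}" "z \<in> X" | "z \<in> A \<union> B1" | Y where "Y \<in> set Ys" "z \<in> Y"
      using z(1) unfolding E_def by auto
    then have zAB: "z \<in> A \<union> B1"
    proof cases
      case 1
      then have "z < a" using less(2) ab(1) by blast
      then show ?thesis using z by simp
    next
      case 3
      then have "b < z" using less(3) ab(2) by blast
      then show ?thesis using z by simp
    qed
    have "z \<in> F" if zB: "z \<in> B1"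
    proof -
      have "b \<notin> A" using zB z less(1) by fastforce
      then have "b \<in> F" using z by (simp add: S_def)
      moreover have "finite {w \<in> B1. w < b}"
        by (rule finite_subset[of _ "B \<union> {N + 1..b}"]) (use B(2) in \<open>auto simp: B1_def split: if_splits\<close>)
      ultimately show ?thesis using first_boxes_initial zB z unfolding F_def by blast
    qed
    then show ?thesis using zAB by (auto simp: S_def)
  qed
  have "\<exists>Fs'. ts_state N \<eta> Fs' (delete_run k xs) \<and> boxes N Fs' = boxes N Fs - S"
  proof -
    have new: "run_partition \<eta> (Cs @ (C \<union> (B1 - F)) # Ys)"
      "\<Union>(set E) - S = \<Union>(set (Cs @ (C \<union> (B1 - F)) # Ys))"
      using run_partition_delete[OF P[unfolded E_def] FB(2)] by (simp_all add: E_def S_def)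
    \<comment> \<open>If \<open>A\<close> comes first then \<open>b = k\<close>, nothing of
      \<open>B\<close> is left, and \<open>{..0}\<close> stays as it is. Otherwise the rest of
      \<open>B\<close> joins \<open>C\<close>, which is the entry \<open>c + b - k\<close>.\<close>
    define Fs' where "Fs' = (if us = [] then Vs else butlast Us @ (C \<union> (B - F)) # Vs)"
    have del1: "delete_run k xs \<in> run_lists 1" using delete_run_props(1)[OF xs(1,2) k0] run_lists_antimono[OF xs(3)] by blast
    have B1F: "B1 - F = (if Vs = [] then (B - F) \<union> {N + 1..} else B - F)"
      using FB B by (auto simp: B1_def)
    have "map card Fs' = delete_run k xs \<and> (\<forall>F \<in> set Fs'. F \<subseteq> {1..N}) \<and>
      extend_last N ({..0} # Fs') = Cs @ (C \<union> (B1 - F)) # Ys"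
    proof (cases "us = []")
      case True
      then have "Us = []" "b = k" "delete_run k xs = vs" using Fs ws by auto
      moreover have "B - F = {}" using calculation FB(1) B cF Fs(4) by (metis Diff_cancel card_subset_eq)
      ultimately show ?thesis using True CC Fs sub B1F
        by (cases "Vs = []") (auto simp: Fs'_def Ys_def extend_last_Cons, auto simp: extend_last_def)
    next
      case False
      then have Us: "Us \<noteq> []" using Fs by auto
      then have C: "C = last Us" "Cs = {..0} # butlast Us" by (simp_all add: C_def Cs_def)
      have Us2: "Us = butlast Us @ [C]" using Us C by simp
      then have "us = map card (butlast Us) @ [card C]" using Fs(2) by (metis list.simps(8,9) map_append)
      then have d: "delete_run k xs = map card (butlast Us) @ (card C + b - k) # vs" using ws(4) by blast
      have CF: "C \<in> set Fs" using Us C Fs by simp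
      have "B \<subseteq> B1" by (simp add: B1_def)
      then have "x < x" if "x \<in> C" "x \<in> B" for x using less(2) that by blast
      then have "C \<inter> B = {}" by blast
      then have "card (C \<union> (B - F)) = card C + card (B - F)"
        using fin[OF CF] B by (subst card_Un_disjoint) auto
      also have "card (B - F) = b - k" using FB B cF Fs(4) by (simp add: card_Diff_subset finite_subset)
      finally have "map card Fs' = delete_run k xs" using d False ws(2) Fs(5) by (simp add: Fs'_def)
      moreover have "(\<forall>F \<in> set Fs'. F \<subseteq> {1..N})"
        using sub CF Fs(1) B False by (auto simp: Fs'_def dest!: in_set_butlastD)
      moreover have "extend_last N ({..0} # Fs') = Cs @ (C \<union> (B1 - F)) # Ys"
        using False C(2) B1F by (cases "Vs = []")
          (simp_all add: Fs'_def Ys_def extend_last_append extend_last_Cons, simp add: extend_last_def Un_assoc)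
      ultimately show ?thesis by blast
    qed
    then have "ts_state N \<eta> Fs' (delete_run k xs)" "boxes N Fs' = boxes N Fs - S"
      using new del1 R by (auto simp: ts_state_def boxes_def)
    then show ?thesis by blast
  qed
  then obtain Fs' where Fs': "ts_state N \<eta> Fs' (delete_run k xs)" "boxes N Fs' = boxes N Fs - S" by blast
  have "\<forall>z \<in> boxes N Fs. \<forall>a \<in> S. \<forall>b \<in> S. a \<le> z \<and> z \<le> b \<longrightarrow> z \<in> S"
    unfolding R using hull by blast
  moreover have "S \<subseteq> boxes N Fs \<inter> {1..N}" using SR SN unfolding R by blast
  ultimately show ?thesis
    using step Fs' cards by (intro exI[of _ S] exI[of _ Fs'] conjI allI) (assumption | simp only:)+
qed

section \<open>The sequence of solitons\<close>

text \<open>\<open>ts_remaining\<close> always starts from all boxes; the closure of this relation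
  can start from any intermediate stage, as induction along the algorithm requires.\<close>

definition ts_succ :: "(int \<Rightarrow> int) \<Rightarrow> int set \<Rightarrow> int set \<Rightarrow> bool" where
  "ts_succ \<eta> R R' \<longleftrightarrow> (\<exists>k S. ts_step \<eta> R k S \<and> R' = R - S)"

lemma ts_remaining_iff: "ts_remaining \<eta> R \<longleftrightarrow> (ts_succ \<eta>)\<^sup>*\<^sup>* UNIV R"
proof
  show "ts_remaining \<eta> R \<Longrightarrow> (ts_succ \<eta>)\<^sup>*\<^sup>* UNIV R"
    by (induction rule: ts_remaining.induct) (auto simp: ts_succ_def intro: rtranclp.rtrancl_into_rtrancl)
  show "(ts_succ \<eta>)\<^sup>*\<^sup>* UNIV R \<Longrightarrow> ts_remaining \<eta> R"
    by (induction rule: rtranclp_induct) (auto simp: ts_succ_def intro: ts_remaining.intros)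
qed

text \<open>A soliton removed later avoids the hull of an earlier one, because the earlier one was
  contiguous in what remained when it was removed.\<close>

definition removed_before :: "nat \<times> int set \<Rightarrow> nat \<times> int set \<Rightarrow> bool" where
  "removed_before p p' \<longleftrightarrow> fst p \<le> fst p' \<and>
     (\<forall>z \<in> snd p'. \<forall>a \<in> snd p. \<forall>b \<in> snd p. \<not> (a \<le> z \<and> z \<le> b))"

text \<open>Steps are unique, so what is reachable from a state is the state itself and whatever is
  reachable from its only successor. This turns the unordered set of solitons into a list in the
  order of removal.\<close>

lemma ts_chain:
  assumes "ts_state N \<eta> Fs xs"
  shows "\<exists>ps. map fst ps = soliton_sizes xs \<and> sorted_wrt removed_before ps \<and>
    (\<forall>k S. (k, S) \<in> set ps \<longleftrightarrow> (\<exists>R. (ts_succ \<eta>)\<^sup>*\<^sup>* (boxes N Fs) R \<and> ts_step \<eta> R k S)) \<and>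
    (\<forall>(k, S) \<in> set ps. S \<subseteq> boxes N Fs \<inter> {1..N} \<and> card {z \<in> S. \<eta> z = 1} = k \<and> card {z \<in> S. \<eta> z = 0} = k)"
  using assms
proof (induction xs arbitrary: Fs rule: length_induct)
  case (1 xs)
  show ?case
  proof (cases "xs = []")
    case True
    then have "Fs = []" using 1(2) by (auto simp: ts_state_def)
    then have P: "run_partition \<eta> [{..0} \<union> {N + 1..}]" "boxes N Fs = \<Union>(set [{..0} \<union> {N + 1..}])"
      using 1(2) by (auto simp: ts_state_def boxes_def extend_last_def)
    \<comment> \<open>A single run is left and it is infinite, so the algorithm has no finite run to
      choose.\<close>
    have no: "\<not> ts_step \<eta> (boxes N Fs) k S" for k S
      using is_run_iff[OF P(1)] infinite_atLeast_int(1)[of "{..0}" "N + 1"]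
      unfolding ts_step_def leftmost_smallest_run_def P(2) by auto
    then have "R = boxes N Fs" if "(ts_succ \<eta>)\<^sup>*\<^sup>* (boxes N Fs) R" for R
      using that by (metis converse_rtranclpE ts_succ_def)
    then show ?thesis using no True by (intro exI[of _ "[]"]) auto
  next
    case False
    define k where "k = Min (set xs)"
    obtain S Fs' where S: "\<forall>k' S'. ts_step \<eta> (boxes N Fs) k' S' \<longleftrightarrow> k' = k \<and> S' = S"
      "ts_state N \<eta> Fs' (delete_run k xs)" "boxes N Fs' = boxes N Fs - S" "S \<subseteq> boxes N Fs \<inter> {1..N}"
      "card {z \<in> S. \<eta> z = 1} = k" "card {z \<in> S. \<eta> z = 0} = k"
      "\<forall>z \<in> boxes N Fs. \<forall>a \<in> S. \<forall>b \<in> S. a \<le> z \<and> z \<le> b \<longrightarrow> z \<in> S"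
      using ts_state_step[OF 1(2) False k_def] by (elim exE conjE) (rule that; assumption)
    have xs1: "xs \<in> run_lists 1" using 1(2) by (simp add: ts_state_def)
    note m = run_list_Min[OF xs1 False, folded k_def]
    have d: "delete_run k xs \<in> run_lists k" using m by (intro delete_run_props) auto
    obtain ps where ps: "map fst ps = soliton_sizes (delete_run k xs)" "sorted_wrt removed_before ps"
      "\<forall>k' S'. (k', S') \<in> set ps \<longleftrightarrow> (\<exists>R. (ts_succ \<eta>)\<^sup>*\<^sup>* (boxes N Fs') R \<and> ts_step \<eta> R k' S')"
      "\<forall>(k', S') \<in> set ps. S' \<subseteq> boxes N Fs' \<inter> {1..N} \<and> card {z \<in> S'. \<eta> z = 1} = k' \<and> card {z \<in> S'. \<eta> z = 0} = k'"
      using 1(1)[rule_format, OF length_delete_run[OF False] S(2)] by (elim exE conjE) (rule that; assumption)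
    have succ: "ts_succ \<eta> (boxes N Fs) R \<longleftrightarrow> R = boxes N Fs'" for R
      by (auto simp: ts_succ_def S(1,3))
    have "map fst ((k, S) # ps) = soliton_sizes xs" using ps(1) False by (simp add: soliton_sizes.simps[of xs] k_def)
    \<comment> \<open>Later solitons consist of boxes that survive the removal of \<open>S\<close>,
      and a surviving box cannot lie between two boxes of \<open>S\<close>.\<close>
    moreover have "removed_before (k, S) p" if "p \<in> set ps" for p
    proof -
      have "fst p \<in> set (soliton_sizes (delete_run k xs))" using that by (simp flip: ps(1))
      then have "k \<le> fst p" using set_soliton_sizes[OF d] m by auto
      moreover have "snd p \<subseteq> boxes N Fs - S" using ps(4) that S(3) by (cases p) auto
      ultimately show ?thesis using S(7) by (auto simp: removed_before_def)
    qed
    then have "sorted_wrt removed_before ((k, S) # ps)" using ps(2) by simp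
    moreover have "(k', S') \<in> set ((k, S) # ps) \<longleftrightarrow>
      (\<exists>R. (ts_succ \<eta>)\<^sup>*\<^sup>* (boxes N Fs) R \<and> ts_step \<eta> R k' S')" for k' S'
    proof -
      have "(ts_succ \<eta>)\<^sup>*\<^sup>* (boxes N Fs) R \<longleftrightarrow> R = boxes N Fs \<or> (ts_succ \<eta>)\<^sup>*\<^sup>* (boxes N Fs') R" for R
        using succ by (metis converse_rtranclpE converse_rtranclp_into_rtranclp rtranclp.rtrancl_refl)
      then show ?thesis using ps(3)[rule_format, of k' S'] S(1)[rule_format, of k' S'] by auto
    qed
    moreover have "\<forall>(k', S') \<in> set ((k, S) # ps). S' \<subseteq> boxes N Fs \<inter> {1..N} \<and>
      card {z \<in> S'. \<eta> z = 1} = k' \<and> card {z \<in> S'. \<eta> z = 0} = k'"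
      using ps(4) S(3-6) by auto
    ultimately show ?thesis by blast
  qed
qed

section \<open>Excursions and their run lengths\<close>

fun steps :: "int \<Rightarrow> nat list \<Rightarrow> int list" where
  "steps s [] = []"
| "steps s (x # xs) = replicate x s @ steps (- s) xs"

definition excursion_of :: "nat list \<Rightarrow> int list" where
  "excursion_of xs = map (\<lambda>n. sum_list (take n (steps 1 xs))) [0..<Suc (sum_list xs)]"

lemma length_steps [simp]: "length (steps s xs) = sum_list xs"
  by (induction s xs rule: steps.induct) auto

lemma set_steps: "set (steps s xs) \<subseteq> {s, - s}"
  by (induction s xs rule: steps.induct) auto

text \<open>Prepending a step opens a new run if the path turns after it, and lengthens the leading
  run otherwise.\<close>

lemma steps_exist:
  assumes "set ds \<subseteq> {1, - 1}" "ds = [] \<or> hd ds = s"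
  shows "\<exists>xs. (\<forall>x \<in> set xs. 1 \<le> x) \<and> ds = steps s xs"
  using assms
proof (induction ds arbitrary: s)
  case (Cons d ds)
  then have d: "d = s" "s = 1 \<or> s = - 1" by auto
  show ?case
  proof (cases "ds = [] \<or> hd ds = - s")
    case True
    then have "\<exists>xs. (\<forall>x \<in> set xs. 1 \<le> x) \<and> ds = steps (- s) xs" using Cons.prems by (intro Cons.IH) auto
    then obtain xs where "\<forall>x \<in> set xs. 1 \<le> x" "ds = steps (- s) xs" by blast
    then show ?thesis using d by (intro exI[of _ "1 # xs"]) auto
  next
    case False
    then have "hd ds = s" using Cons.prems d by (cases ds) auto
    then have "\<exists>xs. (\<forall>x \<in> set xs. 1 \<le> x) \<and> ds = steps s xs" using Cons.prems by (intro Cons.IH) auto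
    then obtain xs where xs: "\<forall>x \<in> set xs. 1 \<le> x" "ds = steps s xs" by blast
    then obtain y ys where "xs = y # ys" using False by (cases xs) auto
    then show ?thesis using xs d by (intro exI[of _ "Suc y # ys"]) auto
  qed
qed (auto intro: exI[of _ "[]"])

text \<open>The run after the first is nonempty and goes the other way, so the first run length is
  visible in the step sequence; injectivity rests on this.\<close>

lemma takeWhile_steps:
  assumes "\<forall>x \<in> set (x # xs). 1 \<le> x" "s \<noteq> 0"
  shows "takeWhile ((=) s) (steps s (x # xs)) = replicate x s"
proof -
  have "takeWhile ((=) s) (steps (- s) xs) = []"
    using assms by (cases xs) (auto simp: takeWhile_eq_Nil_iff hd_append)
  then show ?thesis by (simp add: takeWhile_append)
qed

lemma steps_inj:
  assumes "steps s xs = steps s ys" "\<forall>x \<in> set xs. 1 \<le> x" "\<forall>y \<in> set ys. 1 \<le> y" "s \<noteq> 0"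
  shows "xs = ys"
  using assms
proof (induction xs arbitrary: s ys)
  case Nil
  then show ?case by (cases ys) auto
next
  case (Cons x xs)
  then obtain y ys' where ys: "ys = y # ys'" by (cases ys) auto
  have "replicate x s = replicate y s"
    using takeWhile_steps[of x xs s] takeWhile_steps[of y ys' s] Cons.prems unfolding ys by simp
  then have "x = y" by simp
  then show ?case using Cons.IH[of "- s" ys'] Cons.prems ys by simp
qed

text \<open>\<open>dyck\<close> inspects heights only at the ends of runs. This suffices because the
  height is monotone along a run.\<close>

lemma dyck_iff_steps:
  assumes "s = 1 \<or> s = - 1" "h \<ge> 0"
  shows "dyck s h xs \<longleftrightarrow> h + sum_list (steps s xs) = 0 \<and>
    (\<forall>n \<le> sum_list xs. h + sum_list (take n (steps s xs)) \<ge> 0)"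
  using assms
proof (induction xs arbitrary: s h)
  case (Cons x xs)
  have take: "sum_list (take n (steps s (x # xs))) = s * int (min n x) + sum_list (take (n - x) (steps (- s) xs))" for n
    by (simp add: sum_list_replicate mult.commute)
  have nonneg: "(\<forall>n \<le> sum_list (x # xs). h + sum_list (take n (steps s (x # xs))) \<ge> 0) \<longleftrightarrow>
    h + s * int x \<ge> 0 \<and> (\<forall>n \<le> sum_list xs. h + s * int x + sum_list (take n (steps (- s) xs)) \<ge> 0)" (is "?L \<longleftrightarrow> ?R")
  proof
    assume L: ?L
    have "h + s * int x + sum_list (take n (steps (- s) xs)) \<ge> 0" if "n \<le> sum_list xs" for n
      using L[rule_format, of "x + n"] that unfolding take by (simp add: add.assoc)
    from this this[of 0] show ?R by auto
  next
    assume R: ?R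
    have "h + sum_list (take n (steps s (x # xs))) \<ge> 0" if "n \<le> sum_list (x # xs)" for n
    proof (cases "n \<le> x")
      case True
      then have "h + s * int n \<ge> 0" using R Cons.prems by auto
      then show ?thesis unfolding take using True by simp
    next
      case False
      then show ?thesis unfolding take using R[THEN conjunct2, rule_format, of "n - x"] that by (simp add: add.assoc)
    qed
    then show ?L by blast
  qed
  have "dyck s h (x # xs) \<longleftrightarrow> h + s * int x \<ge> 0 \<and> h + s * int x + sum_list (steps (- s) xs) = 0 \<and>
    (\<forall>n \<le> sum_list xs. h + s * int x + sum_list (take n (steps (- s) xs)) \<ge> 0)"
    using Cons.IH[of "- s" "h + s * int x"] Cons.prems by auto
  then show ?case unfolding nonneg by (auto simp: sum_list_replicate algebra_simps)
qed auto

lemma excursion_of_nth: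
  "n \<le> sum_list xs \<Longrightarrow> excursion_of xs ! n = sum_list (take n (steps 1 xs))"
  by (simp add: excursion_of_def del: upt_Suc)

lemma excursion_of_diff:
  assumes "n < sum_list xs"
  shows "excursion_of xs ! Suc n - excursion_of xs ! n = steps 1 xs ! n"
  using assms by (simp add: excursion_of_nth take_Suc_conv_app_nth)

lemma length_excursion_of [simp]: "length (excursion_of xs) = Suc (sum_list xs)"
  by (simp add: excursion_of_def)

lemma even_sum_list_run_list: "xs \<in> run_lists 1 \<Longrightarrow> even (sum_list xs)"
  using sum_list_length_soliton_sizes[of xs 1] by simp

lemma half_length_excursion_of: "xs \<in> run_lists 1 \<Longrightarrow> 2 * half_length (excursion_of xs) = sum_list xs"
  using even_sum_list_run_list by (simp add: half_length_def)

lemma excursion_of_in: "xs \<in> run_lists 1 \<Longrightarrow> excursion_of xs \<in> excursions"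
proof -
  assume xs: "xs \<in> run_lists 1"
  then have d: "sum_list (steps 1 xs) = 0" "\<forall>n \<le> sum_list xs. sum_list (take n (steps 1 xs)) \<ge> 0"
    using dyck_iff_steps[of 1 0 xs] by (auto simp: run_lists_def)
  obtain n where n: "sum_list xs = 2 * n" using even_sum_list_run_list[OF xs] by (metis evenE)
  have "\<bar>excursion_of xs ! z - excursion_of xs ! (z - 1)\<bar> = 1" if "z \<in> {1..2 * n}" for z
  proof -
    have "z - 1 < sum_list xs" "Suc (z - 1) = z" using that n by auto
    then have "excursion_of xs ! z - excursion_of xs ! (z - 1) \<in> {1, - 1}"
      using excursion_of_diff[of "z - 1" xs] set_steps[of 1 xs] nth_mem[of "z - 1" "steps 1 xs"]
      by (metis length_steps subsetD)
    then show ?thesis by auto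
  qed
  then show ?thesis unfolding excursions_def using n d by (auto simp: excursion_of_nth intro!: exI[of _ n])
qed

lemma excursion_of_surj:
  assumes "e \<in> excursions"
  shows "\<exists>xs \<in> run_lists 1. e = excursion_of xs"
proof -
  obtain n where n: "length e = 2 * n + 1" "e ! 0 = 0" "e ! (2 * n) = 0" "\<forall>z \<in> {0..2 * n}. e ! z \<ge> 0"
    "\<forall>z \<in> {1..2 * n}. \<bar>e ! z - e ! (z - 1)\<bar> = 1"
    using assms by (auto simp: excursions_def)
  define ds where "ds = map (\<lambda>i. e ! Suc i - e ! i) [0..<2 * n]"
  have diff: "e ! Suc i - e ! i \<in> {1, - 1}" if "i < 2 * n" for i using n(5)[rule_format, of "Suc i"] that by auto
  have sum: "sum_list (take z ds) = e ! z" if "z \<le> 2 * n" for z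
    using that
  proof (induction z)
    case (Suc z)
    then show ?case by (simp add: take_Suc_conv_app_nth ds_def)
  qed (simp add: n)
  \<comment> \<open>The first step goes up, since the path starts at 0 and stays nonnegative; so the
    run list may begin with direction 1.\<close>
  have "ds = [] \<or> hd ds = 1"
  proof (cases "n = 0")
    case False
    then have "hd ds = e ! 1 - e ! 0" by (simp add: ds_def hd_map hd_upt)
    then show ?thesis using diff[of 0] n(2) n(4)[rule_format, of 1] False by auto
  qed (simp add: ds_def)
  moreover have "set ds \<subseteq> {1, - 1}" unfolding ds_def set_map by (intro image_subsetI diff) simp
  ultimately obtain xs where xs: "\<forall>x \<in> set xs. 1 \<le> x" "ds = steps 1 xs" using steps_exist by blast
  have len: "sum_list xs = 2 * n" using length_steps[of 1 xs, folded xs(2)] by (simp add: ds_def)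
  have "sum_list ds = 0" using sum[of "2 * n"] n(3) by (simp add: ds_def)
  then have "dyck 1 0 xs" using sum n(4) len xs(2) by (auto simp: dyck_iff_steps)
  then have "xs \<in> run_lists 1" using xs(1) by (simp add: run_lists_def)
  moreover have "e = excursion_of xs"
    using n(1) len sum xs(2) by (intro nth_equalityI) (auto simp: excursion_of_nth)
  ultimately show ?thesis by blast
qed

lemma excursion_of_inj: "inj_on excursion_of (run_lists 1)"
proof (rule inj_onI)
  fix xs ys assume xs: "xs \<in> run_lists 1" "ys \<in> run_lists 1" "excursion_of xs = excursion_of ys"
  then have len: "sum_list xs = sum_list ys" using length_excursion_of by (metis Suc_inject)
  have "steps 1 xs = steps 1 ys"
    using len xs(3) excursion_of_diff[of _ xs] excursion_of_diff[of _ ys] by (intro nth_equalityI) auto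
  then show "xs = ys" using steps_inj xs by (auto simp: run_lists_def)
qed

lemma bij_betw_excursion_of: "bij_betw excursion_of (run_lists 1) excursions"
  using excursion_of_inj excursion_of_in excursion_of_surj by (auto simp: bij_betw_def)

section \<open>The initial block list of an excursion\<close>

fun intervals :: "int \<Rightarrow> nat list \<Rightarrow> int set list" where
  "intervals a [] = []"
| "intervals a (x # xs) = {a + 1..a + int x} # intervals (a + int x) xs"

text \<open>Prepared for induction: \<open>X\<close> is the run just before, of colour
  \<open>c\<close>, and \<open>s = 1 - 2 * c\<close> is the direction of the next run. The parity
  condition makes the final run one of empty boxes, so that it can absorb everything beyond the last
  step.\<close>

lemma intervals_extend:
  assumes "X \<subseteq> {..a}" "X \<noteq> {}" "\<forall>x \<in> set xs. 1 \<le> x" "even (length xs) \<longleftrightarrow> c = 0" "s = 1 - 2 * c" "c = 0 \<or> c = 1"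
    "\<forall>z \<in> X. \<eta> z = c" "\<And>i. i < sum_list xs \<Longrightarrow> \<eta> (a + 1 + int i) = (steps s xs ! i + 1) div 2"
    "\<And>z. a + int (sum_list xs) < z \<Longrightarrow> \<eta> z = 0"
  shows "(\<forall>B \<in> set (extend_last (a + int (sum_list xs)) (X # intervals a xs)). B \<noteq> {}) \<and>
    sorted_wrt block_less (extend_last (a + int (sum_list xs)) (X # intervals a xs)) \<and>
    alternating \<eta> c (extend_last (a + int (sum_list xs)) (X # intervals a xs)) \<and>
    \<Union>(set (extend_last (a + int (sum_list xs)) (X # intervals a xs))) = X \<union> {a + 1..}"
  using assms
proof (induction xs arbitrary: a X c s)
  case Nil
  then show ?case by (auto simp: extend_last_def)
next
  case (Cons x xs)
  let ?X = "{a + 1..a + int x}" and ?a = "a + int x" and ?N = "a + int x + int (sum_list xs)"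
  have x: "x \<ge> 1" using Cons.prems by auto
  have nth: "steps s (x # xs) ! i = s" if "i < x" for i using that by (simp add: nth_append)
  have "(\<forall>B \<in> set (extend_last ?N (?X # intervals ?a xs)). B \<noteq> {}) \<and>
    sorted_wrt block_less (extend_last ?N (?X # intervals ?a xs)) \<and>
    alternating \<eta> (1 - c) (extend_last ?N (?X # intervals ?a xs)) \<and>
    \<Union>(set (extend_last ?N (?X # intervals ?a xs))) = ?X \<union> {?a + 1..}"
  proof (rule Cons.IH[where s = "- s"])
    show "\<forall>z \<in> ?X. \<eta> z = 1 - c"
    proof
      fix z assume z: "z \<in> ?X"
      define i where "i = nat (z - a - 1)"
      have "i < x" "z = a + 1 + int i" using z by (auto simp: i_def)
      then show "\<eta> z = 1 - c" using Cons.prems(8)[of i] nth[of i] Cons.prems(5,6) by auto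
    qed
    show "\<eta> (?a + 1 + int i) = (steps (- s) xs ! i + 1) div 2" if "i < sum_list xs" for i
      using Cons.prems(8)[of "x + i"] that by (simp add: nth_append algebra_simps)
    show "\<eta> z = 0" if "?a + int (sum_list xs) < z" for z using Cons.prems(9) that by auto
  qed (use Cons.prems x in auto)
  note IH = this
  have ext: "extend_last (a + int (sum_list (x # xs))) (X # intervals a (x # xs)) = X # extend_last ?N (?X # intervals ?a xs)"
    by (simp add: extend_last_Cons add.assoc)
  have U: "?X \<union> {?a + 1..} = {a + 1..}" by auto
  have "block_less X B" if "B \<in> set (extend_last ?N (?X # intervals ?a xs))" for B
  proof -
    have "B \<subseteq> {a + 1..}" using IH U that by blast
    then show ?thesis using Cons.prems(1) by (fastforce simp: block_less_def)
  qed
  then show ?case unfolding ext using IH U Cons.prems(2,7) by simp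
qed

lemma card_intervals: "map card (intervals a xs) = xs"
  by (induction a xs rule: intervals.induct) auto

lemma intervals_subset: "F \<in> set (intervals a xs) \<Longrightarrow> F \<subseteq> {a + 1..a + int (sum_list xs)}"
  by (induction a xs rule: intervals.induct) fastforce+

lemma ball_config_excursion_of:
  assumes "xs \<in> run_lists 1"
  shows "i < sum_list xs \<Longrightarrow> ball_config (excursion_of xs) (1 + int i) = (steps 1 xs ! i + 1) div 2"
    and "z \<notin> {1..int (sum_list xs)} \<Longrightarrow> ball_config (excursion_of xs) z = 0"
  using half_length_excursion_of[OF assms] excursion_of_diff[of i xs]
  by (auto simp: ball_config_def nat_add_distrib)

lemma ts_state_excursion_of:
  assumes xs: "xs \<in> run_lists 1"
  defines "N \<equiv> int (sum_list xs)"
  shows "ts_state N (ball_config (excursion_of xs)) (intervals 0 xs) xs" "boxes N (intervals 0 xs) = UNIV"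
proof -
  have "(\<forall>B \<in> set (extend_last (0 + int (sum_list xs)) ({..0} # intervals 0 xs)). B \<noteq> {}) \<and>
    sorted_wrt block_less (extend_last (0 + int (sum_list xs)) ({..0} # intervals 0 xs)) \<and>
    alternating (ball_config (excursion_of xs)) 0 (extend_last (0 + int (sum_list xs)) ({..0} # intervals 0 xs)) \<and>
    \<Union>(set (extend_last (0 + int (sum_list xs)) ({..0} # intervals 0 xs))) = {..0} \<union> {0 + 1..}"
    using sum_list_length_soliton_sizes[OF xs] xs
    by (intro intervals_extend[where s = 1]) (auto simp: run_lists_def ball_config_excursion_of[OF xs])
  then show "ts_state N (ball_config (excursion_of xs)) (intervals 0 xs) xs" "boxes N (intervals 0 xs) = UNIV"
    using xs card_intervals intervals_subset[of _ 0 xs]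
    by (auto simp: ts_state_def boxes_def run_partition_def N_def)
qed

section \<open>The solitons of an excursion in the order of removal\<close>

lemma distinct_if_sorted_wrt:
  assumes "sorted_wrt P xs" "\<And>x. x \<in> set xs \<Longrightarrow> \<not> P x x"
  shows "distinct xs"
  using assms by (induction xs) auto

lemma removed_before_disjoint: "removed_before p p' \<Longrightarrow> snd p \<inter> snd p' = {}"
  by (force simp: removed_before_def)

lemma solitons_excursion_of:
  assumes xs: "xs \<in> run_lists 1"
  shows "\<exists>ps. map fst ps = soliton_sizes xs \<and> sorted_wrt removed_before ps \<and> distinct ps \<and>
    (\<forall>k. solitons (excursion_of xs) k = {S. (k, S) \<in> set ps}) \<and>
    (\<forall>(k, S) \<in> set ps. S \<subseteq> {1..int (sum_list xs)} \<and> S \<noteq> {} \<and>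
      card {z \<in> S. ball_config (excursion_of xs) z = 1} = k \<and> card {z \<in> S. ball_config (excursion_of xs) z = 0} = k)"
proof -
  obtain ps where ps: "map fst ps = soliton_sizes xs" "sorted_wrt removed_before ps"
    "\<forall>k S. (k, S) \<in> set ps \<longleftrightarrow> (\<exists>R. (ts_succ (ball_config (excursion_of xs)))\<^sup>*\<^sup>* UNIV R \<and> ts_step (ball_config (excursion_of xs)) R k S)"
    "\<forall>(k, S) \<in> set ps. S \<subseteq> UNIV \<inter> {1..int (sum_list xs)} \<and> card {z \<in> S. ball_config (excursion_of xs) z = 1} = k \<and>
       card {z \<in> S. ball_config (excursion_of xs) z = 0} = k"
    using ts_chain[OF ts_state_excursion_of(1)[OF xs], unfolded ts_state_excursion_of(2)[OF xs]]
    by (elim exE conjE) (rule that; assumption)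
  have ne: "S \<noteq> {}" if "(k, S) \<in> set ps" for k S
  proof -
    have "k \<in> set (soliton_sizes xs)" unfolding ps(1)[symmetric] using that by force
    then have "1 \<le> k" using set_soliton_sizes[OF xs] by auto
    then show ?thesis using ps(4) that by auto
  qed
  \<comment> \<open>Supports are nonempty and disjoint from all later ones, so no pair occurs
    twice.\<close>
  have "distinct ps"
  proof (rule distinct_if_sorted_wrt[OF ps(2)])
    fix p assume "p \<in> set ps"
    then have "snd p \<noteq> {}" using ne[of "fst p" "snd p"] by simp
    then show "\<not> removed_before p p" using removed_before_disjoint[of p p] by auto
  qed
  moreover have "solitons (excursion_of xs) k = {S. (k, S) \<in> set ps}" for k
    by (auto simp: solitons_def ts_remaining_iff ps(3))
  moreover have "\<forall>(k, S) \<in> set ps. S \<subseteq> {1..int (sum_list xs)} \<and> S \<noteq> {} \<and>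
      card {z \<in> S. ball_config (excursion_of xs) z = 1} = k \<and> card {z \<in> S. ball_config (excursion_of xs) z = 0} = k"
    using ps(4) ne by auto
  ultimately show ?thesis using ps(1,2) by blast
qed

section \<open>Slots\<close>

lemma sorted_wrt_cases:
  assumes "sorted_wrt P xs" "x \<in> set xs" "y \<in> set xs"
  shows "x = y \<or> P x y \<or> P y x"
  using assms by (induction xs) auto

lemma count_list_map_fst: "distinct ps \<Longrightarrow> count_list (map fst ps) k = card {p \<in> set ps. fst p = k}"
proof -
  assume "distinct ps"
  then have "card {p \<in> set ps. fst p = k} = length (filter (\<lambda>p. fst p = k) ps)"
    using distinct_card[of "filter (\<lambda>p. fst p = k) ps"] by simp
  moreover have "count_list (map fst ps) k = length (filter (\<lambda>p. fst p = k) ps)"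
    by (induction ps) auto
  ultimately show ?thesis by simp
qed

lemma num_solitons_excursion_of:
  assumes xs: "xs \<in> run_lists 1"
  shows "num_solitons k (excursion_of xs) = count_list (soliton_sizes xs) k" "finite (solitons (excursion_of xs) k)"
proof -
  obtain ps where ps: "map fst ps = soliton_sizes xs" "sorted_wrt removed_before ps"
    "distinct ps" "\<forall>k. solitons (excursion_of xs) k = {S. (k, S) \<in> set ps}"
    using solitons_excursion_of[OF xs] by (elim exE conjE) (rule that; assumption)
  have eq: "solitons (excursion_of xs) k = snd ` {p \<in> set ps. fst p = k}"
    unfolding ps(4)[rule_format] by force
  have "inj_on snd {p \<in> set ps. fst p = k}" by (auto intro!: inj_onI)
  then have "num_solitons k (excursion_of xs) = card {p \<in> set ps. fst p = k}"
    unfolding num_solitons_def eq by (rule card_image)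
  then show "num_solitons k (excursion_of xs) = count_list (soliton_sizes xs) k"
    using count_list_map_fst[OF ps(3)] ps(1) by simp
  show "finite (solitons (excursion_of xs) k)" unfolding eq by simp
qed

lemma set_drop_nth: "{xs ! i |i. k \<le> i \<and> i < length xs} = set (drop k xs)"
proof (intro set_eqI iffI)
  fix x assume "x \<in> {xs ! i |i. k \<le> i \<and> i < length xs}"
  then obtain i where "k \<le> i" "i < length xs" "x = xs ! i" by blast
  then show "x \<in> set (drop k xs)" unfolding in_set_conv_nth by (intro exI[of _ "i - k"]) auto
next
  fix x assume "x \<in> set (drop k xs)"
  then obtain i where "i < length xs - k" "x = xs ! (k + i)" unfolding in_set_conv_nth by auto
  then show "x \<in> {xs ! i |i. k \<le> i \<and> i < length xs}" by (auto intro!: exI[of _ "k + i"])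
qed

text \<open>To be applied to the head or the tail of a larger soliton, whose boxes with index at
  least \<open>k\<close> are its \<open>k\<close>-slots.\<close>

definition outer_boxes :: "nat \<Rightarrow> int set \<Rightarrow> int set" where
  "outer_boxes k A = set (drop k (sorted_list_of_set A))"

lemma outer_boxes:
  assumes "finite A"
  shows "outer_boxes k A \<subseteq> A" "card (outer_boxes k A) = card A - k" "finite (outer_boxes k A)"
  using assms set_drop_subset[of k "sorted_list_of_set A"]
  by (auto simp: outer_boxes_def distinct_card)

text \<open>A soliton of size \<open>m > k\<close> has \<open>m - k\<close> slots in its head and as
  many in its tail, and disjoint supports make these numbers add up; the extra slot is box 0. Slots
  avoid the hull of a \<open>k\<close>-soliton because the solitons that carry them are removed
  later.\<close>

lemma slots_excursion_of:
  assumes xs: "xs \<in> run_lists 1"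
  shows "num_slots (excursion_of xs) k = Suc (\<Sum>l\<leftarrow>soliton_sizes xs. 2 * (l - k))"
    "slots (excursion_of xs) k \<subseteq> {0..int (sum_list xs)}"
    "S \<in> solitons (excursion_of xs) k \<Longrightarrow> z \<in> slots (excursion_of xs) k \<Longrightarrow>
       z < Min S \<or> Max S < z"
    "S \<in> solitons (excursion_of xs) k \<Longrightarrow> S \<noteq> {} \<and> S \<subseteq> {1..int (sum_list xs)}"
proof -
  define e \<eta> where "e = excursion_of xs" and "\<eta> = ball_config e"
  obtain ps where ps: "map fst ps = soliton_sizes xs" "sorted_wrt removed_before ps" and dist: "distinct ps" and
    soliton_sizes: "\<forall>k. solitons e k = {S. (k, S) \<in> set ps}" and
    S: "\<forall>(k, S) \<in> set ps. S \<subseteq> {1..int (sum_list xs)} \<and> S \<noteq> {} \<and>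
      card {z \<in> S. \<eta> z = 1} = k \<and> card {z \<in> S. \<eta> z = 0} = k"
    using solitons_excursion_of[OF xs, folded e_def \<eta>_def] by (elim exE conjE) (rule that; assumption)
  note ps = ps soliton_sizes[rule_format]
  have ps4: "S \<subseteq> {1..int (sum_list xs)}" "S \<noteq> {}" "card {z \<in> S. \<eta> z = 1} = k" "card {z \<in> S. \<eta> z = 0} = k"
    if "(k, S) \<in> set ps" for k S using S that by auto
  define Ob where "Ob p = outer_boxes k {z \<in> snd p. \<eta> z = 1} \<union> outer_boxes k {z \<in> snd p. \<eta> z = 0}" for p :: "nat \<times> int set"
  define P where "P = {p \<in> set ps. k < fst p}"
  have fin: "finite (snd p)" if "p \<in> set ps" for p
    using ps4[of "fst p" "snd p"] that finite_subset by auto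
  have heads: "{head_box e S i |i. k \<le> i \<and> i < m} = outer_boxes k {z \<in> S. \<eta> z = 1}"
    "{tail_box e S i |i. k \<le> i \<and> i < m} = outer_boxes k {z \<in> S. \<eta> z = 0}" if "(m, S) \<in> set ps" for m S
    using ps4[OF that] fin[OF that]
      set_drop_nth[where k = k and xs = "sorted_list_of_set {z \<in> S. \<eta> z = 1}"]
      set_drop_nth[where k = k and xs = "sorted_list_of_set {z \<in> S. \<eta> z = 0}"]
    by (simp_all add: outer_boxes_def head_box_def tail_box_def flip: \<eta>_def)
  have Ob: "{z. \<exists>i. k \<le> i \<and> i < m \<and> (z = head_box e S i \<or> z = tail_box e S i)} = Ob (m, S)" if "(m, S) \<in> set ps" for m S
    using heads[OF that] unfolding Ob_def by auto
  have "z \<in> slots e k \<longleftrightarrow> z = 0 \<or> (\<exists>m S. (m, S) \<in> P \<and> z \<in> Ob (m, S))" for z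
    unfolding slots_def ps(3) P_def using Ob by (fastforce simp: set_eq_iff)
  then have slots: "slots e k = insert 0 (\<Union>p \<in> P. Ob p)" by auto
  have OS: "Ob p \<subseteq> snd p" "finite (Ob p)" if "p \<in> P" for p
    using that fin[of p] outer_boxes(1,3)[of "{z \<in> snd p. \<eta> z = _}" k] by (auto simp: Ob_def P_def)
  have sub: "snd p \<subseteq> {1..int (sum_list xs)}" if "p \<in> set ps" for p
    using ps4[of "fst p" "snd p"] that by simp
  show "slots (excursion_of xs) k \<subseteq> {0..int (sum_list xs)}"
  proof -
    have "z \<in> {0..int (sum_list xs)}" if "p \<in> P" "z \<in> Ob p" for p z
      using OS(1)[OF that(1)] sub[of p] that by (force simp: P_def)
    then show ?thesis unfolding e_def[symmetric] slots by auto
  qed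
  have cO: "card (Ob p) = 2 * (fst p - k)" if "p \<in> P" for p
  proof -
    have fp: "finite {z \<in> snd p. \<eta> z = c}" for c using fin that by (auto simp: P_def)
    have "card (Ob p) = card (outer_boxes k {z \<in> snd p. \<eta> z = 1}) + card (outer_boxes k {z \<in> snd p. \<eta> z = 0})"
      unfolding Ob_def using outer_boxes(1)[OF fp[of 1], of k] outer_boxes(1)[OF fp[of 0], of k] outer_boxes(3)[OF fp, of k]
      by (intro card_Un_disjoint) fastforce+
    then show ?thesis using outer_boxes(2)[OF fp] ps4[of "fst p" "snd p"] that by (simp add: P_def)
  qed
  have "0 \<notin> (\<Union>p \<in> P. Ob p)" using OS(1) sub by (force simp: P_def)
  then have "card (slots e k) = Suc (card (\<Union>p \<in> P. Ob p))"
    unfolding slots using OS(2) by (intro card_insert_disjoint) (auto simp: P_def)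
  also have "card (\<Union>p \<in> P. Ob p) = (\<Sum>p \<in> P. card (Ob p))"
  proof (rule card_UN_disjoint)
    show "\<forall>p \<in> P. \<forall>p' \<in> P. p \<noteq> p' \<longrightarrow> Ob p \<inter> Ob p' = {}"
    proof (intro ballI impI)
      fix p p' assume pp: "p \<in> P" "p' \<in> P" "p \<noteq> p'"
      then have "snd p \<inter> snd p' = {}"
        using sorted_wrt_cases[OF ps(2), of p p'] removed_before_disjoint[of p p'] removed_before_disjoint[of p' p]
        unfolding P_def by blast
      then show "Ob p \<inter> Ob p' = {}" using OS(1)[OF pp(1)] OS(1)[OF pp(2)] by blast
    qed
  qed (auto simp: P_def OS[unfolded P_def])
  also have "\<dots> = (\<Sum>p \<in> P. 2 * (fst p - k))" using cO by simp
  \<comment> \<open>Solitons of size at most \<open>k\<close> enter with truncated difference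
    0.\<close>
  also have "\<dots> = (\<Sum>p \<in> set ps. 2 * (fst p - k))"
    by (rule sum.mono_neutral_left) (auto simp: P_def)
  also have "\<dots> = (\<Sum>p\<leftarrow>ps. 2 * (fst p - k))" using dist by (simp add: sum_list_distinct_conv_sum_set)
  also have "\<dots> = (\<Sum>l\<leftarrow>soliton_sizes xs. 2 * (l - k))" unfolding ps(1)[symmetric] by (simp add: comp_def)
  finally show "num_slots (excursion_of xs) k = Suc (\<Sum>l\<leftarrow>soliton_sizes xs. 2 * (l - k))"
    by (simp add: num_slots_def e_def)
  { assume S: "S \<in> solitons (excursion_of xs) k"
    then have Sps: "(k, S) \<in> set ps" using ps(3) e_def by auto
    from ps4[OF Sps] show SN: "S \<noteq> {} \<and> S \<subseteq> {1..int (sum_list xs)}" by simp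
    assume z: "z \<in> slots (excursion_of xs) k"
    have "finite S" using fin[OF Sps] by simp
    then have M: "Min S \<in> S" "Max S \<in> S" using SN by auto
    show "z < Min S \<or> Max S < z"
    proof (cases "z = 0")
      case True
      then show ?thesis using M SN by force
    next
      case False
      then obtain p where p: "p \<in> P" "z \<in> snd p" using z slots OS(1) e_def by blast
      \<comment> \<open>The order of removal is weakly increasing in size, and the carrier of the
        slot is strictly larger than \<open>k\<close>.\<close>
      then have "\<not> removed_before p (k, S)" "p \<noteq> (k, S)" by (auto simp: removed_before_def P_def)
      then have "removed_before (k, S) p" using sorted_wrt_cases[OF ps(2) _ Sps, of p] p by (auto simp: P_def)
      then show ?thesis using p(2) M by (fastforce simp: removed_before_def)
    qed }
qed

text \<open>The last breakpoint below \<open>Min S\<close> opens the gap: the next one is not below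
  \<open>Min S\<close> and, as none hits the hull, lies beyond \<open>Max S\<close>.\<close>

lemma partition_by_increasing:
  fixes f :: "nat \<Rightarrow> 'a :: linorder"
  assumes "\<And>j. j < n \<Longrightarrow> f j < f (Suc j)" "finite S" "S \<noteq> {}" "f 0 < Min S" "Max S < f n"
    "\<And>j. j < n \<Longrightarrow> f j < Min S \<or> Max S < f j"
  shows "\<exists>!j. j < n \<and> S \<subseteq> {f j<..<f (Suc j)}"
proof -
  have mono: "f i \<le> f j" if "i \<le> j" "j \<le> n" for i j
    using that
  proof (induction j rule: dec_induct)
    case (step m)
    then show ?case using assms(1)[of m] by simp
  qed simp
  have MM: "Min S \<le> Max S" using assms(2,3) by (meson Max_in Min_le)
  define j where "j = Max {i. i \<le> n \<and> f i < Min S}"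
  have "0 \<in> {i. i \<le> n \<and> f i < Min S}" using assms(4) by simp
  then have "{i. i \<le> n \<and> f i < Min S} \<noteq> {}" by blast
  then have "j \<in> {i. i \<le> n \<and> f i < Min S}" unfolding j_def by (intro Max_in) auto
  then have j: "j \<le> n" "f j < Min S" by auto
  then have jn: "j < n" using assms(5) MM by (metis le_neq_implies_less less_asym less_le_trans)
  have "\<not> f (Suc j) < Min S"
  proof
    assume "f (Suc j) < Min S"
    then have "Suc j \<le> j" unfolding j_def using jn j_def by (intro Max_ge) auto
    then show False by simp
  qed
  then have "Max S < f (Suc j)" using assms(5) assms(6)[of "Suc j"] jn by (cases "Suc j = n") auto
  then have "S \<subseteq> {f j<..<f (Suc j)}"
    using j assms(2,3) by (meson Max_ge Min_le greaterThanLessThan_iff le_less_trans less_le_trans subsetI)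
  moreover have "i = j" if "i < n" "S \<subseteq> {f i<..<f (Suc i)}" for i
  proof (rule ccontr)
    assume "i \<noteq> j"
    obtain s where s: "s \<in> S" using assms(3) by blast
    have "f i < s" "s < f (Suc i)" "f j < s" "s < f (Suc j)" using s that(2) calculation by auto
    moreover have "f (Suc i) \<le> f j \<or> f (Suc j) \<le> f i" using mono \<open>i \<noteq> j\<close> that(1) jn by (metis Suc_leI less_imp_le linorder_neqE_nat)
    ultimately show False by (meson less_asym less_le_trans order.strict_trans)
  qed
  ultimately show ?thesis using jn by blast
qed

text \<open>No \<open>k\<close>-slot lies in the hull of a \<open>k\<close>-soliton, so the soliton
  sits in exactly one gap and is counted once.\<close>

lemma slot_diagram_norm_excursion_of:
  assumes xs: "xs \<in> run_lists 1"
  shows "slot_diagram_norm (excursion_of xs) k = num_solitons k (excursion_of xs)"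
proof -
  define e n where "e = excursion_of xs" and "n = num_slots e k"
  note sl = slots_excursion_of[OF xs, where k = k, folded e_def]
  have fin: "finite (slots e k)" using sl(2) finite_subset by blast
  define bs where "bs = sorted_list_of_set (slots e k)"
  have bs: "set bs = slots e k" "sorted_wrt (<) bs" "length bs = n"
    using fin by (auto simp: bs_def n_def num_slots_def)
  have n0: "0 < n" using slots_excursion_of(1)[OF xs, of k] by (simp add: n_def e_def)
  have last: "slot_pos e k n = int (sum_list xs) + 1"
    using half_length_excursion_of[OF xs] by (simp add: slot_pos_def n_def e_def flip: of_nat_mult of_nat_Suc)
  have pos: "slot_pos e k j = bs ! j" if "j < n" for j using that by (simp add: slot_pos_def bs_def n_def)
  have mem: "slot_pos e k j \<in> slots e k" if "j < n" for j using pos[OF that] bs that nth_mem by metis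
  have mono: "slot_pos e k j < slot_pos e k (Suc j)" if "j < n" for j
  proof (cases "Suc j = n")
    case True
    then show ?thesis using mem[OF that] sl(2) last by force
  next
    case False
    then show ?thesis using pos that bs by (simp add: sorted_wrt_nth_less)
  qed
  have zero: "slot_pos e k 0 \<le> 0"
  proof -
    have "0 \<in> set bs" using bs(1) by (simp add: slots_def)
    then obtain i where "i < n" "bs ! i = 0" using bs(3) by (metis in_set_conv_nth)
    then show ?thesis using pos[of 0] n0 bs by (cases i) (force simp: sorted_wrt_iff_nth_less)+
  qed
  have ex1: "\<exists>!j. j < n \<and> S \<subseteq> {slot_pos e k j<..<slot_pos e k (Suc j)}" if S: "S \<in> solitons e k" for S
  proof (rule partition_by_increasing)
    have S': "S \<noteq> {}" "S \<subseteq> {1..int (sum_list xs)}" using sl(4)[OF S] by auto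
    then show "S \<noteq> {}" "finite S" using finite_subset by blast+
    then have "Min S \<in> S" "Max S \<in> S" by auto
    then show "slot_pos e k 0 < Min S" "Max S < slot_pos e k n" using S' zero last by fastforce+
    show "slot_pos e k j < Min S \<or> Max S < slot_pos e k j" if "j < n" for j
      using sl(3)[OF S mem[OF that]] .
  qed (fact mono)
  have "slot_diagram_norm e k = (\<Sum>j<n. card {S \<in> solitons e k. S \<subseteq> {slot_pos e k j<..<slot_pos e k (Suc j)}})"
    by (simp add: slot_diagram_norm_def slot_diagram_def n_def)
  also have "\<dots> = card (\<Union>j<n. {S \<in> solitons e k. S \<subseteq> {slot_pos e k j<..<slot_pos e k (Suc j)}})"
    using ex1 num_solitons_excursion_of(2)[OF xs, of k]
    by (intro card_UN_disjoint[symmetric]) (auto simp: e_def)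
  also have "(\<Union>j<n. {S \<in> solitons e k. S \<subseteq> {slot_pos e k j<..<slot_pos e k (Suc j)}}) = solitons e k"
  proof (intro equalityI subsetI)
    fix S assume S: "S \<in> solitons e k"
    obtain j where "j < n" "S \<subseteq> {slot_pos e k j<..<slot_pos e k (Suc j)}" using ex1_implies_ex[OF ex1[OF S]] by blast
    then show "S \<in> (\<Union>j<n. {S \<in> solitons e k. S \<subseteq> {slot_pos e k j<..<slot_pos e k (Suc j)}})"
      using S by blast
  qed auto
  finally show ?thesis by (simp add: num_solitons_def e_def)
qed

section \<open>Summing out the solitons of one size\<close>

lemma nn_integral_count_space_Sigma:
  "(\<integral>\<^sup>+z. f z \<partial>count_space (Sigma A B)) = (\<integral>\<^sup>+x. \<integral>\<^sup>+y. f (x, y) \<partial>count_space (B x) \<partial>count_space A)"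
proof -
  have "(\<integral>\<^sup>+z. f z \<partial>count_space (Sigma A B)) = (\<integral>\<^sup>+z. f z * indicator (Sigma A B) z \<partial>count_space UNIV)"
    by (simp add: nn_integral_count_space_indicator)
  also have "\<dots> = (\<integral>\<^sup>+x. \<integral>\<^sup>+y. f (x, y) * indicator (Sigma A B) (x, y) \<partial>count_space UNIV \<partial>count_space UNIV)"
    by (rule nn_integral_fst_count_space[symmetric])
  also have "\<dots> = (\<integral>\<^sup>+x. (\<integral>\<^sup>+y. f (x, y) * indicator (B x) y \<partial>count_space UNIV) * indicator A x \<partial>count_space UNIV)"
    by (intro nn_integral_cong) (auto simp: indicator_def intro!: nn_integral_cong)
  also have "\<dots> = (\<integral>\<^sup>+x. \<integral>\<^sup>+y. f (x, y) \<partial>count_space (B x) \<partial>count_space A)"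
    by (simp add: nn_integral_count_space_indicator)
  finally show ?thesis .
qed

text \<open>Links the sums of the definitions to integrals, for which exchange of sums and monotone
  convergence are at hand.\<close>

lemma infsum_ennreal_eq_nn_integral:
  fixes f :: "'a \<Rightarrow> ennreal"
  assumes "countable A"
  shows "infsum f A = (\<integral>\<^sup>+x. f x \<partial>count_space A)"
proof (rule antisym)
  have "sum f F \<le> (\<integral>\<^sup>+x. f x \<partial>count_space A)" if "finite F" "F \<subseteq> A" for F
  proof -
    have "sum f F = (\<integral>\<^sup>+x. f x \<partial>count_space F)" using that by (simp add: nn_integral_count_space_finite)
    also have "\<dots> = (\<integral>\<^sup>+x. f x * indicator F x \<partial>count_space UNIV)"
      by (simp add: nn_integral_count_space_indicator)
    also have "\<dots> \<le> (\<integral>\<^sup>+x. f x * indicator A x \<partial>count_space UNIV)"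
      using that by (intro nn_integral_mono) (auto simp: indicator_def)
    finally show ?thesis by (simp add: nn_integral_count_space_indicator)
  qed
  then show "infsum f A \<le> (\<integral>\<^sup>+x. f x \<partial>count_space A)"
    by (subst nonneg_infsum_complete) (auto intro!: SUP_least)
  have sum_le: "sum f F \<le> infsum f A" if "finite F" "F \<subseteq> A" for F
    using that by (subst nonneg_infsum_complete) (auto intro!: SUP_upper)
  show "(\<integral>\<^sup>+x. f x \<partial>count_space A) \<le> infsum f A"
  proof (cases "finite A")
    case False
    define g where "g = from_nat_into A"
    have g: "bij_betw g UNIV A" unfolding g_def using assms False by (rule bij_betw_from_nat_into)
    have "(\<integral>\<^sup>+x. f x \<partial>count_space A) = (\<integral>\<^sup>+i. f (g i) \<partial>count_space UNIV)"
      using nn_integral_bij_count_space[OF g] by simp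
    also have "\<dots> = (\<Sum>i. f (g i))" by (rule nn_integral_count_space_nat)
    also have "\<dots> \<le> infsum f A"
    proof (rule suminf_le_const)
      show "(\<Sum>i<n. f (g i)) \<le> infsum f A" for n
      proof -
        have "(\<Sum>i<n. f (g i)) = sum f (g ` {..<n})"
          using g by (subst sum.reindex) (auto simp: bij_betw_def inj_on_def)
        also have "\<dots> \<le> infsum f A" using g by (intro sum_le) (auto simp: bij_betw_def)
        finally show ?thesis .
      qed
    qed auto
    finally show ?thesis .
  qed (simp add: nn_integral_count_space_finite)
qed

text \<open>One application sums over the admissible places of one insertion; the
  \<open>x\<close>-th iterate sums over weakly decreasing sequences of \<open>x\<close> places
  starting at most at \<open>r\<close>.\<close>

definition cumulate :: "(nat \<Rightarrow> ennreal) \<Rightarrow> nat \<Rightarrow> ennreal" where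
  "cumulate f r = (\<Sum>j\<le>r. f j)"

text \<open>Hockey-stick identity in the induction step.\<close>

lemma cumulate_power: "(cumulate ^^ x) (\<lambda>_. 1) r = of_nat ((r + x) choose x)"
proof (induction x arbitrary: r)
  case (Suc x)
  have "(cumulate ^^ Suc x) (\<lambda>_. 1) r = (\<Sum>j\<le>r. of_nat ((j + x) choose x))"
    by (simp add: cumulate_def Suc.IH)
  also have "\<dots> = of_nat (\<Sum>j\<le>r. (x + j) choose x)" by (simp add: add.commute)
  also have "(\<Sum>j\<le>r. (x + j) choose x) = (r + Suc x) choose Suc x"
    by (subst choose_rising_sum(1)) (simp add: add.commute)
  finally show ?case .
qed simp

text \<open>Undoing one insertion leaves the larger solitons alone, as the filter drops the new
  \<open>k\<close>, and turns \<open>room\<close> into the place \<open>j\<close>; the sum over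
  \<open>j\<close> replaces \<open>f\<close> by \<open>cumulate f\<close>. Hence \<open>f\<close>
  must be arbitrary in the induction.\<close>

lemma nn_integral_run_lists_num:
  assumes "0 < k"
  shows "(\<integral>\<^sup>+xs. g (filter ((<) k) (soliton_sizes xs)) * f (room k xs) \<partial>count_space (run_lists_num k x)) =
    (\<integral>\<^sup>+w. g (soliton_sizes w) * (cumulate ^^ x) f (room k w) \<partial>count_space (run_lists (Suc k)))"
proof (induction x arbitrary: f)
  case 0
  have "filter ((<) k) (soliton_sizes w) = soliton_sizes w" if "w \<in> run_lists (Suc k)" for w
    using set_soliton_sizes[OF that] by (auto simp: filter_id_conv)
  then show ?case unfolding run_lists_num_0[OF assms] by (intro nn_integral_cong) simp
next
  case (Suc x)
  let ?F = "\<lambda>ys. g (filter ((<) k) (soliton_sizes ys)) * f (room k ys)"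
  have "(\<integral>\<^sup>+ys. ?F ys \<partial>count_space (run_lists_num k (Suc x))) =
    (\<integral>\<^sup>+z. ?F ((\<lambda>(xs, j). insert_run k j xs) z) \<partial>count_space (Sigma (run_lists_num k x) (\<lambda>xs. {..room k xs})))"
    using nn_integral_bij_count_space[OF bij_betw_insert_run[OF assms, of x], of ?F] by simp
  also have "\<dots> = (\<integral>\<^sup>+xs. \<integral>\<^sup>+j. ?F (insert_run k j xs) \<partial>count_space {..room k xs} \<partial>count_space (run_lists_num k x))"
    by (subst nn_integral_count_space_Sigma) simp
  also have "\<dots> = (\<integral>\<^sup>+xs. g (filter ((<) k) (soliton_sizes xs)) * cumulate f (room k xs) \<partial>count_space (run_lists_num k x))"
  proof (intro nn_integral_cong)
    fix xs assume "xs \<in> space (count_space (run_lists_num k x))"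
    then have "xs \<in> run_lists k" by (simp add: run_lists_num_def)
    then show "(\<integral>\<^sup>+j. ?F (insert_run k j xs) \<partial>count_space {..room k xs}) = g (filter ((<) k) (soliton_sizes xs)) * cumulate f (room k xs)"
      by (simp add: nn_integral_count_space_finite soliton_sizes_insert_run room_insert_run cumulate_def sum_distrib_left)
  qed
  also have "\<dots> = (\<integral>\<^sup>+w. g (soliton_sizes w) * (cumulate ^^ x) (cumulate f) (room k w) \<partial>count_space (run_lists (Suc k)))"
    by (rule Suc.IH)
  finally show ?case by (simp add: funpow_swap1)
qed

lemma nn_integral_run_lists:
  assumes "0 < k"
  shows "(\<integral>\<^sup>+xs. F (count_list (soliton_sizes xs) k) (filter ((<) k) (soliton_sizes xs)) \<partial>count_space (run_lists k)) =
    (\<Sum>x. \<integral>\<^sup>+w. F x (soliton_sizes w) * of_nat ((room k w + x) choose x) \<partial>count_space (run_lists (Suc k)))"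
proof -
  let ?G = "\<lambda>xs. F (count_list (soliton_sizes xs) k) (filter ((<) k) (soliton_sizes xs))"
  have bij: "bij_betw snd (Sigma UNIV (run_lists_num k)) (run_lists k)"
    by (rule bij_betw_byWitness[where f' = "\<lambda>xs. (count_list (soliton_sizes xs) k, xs)"]) (auto simp: run_lists_num_def)
  have "(\<integral>\<^sup>+xs. ?G xs \<partial>count_space (run_lists k)) =
    (\<integral>\<^sup>+z. ?G (snd z) \<partial>count_space (Sigma UNIV (run_lists_num k)))"
    by (rule nn_integral_bij_count_space[OF bij, symmetric])
  also have "\<dots> = (\<Sum>x. \<integral>\<^sup>+xs. ?G xs \<partial>count_space (run_lists_num k x))"
    by (subst nn_integral_count_space_Sigma) (simp add: nn_integral_count_space_nat)
  also have "\<dots> = (\<Sum>x. \<integral>\<^sup>+xs. F x (filter ((<) k) (soliton_sizes xs)) * (\<lambda>_. 1) (room k xs) \<partial>count_space (run_lists_num k x))"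
    by (intro suminf_cong nn_integral_cong) (simp add: run_lists_num_def)
  also have "\<dots> = (\<Sum>x. \<integral>\<^sup>+w. F x (soliton_sizes w) * of_nat ((room k w + x) choose x) \<partial>count_space (run_lists (Suc k)))"
    using nn_integral_run_lists_num[OF assms, where f = "\<lambda>_. 1"] by (simp add: cumulate_power)
  finally show ?thesis .
qed

text \<open>The first is the binomial series with exponent \<open>- (r + 1)\<close>. The second
  reduces to it with \<open>r + 1\<close> for \<open>r\<close>, by absorbing the factor
  \<open>x\<close> into the binomial coefficient; it will supply the mean number of solitons of one
  size.\<close>

lemma negative_binomial_sums:
  fixes q :: real
  assumes "0 \<le> q" "q < 1"
  shows "(\<lambda>x. real ((r + x) choose x) * q ^ x) sums (1 / (1 - q) ^ (r + 1))"
    and "(\<lambda>x. real x * real ((r + x) choose x) * q ^ x) sums (real (r + 1) * q / (1 - q) ^ (r + 2))"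
proof -
  have *: "(\<lambda>x. real ((r + x) choose x) * q ^ x) sums (1 / (1 - q) ^ (r + 1))" for r
  proof -
    have "(- real (r + 1) gchoose x) * (- q) ^ x = real ((r + x) choose x) * q ^ x" for x
    proof -
      have "(- real (r + 1) gchoose x) = (- 1) ^ x * real ((r + x) choose x)"
        by (subst gbinomial_minus) (simp add: binomial_gbinomial add.commute)
      then show ?thesis by (simp add: power_mult_distrib[symmetric] flip: mult.assoc)
    qed
    moreover have "(1 + - q) powr (- real (r + 1)) = 1 / (1 - q) ^ (r + 1)"
      using assms by (simp add: powr_minus powr_realpow divide_inverse flip: of_nat_Suc)
    ultimately show ?thesis using gen_binomial_real[of "- q" "- real (r + 1)"] assms by simp
  qed
  show "(\<lambda>x. real ((r + x) choose x) * q ^ x) sums (1 / (1 - q) ^ (r + 1))" by (rule *)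
  have "Suc y * ((r + Suc y) choose Suc y) = Suc r * ((Suc r + y) choose y)" for y
  proof -
    have "Suc y * (Suc (r + y) choose Suc y) = Suc (r + y) * ((r + y) choose y)" by (rule Suc_times_binomial)
    also have "(r + y) choose y = (r + y) choose r" using binomial_symmetric[of y "r + y"] by simp
    also have "Suc (r + y) * ((r + y) choose r) = Suc r * (Suc (r + y) choose Suc r)" by (rule Suc_times_binomial[symmetric])
    also have "Suc (r + y) choose Suc r = (Suc r + y) choose y" using binomial_symmetric[of y "Suc r + y"] by simp
    finally show ?thesis by simp
  qed
  then have eq: "real (Suc y) * real ((r + Suc y) choose Suc y) * q ^ Suc y =
      real (Suc r) * q * (real ((Suc r + y) choose y) * q ^ y)" for y
    by (simp del: of_nat_Suc binomial_Suc_Suc add: mult_ac flip: of_nat_mult)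
  have "(\<lambda>y. real (Suc r) * q * (real ((Suc r + y) choose y) * q ^ y)) sums (real (Suc r) * q * (1 / (1 - q) ^ (Suc r + 1)))"
    by (rule sums_mult[OF *])
  then have "(\<lambda>y. real (Suc y) * real ((r + Suc y) choose Suc y) * q ^ Suc y) sums (real (r + 1) * q / (1 - q) ^ (r + 2))"
    unfolding eq by simp
  then show "(\<lambda>x. real x * real ((r + x) choose x) * q ^ x) sums (real (r + 1) * q / (1 - q) ^ (r + 2))"
    by (subst (asm) sums_Suc_iff) simp
qed

text \<open>A product weight times an affine function of the soliton numbers, with slope
  \<open>d l\<close> for size \<open>l\<close>. Such weights are closed under summing out the
  smallest size.\<close>

definition list_weight :: "real \<Rightarrow> (nat \<Rightarrow> real) \<Rightarrow> (nat \<Rightarrow> real) \<Rightarrow> nat list \<Rightarrow> real" where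
  "list_weight c d \<beta> ls = (c + (\<Sum>l\<leftarrow>ls. d l)) * (\<Prod>l\<leftarrow>ls. \<beta> l)"

definition total_weight :: "nat \<Rightarrow> real \<Rightarrow> (nat \<Rightarrow> real) \<Rightarrow> (nat \<Rightarrow> real) \<Rightarrow> ennreal" where
  "total_weight k c d \<beta> = (\<integral>\<^sup>+xs. ennreal (list_weight c d \<beta> (soliton_sizes xs)) \<partial>count_space (run_lists k))"

lemma list_weight_filter:
  assumes "\<forall>l \<in> set ls. k \<le> l"
  shows "list_weight c d \<beta> ls =
    (c + real (count_list ls k) * d k + (\<Sum>l\<leftarrow>filter ((<) k) ls. d l)) * (\<beta> k ^ count_list ls k * (\<Prod>l\<leftarrow>filter ((<) k) ls. \<beta> l))"
proof -
  have "(\<Sum>l\<leftarrow>ls. d l) = real (count_list ls k) * d k + (\<Sum>l\<leftarrow>filter ((<) k) ls. d l)"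
    using assms by (induction ls) (auto simp: algebra_simps)
  moreover have "(\<Prod>l\<leftarrow>ls. \<beta> l) = \<beta> k ^ count_list ls k * (\<Prod>l\<leftarrow>filter ((<) k) ls. \<beta> l)"
    using assms by (induction ls) auto
  ultimately show ?thesis by (simp add: list_weight_def)
qed

lemma list_weight_nonneg:
  assumes "\<forall>l \<in> set ls. 0 \<le> d l \<and> 0 \<le> \<beta> l" "0 \<le> c"
  shows "0 \<le> (\<Sum>l\<leftarrow>ls. d l)" "0 \<le> (\<Prod>l\<leftarrow>ls. \<beta> l)" "0 \<le> list_weight c d \<beta> ls"
proof -
  show *: "0 \<le> (\<Sum>l\<leftarrow>ls. d l)" "0 \<le> (\<Prod>l\<leftarrow>ls. \<beta> l)"
    using assms(1) by (induction ls) auto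
  show "0 \<le> list_weight c d \<beta> ls" using * assms(2) by (simp add: list_weight_def)
qed

text \<open>The number \<open>x\<close> of smallest solitons is separated but not yet summed over,
  so the formula serves both the convergent case and the divergent one.\<close>

lemma total_weight_expand:
  assumes "0 < k"
  shows "total_weight k c d \<beta> = (\<Sum>x. \<integral>\<^sup>+w. ennreal ((c + real x * d k + (\<Sum>l\<leftarrow>soliton_sizes w. d l)) * (\<beta> k ^ x * (\<Prod>l\<leftarrow>soliton_sizes w. \<beta> l))) *
    of_nat ((room k w + x) choose x) \<partial>count_space (run_lists (Suc k)))"
proof -
  have "total_weight k c d \<beta> = (\<integral>\<^sup>+xs. (\<lambda>x ls. ennreal ((c + real x * d k + (\<Sum>l\<leftarrow>ls. d l)) * (\<beta> k ^ x * (\<Prod>l\<leftarrow>ls. \<beta> l))))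
    (count_list (soliton_sizes xs) k) (filter ((<) k) (soliton_sizes xs)) \<partial>count_space (run_lists k))"
    unfolding total_weight_def
  proof (intro nn_integral_cong)
    fix xs assume "xs \<in> space (count_space (run_lists k))"
    then have "\<forall>l \<in> set (soliton_sizes xs). k \<le> l" using set_soliton_sizes[of xs k] assms by auto
    from list_weight_filter[OF this, of c d \<beta>]
    show "ennreal (list_weight c d \<beta> (soliton_sizes xs)) = (\<lambda>x ls. ennreal ((c + real x * d k + (\<Sum>l\<leftarrow>ls. d l)) * (\<beta> k ^ x * (\<Prod>l\<leftarrow>ls. \<beta> l))))
      (count_list (soliton_sizes xs) k) (filter ((<) k) (soliton_sizes xs))" by simp
  qed
  also note nn_integral_run_lists[OF assms]
  finally show ?thesis .
qed

text \<open>For fixed \<open>w\<close> and \<open>r = room k w\<close> the number \<open>x\<close>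
  has negative binomial weights, of total mass \<open>1 / (1 - q) ^ (r + 1)\<close> and mean
  \<open>(r + 1) * q / (1 - q)\<close>. The affine function is linear in \<open>x\<close>, so
  \<open>x\<close> is replaced by its mean. As \<open>r\<close> is a sum over the larger solitons,
  it changes \<open>d\<close> and \<open>\<beta>\<close>; the 1 in \<open>r + 1\<close> gives the
  prefactor and the change of \<open>c\<close>.\<close>

lemma total_weight_Suc:
  assumes "0 < k" "\<beta> k < 1" "0 \<le> c" "\<And>l. k \<le> l \<Longrightarrow> 0 \<le> d l \<and> 0 \<le> \<beta> l"
  defines "q \<equiv> \<beta> k"
  shows "total_weight k c d \<beta> = ennreal (1 / (1 - q)) *
    total_weight (Suc k) (c + d k * (q / (1 - q))) (\<lambda>l. d l + 2 * d k * (q / (1 - q)) * real (l - k))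
      (\<lambda>l. \<beta> l / (1 - q) ^ (2 * (l - k)))"
proof -
  define \<rho> where "\<rho> = q / (1 - q)"
  have q: "0 \<le> q" "q < 1" using assms by (auto simp: q_def)
  have "total_weight k c d \<beta> = (\<integral>\<^sup>+w. (\<Sum>x. ennreal ((c + real x * d k + (\<Sum>l\<leftarrow>soliton_sizes w. d l)) * (q ^ x * (\<Prod>l\<leftarrow>soliton_sizes w. \<beta> l))) *
    of_nat ((room k w + x) choose x)) \<partial>count_space (run_lists (Suc k)))"
    unfolding total_weight_expand[OF assms(1)] q_def by (rule nn_integral_suminf[symmetric]) simp
  also have "\<dots> = (\<integral>\<^sup>+w. ennreal (1 / (1 - q)) * ennreal (list_weight (c + d k * \<rho>) (\<lambda>l. d l + 2 * d k * \<rho> * real (l - k))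
      (\<lambda>l. \<beta> l / (1 - q) ^ (2 * (l - k))) (soliton_sizes w)) \<partial>count_space (run_lists (Suc k)))"
  proof (intro nn_integral_cong)
    fix w assume "w \<in> space (count_space (run_lists (Suc k)))"
    then have w: "w \<in> run_lists (Suc k)" by simp
    define D P r where "D = (\<Sum>l\<leftarrow>soliton_sizes w. d l)" and "P = (\<Prod>l\<leftarrow>soliton_sizes w. \<beta> l)" and "r = room k w"
    have DP: "0 \<le> D" "0 \<le> P" unfolding D_def P_def
      by (rule list_weight_nonneg[where c = 0 and \<beta> = \<beta> and d = d]; use set_soliton_sizes[OF w] assms(4) in fastforce)+
    have "(\<lambda>x. ((c + real x * d k + D) * (q ^ x * P)) * real ((r + x) choose x)) sums
      ((c + D) * P * (1 / (1 - q) ^ (r + 1)) + d k * P * (real (r + 1) * q / (1 - q) ^ (r + 2)))"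
    proof -
      have "(\<lambda>x. (c + D) * P * (real ((r + x) choose x) * q ^ x) + d k * P * (real x * real ((r + x) choose x) * q ^ x)) sums
        ((c + D) * P * (1 / (1 - q) ^ (r + 1)) + d k * P * (real (r + 1) * q / (1 - q) ^ (r + 2)))"
        by (intro sums_add sums_mult negative_binomial_sums q)
      then show ?thesis by (rule sums_cong[THEN iffD1, rotated]) (simp add: algebra_simps)
    qed
    then have "(\<Sum>x. ennreal (((c + real x * d k + D) * (q ^ x * P)) * real ((r + x) choose x))) =
      ennreal ((c + D) * P * (1 / (1 - q) ^ (r + 1)) + d k * P * (real (r + 1) * q / (1 - q) ^ (r + 2)))"
      using DP q assms(3,4) by (subst suminf_ennreal_eq) auto
    also have "(c + D) * P * (1 / (1 - q) ^ (r + 1)) + d k * P * (real (r + 1) * q / (1 - q) ^ (r + 2)) =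
      1 / (1 - q) * ((c + d k * \<rho> + (D + d k * \<rho> * real r)) * (P / (1 - q) ^ r))"
    proof -
      define u where "u = 1 - q"
      have "u \<noteq> 0" using q by (simp add: u_def)
      then show ?thesis unfolding \<rho>_def u_def[symmetric] by (simp add: field_simps)
    qed
    also have "D + d k * \<rho> * real r = (\<Sum>l\<leftarrow>soliton_sizes w. d l + 2 * d k * \<rho> * real (l - k))"
    proof -
      have "(\<Sum>l\<leftarrow>ls. d l + 2 * d k * \<rho> * real (l - k)) = (\<Sum>l\<leftarrow>ls. d l) + d k * \<rho> * real (\<Sum>l\<leftarrow>ls. 2 * (l - k))" for ls
        by (induction ls) (simp_all add: distrib_left mult_ac)
      then show ?thesis by (simp add: D_def r_def room_run_list_Suc[OF w])
    qed
    also have "P / (1 - q) ^ r = (\<Prod>l\<leftarrow>soliton_sizes w. \<beta> l / (1 - q) ^ (2 * (l - k)))"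
    proof -
      have "(\<Prod>l\<leftarrow>ls. \<beta> l / (1 - q) ^ (2 * (l - k))) = (\<Prod>l\<leftarrow>ls. \<beta> l) / (1 - q) ^ (\<Sum>l\<leftarrow>ls. 2 * (l - k))" for ls
        by (induction ls) (simp_all add: power_add)
      then show ?thesis by (simp add: P_def r_def room_run_list_Suc[OF w])
    qed
    also have "ennreal (1 / (1 - q) * X) = ennreal (1 / (1 - q)) * ennreal X" for X
      using q by (intro ennreal_mult') simp
    also have "(\<lambda>x. ennreal ((c + real x * d k + D) * (q ^ x * P) * real ((r + x) choose x))) =
        (\<lambda>x. ennreal ((c + real x * d k + D) * (q ^ x * P)) * of_nat ((r + x) choose x))"
      by (intro ext) (simp add: ennreal_mult'' ennreal_of_nat_eq_real_of_nat)
    finally show "(\<Sum>x. ennreal ((c + real x * d k + (\<Sum>l\<leftarrow>soliton_sizes w. d l)) * (q ^ x * (\<Prod>l\<leftarrow>soliton_sizes w. \<beta> l))) *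
      of_nat ((room k w + x) choose x)) = ennreal (1 / (1 - q)) * ennreal (list_weight (c + d k * \<rho>) (\<lambda>l. d l + 2 * d k * \<rho> * real (l - k))
      (\<lambda>l. \<beta> l / (1 - q) ^ (2 * (l - k))) (soliton_sizes w))"
      unfolding list_weight_def D_def[symmetric] P_def[symmetric] r_def[symmetric] .
  qed
  also have "\<dots> = ennreal (1 / (1 - q)) * total_weight (Suc k) (c + d k * \<rho>) (\<lambda>l. d l + 2 * d k * \<rho> * real (l - k))
      (\<lambda>l. \<beta> l / (1 - q) ^ (2 * (l - k)))"
    unfolding total_weight_def by (rule nn_integral_cmult) simp
  finally show ?thesis unfolding \<rho>_def .
qed

section \<open>Lower bound, divergence and degenerate case of the total weight\<close>

lemma Nil_in_run_lists: "[] \<in> run_lists k"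
  by (simp add: run_lists_def)

lemma total_weight_ge: "ennreal c \<le> total_weight k c d \<beta>"
proof -
  have "ennreal (list_weight c d \<beta> (soliton_sizes [])) \<le> total_weight k c d \<beta>"
    unfolding total_weight_def by (rule nn_integral_ge_point[OF Nil_in_run_lists])
  then show ?thesis by (simp add: list_weight_def)
qed

text \<open>Already \<open>w = []\<close> contributes \<open>\<beta> k ^ x \<ge> 1\<close> for each
  \<open>x\<close>, with binomial coefficient 1. This is how finiteness forces the parameters
  \<open>q\<close> below 1.\<close>

lemma total_weight_eq_top:
  assumes "0 < k" "1 \<le> \<beta> k"
  shows "total_weight k 1 (\<lambda>_. 0) \<beta> = \<infinity>"
proof -
  have "(1 :: ennreal) \<le> (\<integral>\<^sup>+w. ennreal ((1 + real x * 0 + (\<Sum>l\<leftarrow>soliton_sizes w. 0)) * (\<beta> k ^ x * (\<Prod>l\<leftarrow>soliton_sizes w. \<beta> l))) *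
    of_nat ((room k w + x) choose x) \<partial>count_space (run_lists (Suc k)))" (is "_ \<le> ?I x") for x
  proof -
    have "1 \<le> ennreal ((1 + real x * 0 + (\<Sum>l\<leftarrow>soliton_sizes []. 0)) * (\<beta> k ^ x * (\<Prod>l\<leftarrow>soliton_sizes []. \<beta> l))) * of_nat ((room k [] + x) choose x)"
      using one_le_power[OF assms(2), of x] by simp
    also have "\<dots> \<le> ?I x" by (rule nn_integral_ge_point[OF Nil_in_run_lists])
    finally show ?thesis .
  qed
  then have "(\<Sum>x::nat. 1 :: ennreal) \<le> (\<Sum>x. ?I x)" by (intro suminf_le) auto
  moreover have "(\<Sum>x::nat. 1 :: ennreal) = \<infinity>"
    using nn_integral_count_space_nat[of "\<lambda>_. 1"] by simp
  ultimately show ?thesis unfolding total_weight_expand[OF assms(1)] by (simp add: top.extremum_unique)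
qed

text \<open>Every nonempty run list contains a soliton, whose weight is 0.\<close>

lemma total_weight_vanishing:
  assumes "0 < k" "\<And>l. k \<le> l \<Longrightarrow> \<beta> l = 0"
  shows "total_weight k c d \<beta> = ennreal c"
proof -
  have "list_weight c d \<beta> (soliton_sizes xs) = 0" if xs: "xs \<in> run_lists k" "xs \<noteq> []" for xs
  proof -
    have "Min (set xs) \<in> set (soliton_sizes xs)" using xs(2) by (simp add: soliton_sizes.simps[of xs])
    then have "Min (set xs) \<in> set (soliton_sizes xs)" "\<beta> (Min (set xs)) = 0"
      using set_soliton_sizes[OF xs(1) assms(1)] assms(2) by auto
    then have "0 \<in> \<beta> ` set (soliton_sizes xs)" by (metis image_eqI)
    then show ?thesis by (simp add: list_weight_def prod_list_zero_iff)
  qed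
  then have "total_weight k c d \<beta> = (\<Sum>xs \<in> {[]}. ennreal (list_weight c d \<beta> (soliton_sizes xs)))"
    unfolding total_weight_def by (intro nn_integral_count_space') (auto simp: Nil_in_run_lists)
  then show ?thesis by (simp add: list_weight_def)
qed

section \<open>Partition function and mean length\<close>

text \<open>The weights that remain when the solitons of size less than \<open>k\<close> have been summed out.\<close>

definition beta :: "(nat \<Rightarrow> real) \<Rightarrow> nat \<Rightarrow> nat \<Rightarrow> real" where
  "beta \<alpha> k l = \<alpha> l / (\<Prod>j \<in> {1..<k}. (1 - q_rec \<alpha> j) ^ (2 * (l - j)))"

text \<open>The origin of the recursion for \<open>q\<close>: it is the weight left to a
  \<open>k\<close>-soliton once all smaller ones have been summed out.\<close>

lemma beta_diag: "beta \<alpha> k k = q_rec \<alpha> k"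
  by (simp add: beta_def q_rec.simps[of \<alpha> k])

lemma beta_1: "beta \<alpha> 1 = \<alpha>"
  by (simp add: beta_def fun_eq_iff)

lemma beta_Suc: "1 \<le> k \<Longrightarrow> beta \<alpha> (Suc k) l = beta \<alpha> k l / (1 - q_rec \<alpha> k) ^ (2 * (l - k))"
  by (simp add: beta_def)

lemma beta_nonneg:
  assumes "0 \<le> \<alpha> l" "\<And>j. 1 \<le> j \<Longrightarrow> j < k \<Longrightarrow> q_rec \<alpha> j < 1"
  shows "0 \<le> beta \<alpha> k l"
  unfolding beta_def using assms by (intro divide_nonneg_nonneg prod_nonneg) (auto simp: less_imp_le)

text \<open>With \<open>t = 0\<close> this computes the partition function; \<open>t = 1\<close> weights an excursion by its
  length plus one.\<close>

lemma total_weight_iterate: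
  assumes "\<And>l. 1 \<le> l \<Longrightarrow> 0 \<le> \<alpha> l" "1 \<le> k" "\<And>j. 1 \<le> j \<Longrightarrow> j < k \<Longrightarrow> q_rec \<alpha> j < 1" "t \<in> {0, 1}"
  shows "\<exists>c d. total_weight 1 1 (\<lambda>l. 2 * t * real l) \<alpha> =
      ennreal (\<Prod>j \<in> {1..<k}. 1 / (1 - q_rec \<alpha> j)) * total_weight k c d (beta \<alpha> k) \<and>
    1 + (\<Sum>j \<in> {1..<k}. 2 * t * real j * q_rec \<alpha> j) \<le> c \<and>
    c \<le> (\<Prod>j \<in> {1..<k}. 1 + 2 * t * real j * (q_rec \<alpha> j / (1 - q_rec \<alpha> j))) \<and>
    (\<forall>l \<ge> k. 2 * t * real l \<le> d l \<and> d l \<le> 2 * t * real l * c)"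
  using assms(2,3)
proof (induction k rule: dec_induct)
  case base
  show ?case
    by (rule exI[of _ 1], rule exI[of _ "\<lambda>l. 2 * t * real l"]) (simp add: beta_1[simplified])
next
  case (step k)
  define q where "q = q_rec \<alpha> k"
  define \<rho> where "\<rho> = q / (1 - q)"
  define Q where "Q = (\<Prod>j \<in> {1..<k}. 1 / (1 - q_rec \<alpha> j))"
  obtain c d where IH: "total_weight 1 1 (\<lambda>l. 2 * t * real l) \<alpha> = ennreal Q * total_weight k c d (beta \<alpha> k)"
    "1 + (\<Sum>j \<in> {1..<k}. 2 * t * real j * q_rec \<alpha> j) \<le> c"
    "c \<le> (\<Prod>j \<in> {1..<k}. 1 + 2 * t * real j * (q_rec \<alpha> j / (1 - q_rec \<alpha> j)))"
    "\<forall>l \<ge> k. 2 * t * real l \<le> d l \<and> d l \<le> 2 * t * real l * c"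
    using step.IH step.prems unfolding Q_def by (meson less_Suc_eq)
  have t: "0 \<le> t" using assms(4) by auto
  have q0: "0 \<le> q_rec \<alpha> j" if "1 \<le> j" "j \<le> k" for j
    using beta_nonneg[of \<alpha> j j] assms(1) step.prems that by (simp add: beta_diag)
  have q: "0 \<le> q" "q < 1" using q0[of k] step by (auto simp: q_def)
  have "q * (1 - q) \<le> q * 1" using q by (intro mult_left_mono) auto
  then have rho: "q \<le> \<rho>" "0 \<le> \<rho>" using q by (auto simp: \<rho>_def field_simps)
  have "0 \<le> (\<Sum>j \<in> {1..<k}. 2 * t * real j * q_rec \<alpha> j)" using t q0 by (intro sum_nonneg) auto
  then have c: "1 \<le> c" using IH(2) by simp
  have d: "0 \<le> d l" if "k \<le> l" for l using IH(4) that t by (meson mult_nonneg_nonneg of_nat_0_le_iff order.trans zero_le_numeral)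
  define d' where "d' l = d l + 2 * d k * \<rho> * real (l - k)" for l
  have Q0: "0 \<le> Q" unfolding Q_def using step.prems by (intro prod_nonneg) (auto simp: less_imp_le)
  have "total_weight k c d (beta \<alpha> k) = ennreal (1 / (1 - q)) * total_weight (Suc k) (c + d k * \<rho>) d' (beta \<alpha> (Suc k))"
  proof -
    have "beta \<alpha> (Suc k) = (\<lambda>l. beta \<alpha> k l / (1 - q) ^ (2 * (l - k)))"
      using step.hyps by (simp add: fun_eq_iff beta_Suc q_def)
    moreover have "0 \<le> beta \<alpha> k l" if "k \<le> l" for l
      using assms(1) step that by (intro beta_nonneg) auto
    ultimately show ?thesis
      using total_weight_Suc[of k "beta \<alpha> k" c d] step.hyps q c d
      by (simp add: beta_diag q_def[symmetric] \<rho>_def[symmetric] d'_def[abs_def])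
  qed
  then have "total_weight 1 1 (\<lambda>l. 2 * t * real l) \<alpha> =
      ennreal (Q * (1 / (1 - q))) * total_weight (Suc k) (c + d k * \<rho>) d' (beta \<alpha> (Suc k))"
    by (simp only: IH(1) ennreal_mult'[OF Q0] mult.assoc[where 'a = ennreal])
  also have "Q * (1 / (1 - q)) = (\<Prod>j \<in> {1..<Suc k}. 1 / (1 - q_rec \<alpha> j))"
    using step.hyps by (simp add: Q_def q_def)
  finally have 1: "total_weight 1 1 (\<lambda>l. 2 * t * real l) \<alpha> =
    ennreal (\<Prod>j \<in> {1..<Suc k}. 1 / (1 - q_rec \<alpha> j)) * total_weight (Suc k) (c + d k * \<rho>) d' (beta \<alpha> (Suc k))" .
  have dk: "2 * t * real k \<le> d k" "d k \<le> 2 * t * real k * c" using IH(4) by auto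
  \<comment> \<open>Lower bound: \<open>d k\<close> is at least its initial value
    \<open>2 * t * real k\<close>, and the odds \<rho> dominate \<open>q\<close>.\<close>
  have "2 * t * real k * q \<le> d k * \<rho>" using dk rho q d[of k] by (intro mult_mono) auto
  then have 2: "1 + (\<Sum>j \<in> {1..<Suc k}. 2 * t * real j * q_rec \<alpha> j) \<le> c + d k * \<rho>"
    using IH(2) step.hyps by (simp add: q_def)
  \<comment> \<open>Upper bound: \<open>d k\<close> exceeds its initial value at most by the factor
    \<open>c\<close>, so the increment of \<open>c\<close> is at most proportional to
    \<open>c\<close>.\<close>
  have "d k * \<rho> \<le> 2 * t * real k * c * \<rho>" using dk(2) rho by (intro mult_right_mono) auto
  then have "c + d k * \<rho> \<le> c * (1 + 2 * t * real k * \<rho>)" by (simp add: algebra_simps)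
  also have "\<dots> \<le> (\<Prod>j \<in> {1..<k}. 1 + 2 * t * real j * (q_rec \<alpha> j / (1 - q_rec \<alpha> j))) * (1 + 2 * t * real k * \<rho>)"
    using IH(3) t rho by (intro mult_right_mono) auto
  also have "\<dots> = (\<Prod>j \<in> {1..<Suc k}. 1 + 2 * t * real j * (q_rec \<alpha> j / (1 - q_rec \<alpha> j)))"
    using step.hyps by (simp add: q_def \<rho>_def)
  finally have 3: "c + d k * \<rho> \<le> (\<Prod>j \<in> {1..<Suc k}. 1 + 2 * t * real j * (q_rec \<alpha> j / (1 - q_rec \<alpha> j)))" .
  have 4: "2 * t * real l \<le> d' l \<and> d' l \<le> 2 * t * real l * (c + d k * \<rho>)" if "Suc k \<le> l" for l
  proof
    have "0 \<le> 2 * d k * \<rho> * real (l - k)" using d[of k] rho by simp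
    then show "2 * t * real l \<le> d' l" using IH(4) that unfolding d'_def by (metis Suc_leD add_increasing2)
    \<comment> \<open>For \<open>t = 0\<close> the bounds give \<open>d k = 0\<close>; for
      \<open>t = 1\<close> this is \<open>l - k \<le> l\<close>.\<close>
    have "2 * (d k * \<rho>) * real (l - k) \<le> 2 * t * real l * (d k * \<rho>)"
    proof (cases "t = 0")
      case True
      then show ?thesis using dk by simp
    next
      case False
      have "(d k * \<rho>) * real (l - k) \<le> (d k * \<rho>) * real l" using d[of k] rho by (intro mult_left_mono) auto
      then show ?thesis using False assms(4) by (simp add: mult.commute mult.left_commute)
    qed
    moreover have "d l \<le> 2 * t * real l * c" using IH(4) that by auto
    ultimately show "d' l \<le> 2 * t * real l * (c + d k * \<rho>)" unfolding d'_def by (simp add: algebra_simps)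
  qed
  show ?case using 1 2 3 4 by blast
qed

text \<open>Gives weight 0 to solitons larger than \<open>M\<close>, so that finitely many
  summations exhaust the total.\<close>

definition truncate_family :: "nat \<Rightarrow> (nat \<Rightarrow> real) \<Rightarrow> nat \<Rightarrow> real" where
  "truncate_family M \<alpha> l = (if l \<le> M then \<alpha> l else 0)"

lemma q_rec_truncate_family:
  "q_rec (truncate_family M \<alpha>) k = (if k \<le> M then q_rec \<alpha> k else 0)"
proof (induction k rule: less_induct)
  case (less k)
  show ?case
  proof (cases "k \<le> M")
    case True
    then have "(\<Prod>j \<in> {1..<k}. (1 - q_rec (truncate_family M \<alpha>) j) ^ (2 * (k - j))) =
      (\<Prod>j \<in> {1..<k}. (1 - q_rec \<alpha> j) ^ (2 * (k - j)))"
      using less by (intro prod.cong) auto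
    then show ?thesis using True by (subst (1 2) q_rec.simps) (simp add: truncate_family_def)
  qed (subst q_rec.simps, simp add: truncate_family_def)
qed

text \<open>After \<open>M\<close> summations only the empty run list has nonzero weight, so the
  remaining total is the constant \<open>c\<close> itself.\<close>

lemma total_weight_truncate:
  assumes "\<And>l. 1 \<le> l \<Longrightarrow> 0 \<le> \<alpha> l" "\<And>j. 1 \<le> j \<Longrightarrow> q_rec \<alpha> j < 1" "t \<in> {0, 1}"
  shows "\<exists>c. total_weight 1 1 (\<lambda>l. 2 * t * real l) (truncate_family M \<alpha>) =
      ennreal ((\<Prod>j \<in> {1..M}. 1 / (1 - q_rec \<alpha> j)) * c) \<and>
    1 + (\<Sum>j \<in> {1..M}. 2 * t * real j * q_rec \<alpha> j) \<le> c \<and>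
    c \<le> (\<Prod>j \<in> {1..M}. 1 + 2 * t * real j * (q_rec \<alpha> j / (1 - q_rec \<alpha> j)))"
proof -
  let ?\<alpha> = "truncate_family M \<alpha>"
  have q: "q_rec ?\<alpha> j = q_rec \<alpha> j" if "j \<in> {1..M}" for j using that by (simp add: q_rec_truncate_family)
  have 1: "0 \<le> ?\<alpha> l" if "1 \<le> l" for l using assms(1) that by (simp add: truncate_family_def)
  have 2: "q_rec ?\<alpha> j < 1" if "1 \<le> j" "j < Suc M" for j using assms(2) that by (simp add: q_rec_truncate_family)
  have eqs: "(\<Prod>j \<in> {1..<Suc M}. 1 / (1 - q_rec ?\<alpha> j)) = (\<Prod>j \<in> {1..M}. 1 / (1 - q_rec \<alpha> j))"
    "(\<Sum>j \<in> {1..<Suc M}. 2 * t * real j * q_rec ?\<alpha> j) = (\<Sum>j \<in> {1..M}. 2 * t * real j * q_rec \<alpha> j)"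
    "(\<Prod>j \<in> {1..<Suc M}. 1 + 2 * t * real j * (q_rec ?\<alpha> j / (1 - q_rec ?\<alpha> j))) =
      (\<Prod>j \<in> {1..M}. 1 + 2 * t * real j * (q_rec \<alpha> j / (1 - q_rec \<alpha> j)))"
    by (rule prod.cong sum.cong; auto simp: q)+
  have iter: "\<exists>c d. total_weight 1 1 (\<lambda>l. 2 * t * real l) ?\<alpha> =
      ennreal (\<Prod>j \<in> {1..M}. 1 / (1 - q_rec \<alpha> j)) * total_weight (Suc M) c d (beta ?\<alpha> (Suc M)) \<and>
    1 + (\<Sum>j \<in> {1..M}. 2 * t * real j * q_rec \<alpha> j) \<le> c \<and>
    c \<le> (\<Prod>j \<in> {1..M}. 1 + 2 * t * real j * (q_rec \<alpha> j / (1 - q_rec \<alpha> j))) \<and>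
    (\<forall>l \<ge> Suc M. 2 * t * real l \<le> d l \<and> d l \<le> 2 * t * real l * c)"
    unfolding eqs[symmetric] by (rule total_weight_iterate) (use 1 2 assms(3) in \<open>auto simp del: insert_iff\<close>)
  obtain c d where cd: "total_weight 1 1 (\<lambda>l. 2 * t * real l) ?\<alpha> =
      ennreal (\<Prod>j \<in> {1..M}. 1 / (1 - q_rec \<alpha> j)) * total_weight (Suc M) c d (beta ?\<alpha> (Suc M))"
    "1 + (\<Sum>j \<in> {1..M}. 2 * t * real j * q_rec \<alpha> j) \<le> c"
    "c \<le> (\<Prod>j \<in> {1..M}. 1 + 2 * t * real j * (q_rec \<alpha> j / (1 - q_rec \<alpha> j)))"
    using iter by (elim exE conjE) (rule that; assumption)
  have "total_weight (Suc M) c d (beta ?\<alpha> (Suc M)) = ennreal c"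
    by (rule total_weight_vanishing) (auto simp: beta_def truncate_family_def)
  moreover have "0 \<le> (\<Prod>j \<in> {1..M}. 1 / (1 - q_rec \<alpha> j))"
    using assms(2) by (intro prod_nonneg) (auto simp: less_imp_le)
  ultimately show ?thesis using cd by (intro exI[of _ c]) (simp add: ennreal_mult')
qed

text \<open>An excursion has finitely many solitons, so its truncated weight is 0 until
  \<open>M\<close> reaches the largest size and exact from then on.\<close>

lemma total_weight_eq_SUP:
  assumes "\<And>l. 1 \<le> l \<Longrightarrow> 0 \<le> \<alpha> l \<and> 0 \<le> d l" "0 \<le> c"
  shows "total_weight 1 c d \<alpha> = (SUP M. total_weight 1 c d (truncate_family M \<alpha>))"
proof -
  have trunc: "(\<Prod>l\<leftarrow>ls. truncate_family M \<alpha> l) = (if \<forall>l \<in> set ls. l \<le> M then \<Prod>l\<leftarrow>ls. \<alpha> l else 0)" for ls M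
    by (induction ls) (auto simp: truncate_family_def)
  let ?f = "\<lambda>M xs. ennreal (list_weight c d (truncate_family M \<alpha>) (soliton_sizes xs)) * indicator (run_lists 1) xs"
  let ?g = "\<lambda>xs. ennreal (list_weight c d \<alpha> (soliton_sizes xs)) * indicator (run_lists 1) xs"
  have le: "?f M xs \<le> ?f N xs" "?f M xs \<le> ?g xs" if "M \<le> N" for M N xs
  proof -
    have "?f M xs \<le> ?f N xs \<and> ?f M xs \<le> ?g xs"
    proof (cases "xs \<in> run_lists 1")
      case True
      have "0 \<le> list_weight c d \<alpha> (soliton_sizes xs)"
        using set_soliton_sizes[OF True] assms by (intro list_weight_nonneg) auto
      then show ?thesis using that by (auto simp: list_weight_def trunc indicator_def)
    qed simp
    then show "?f M xs \<le> ?f N xs" "?f M xs \<le> ?g xs" by auto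
  qed
  have sup: "(SUP M. ?f M xs) = ?g xs" for xs
  proof (rule antisym)
    have "l \<le> sum_list (soliton_sizes xs)" if "l \<in> set (soliton_sizes xs)" for l by (intro member_le_sum_list that) simp
    then have "?g xs = ?f (sum_list (soliton_sizes xs)) xs" by (auto simp: list_weight_def trunc)
    also have "\<dots> \<le> (SUP M. ?f M xs)" by (rule SUP_upper) simp
    finally show "?g xs \<le> (SUP M. ?f M xs)" .
  qed (intro SUP_least le(2)[OF order_refl])
  have "total_weight 1 c d \<alpha> = (\<integral>\<^sup>+xs. (SUP M. ?f M xs) \<partial>count_space UNIV)"
    unfolding sup total_weight_def by (simp add: nn_integral_count_space_indicator)
  also have "\<dots> = (SUP M. \<integral>\<^sup>+xs. ?f M xs \<partial>count_space UNIV)"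
    using le by (intro nn_integral_monotone_convergence_SUP) (auto simp: incseq_def le_fun_def)
  finally show ?thesis unfolding total_weight_def by (simp add: nn_integral_count_space_indicator)
qed

section \<open>Comparison of products with sums, and the finiteness criterion\<close>

lemma prod_one_plus_ge:
  fixes x :: "'a \<Rightarrow> real"
  assumes "finite A" "\<And>a. a \<in> A \<Longrightarrow> 0 \<le> x a"
  shows "1 + (\<Sum>a \<in> A. x a) \<le> (\<Prod>a \<in> A. 1 + x a)"
  using assms
proof (induction A rule: finite_induct)
  case (insert a A)
  then have IH: "1 + (\<Sum>a \<in> A. x a) \<le> (\<Prod>a \<in> A. 1 + x a)" by auto
  have "0 \<le> x a * (\<Sum>a \<in> A. x a)" using insert by (intro mult_nonneg_nonneg sum_nonneg) auto
  then have "1 + (\<Sum>a \<in> insert a A. x a) \<le> (1 + x a) * (1 + (\<Sum>a \<in> A. x a))"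
    using insert by (simp add: algebra_simps)
  also have "\<dots> \<le> (1 + x a) * (\<Prod>a \<in> A. 1 + x a)" using IH insert by (intro mult_left_mono) auto
  finally show ?case using insert by simp
qed simp

lemma prod_one_plus_le_exp:
  fixes x :: "'a \<Rightarrow> real"
  assumes "finite A" "\<And>a. a \<in> A \<Longrightarrow> 0 \<le> x a"
  shows "(\<Prod>a \<in> A. 1 + x a) \<le> exp (\<Sum>a \<in> A. x a)"
  using assms by (subst exp_sum) (auto intro!: prod_mono simp: exp_ge_add_one_self add.commute)

lemma summable_on_atLeast_1I:
  fixes f :: "nat \<Rightarrow> real"
  assumes "\<And>j. 1 \<le> j \<Longrightarrow> 0 \<le> f j" "\<And>M. (\<Sum>j \<in> {1..M}. f j) \<le> B"
  shows "f summable_on {1..}"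
proof (rule nonneg_bdd_above_summable_on)
  show "bdd_above (sum f ` {F. F \<subseteq> {1..} \<and> finite F})"
  proof (rule bdd_aboveI2)
    fix F :: "nat set" assume F: "F \<in> {F. F \<subseteq> {1..} \<and> finite F}"
    have "F \<subseteq> {1..Max F}" using F by auto
    then have "sum f F \<le> sum f {1..Max F}" using assms(1) by (intro sum_mono2) auto
    then show "sum f F \<le> B" using assms(2)[of "Max F"] by linarith
  qed
qed (use assms in auto)

lemma summable_on_atLeast_1D:
  fixes f :: "nat \<Rightarrow> real"
  assumes "f summable_on {1..}" "\<And>j. 1 \<le> j \<Longrightarrow> 0 \<le> f j"
  shows "\<exists>B. \<forall>M. (\<Sum>j \<in> {1..M}. f j) \<le> B" "summable (\<lambda>j. f (Suc j))"
proof -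
  have "(\<Sum>j \<in> {1..M}. f j) \<le> infsum f {1..}" for M
    using assms by (intro finite_sum_le_infsum) auto
  then show "\<exists>B. \<forall>M. (\<Sum>j \<in> {1..M}. f j) \<le> B" by blast
  have "(\<lambda>j. f (Suc j)) summable_on UNIV"
  proof -
    have "range Suc = {1..}" by (auto simp: image_iff Suc_le_eq gr0_conv_Suc)
    then show ?thesis using assms(1) summable_on_reindex[of Suc UNIV f] by (simp add: comp_def)
  qed
  then show "summable (\<lambda>j. f (Suc j))" using assms(2) by (simp add: summable_on_UNIV_nonneg_real_iff)
qed

text \<open>Summing out produces the odds \<open>q j / (1 - q j)\<close>, whereas the conditions
  speak about \<open>q j\<close>. Summability makes \<open>q j < 1 / 2\<close> from some index on,
  and the constant absorbs the finitely many exceptions.\<close>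

lemma odds_bound:
  fixes q :: "nat \<Rightarrow> real"
  assumes "q summable_on {1..}" "\<And>j. 1 \<le> j \<Longrightarrow> 0 \<le> q j \<and> q j < 1"
  shows "\<exists>C \<ge> 0. \<forall>j \<ge> 1. q j / (1 - q j) \<le> C * q j"
proof -
  have "summable (\<lambda>j. q (Suc j))" using summable_on_atLeast_1D(2)[OF assms(1)] assms(2) by blast
  then have "(\<lambda>j. q (Suc j)) \<longlonglongrightarrow> 0" by (rule summable_LIMSEQ_zero)
  then have "eventually (\<lambda>j. q (Suc j) < 1 / 2) sequentially" by (rule order_tendstoD) simp
  then obtain N where N: "\<And>j. N \<le> j \<Longrightarrow> q (Suc j) < 1 / 2" by (auto simp: eventually_sequentially)
  define C where "C = 2 + (\<Sum>j \<in> {1..N}. 1 / (1 - q j))"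
  have pos: "0 \<le> 1 / (1 - q j)" if "1 \<le> j" for j using assms(2)[OF that] by simp
  have S: "0 \<le> (\<Sum>j \<in> {1..N}. 1 / (1 - q j))" using pos by (intro sum_nonneg) auto
  have "q j / (1 - q j) \<le> C * q j" if j: "1 \<le> j" for j
  proof -
    have "1 / (1 - q j) \<le> C"
    proof (cases "j \<le> N")
      case True
      then have "1 / (1 - q j) \<le> (\<Sum>j \<in> {1..N}. 1 / (1 - q j))" using j pos by (intro member_le_sum) auto
      then show ?thesis by (simp add: C_def)
    next
      case False
      then have "q j < 1 / 2" using N[of "j - 1"] j by simp
      then have "1 / (1 - q j) \<le> 2" by (simp add: field_simps)
      then show ?thesis using S by (simp add: C_def)
    qed
    then have "1 / (1 - q j) * q j \<le> C * q j" using assms(2)[OF j] by (intro mult_right_mono) auto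
    then show ?thesis by simp
  qed
  moreover have "0 \<le> C" using S by (simp add: C_def)
  ultimately show ?thesis by blast
qed

text \<open>A truncated total is the product of all \<open>1 + r j\<close> times \<open>c\<close>,
  and \<open>c\<close> is caught between a sum and a product of the same kind. Such products lie
  between 1 plus the sum and its exponential, so boundedness in \<open>M\<close> is
  summability.\<close>

lemma total_weight_finite_iff:
  assumes \<alpha>: "\<And>l. 1 \<le> l \<Longrightarrow> 0 \<le> \<alpha> l" and q: "\<And>j. 1 \<le> j \<Longrightarrow> 0 \<le> q_rec \<alpha> j \<and> q_rec \<alpha> j < 1" and t: "t \<in> {0, 1}"
  shows "total_weight 1 1 (\<lambda>l. 2 * t * real l) \<alpha> < \<infinity> \<longleftrightarrow>
    q_rec \<alpha> summable_on {1..} \<and> (\<lambda>j. t * real j * q_rec \<alpha> j) summable_on {1..}"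
proof -
  define r where "r j = q_rec \<alpha> j / (1 - q_rec \<alpha> j)" for j
  have r: "0 \<le> r j" "q_rec \<alpha> j \<le> r j" "1 / (1 - q_rec \<alpha> j) = 1 + r j" if "1 \<le> j" for j
  proof -
    have "q_rec \<alpha> j * (1 - q_rec \<alpha> j) \<le> q_rec \<alpha> j * 1" using q[OF that] by (intro mult_left_mono) auto
    then show "q_rec \<alpha> j \<le> r j" using q[OF that] by (simp add: r_def field_simps)
    show "0 \<le> r j" "1 / (1 - q_rec \<alpha> j) = 1 + r j" using q[OF that] by (simp_all add: r_def field_simps)
  qed
  have t0: "0 \<le> t" using t by auto
  have trunc: "\<exists>c. total_weight 1 1 (\<lambda>l. 2 * t * real l) (truncate_family M \<alpha>) = ennreal ((\<Prod>j \<in> {1..M}. 1 + r j) * c) \<and>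
    1 + (\<Sum>j \<in> {1..M}. 2 * t * real j * q_rec \<alpha> j) \<le> c \<and> c \<le> (\<Prod>j \<in> {1..M}. 1 + 2 * t * real j * r j)" for M
  proof -
    have eq: "(\<Prod>j \<in> {1..M}. 1 + r j) = (\<Prod>j \<in> {1..M}. 1 / (1 - q_rec \<alpha> j))"
      by (rule prod.cong) (auto simp: r(3))
    show ?thesis unfolding eq unfolding r_def
      by (rule total_weight_truncate) (use \<alpha> q t in \<open>auto simp del: insert_iff\<close>)
  qed
  have SUP: "total_weight 1 1 (\<lambda>l. 2 * t * real l) \<alpha> = (SUP M. total_weight 1 1 (\<lambda>l. 2 * t * real l) (truncate_family M \<alpha>))"
    using \<alpha> t0 by (intro total_weight_eq_SUP) auto
  have sums: "0 \<le> (\<Sum>j \<in> {1..M}. q_rec \<alpha> j)" "0 \<le> (\<Sum>j \<in> {1..M}. t * real j * q_rec \<alpha> j)" for M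
    using q t0 by (auto intro!: sum_nonneg)
  show ?thesis
  proof
    assume fin: "total_weight 1 1 (\<lambda>l. 2 * t * real l) \<alpha> < \<infinity>"
    define B where "B = enn2real (total_weight 1 1 (\<lambda>l. 2 * t * real l) \<alpha>)"
    \<comment> \<open>Both factors are at least 1, so a bound for their product bounds each of the
      two sums.\<close>
    have B: "(1 + (\<Sum>j \<in> {1..M}. q_rec \<alpha> j)) * (1 + 2 * (\<Sum>j \<in> {1..M}. t * real j * q_rec \<alpha> j)) \<le> B" for M
    proof -
      obtain c where c: "total_weight 1 1 (\<lambda>l. 2 * t * real l) (truncate_family M \<alpha>) = ennreal ((\<Prod>j \<in> {1..M}. 1 + r j) * c)"
        "1 + (\<Sum>j \<in> {1..M}. 2 * t * real j * q_rec \<alpha> j) \<le> c" using trunc[of M] by blast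
      have "1 + (\<Sum>j \<in> {1..M}. q_rec \<alpha> j) \<le> 1 + (\<Sum>j \<in> {1..M}. r j)" using r(2) by (intro add_left_mono sum_mono) auto
      also have "\<dots> \<le> (\<Prod>j \<in> {1..M}. 1 + r j)" using r by (intro prod_one_plus_ge) auto
      finally have P: "1 + (\<Sum>j \<in> {1..M}. q_rec \<alpha> j) \<le> (\<Prod>j \<in> {1..M}. 1 + r j)" .
      have "(\<Sum>j \<in> {1..M}. 2 * t * real j * q_rec \<alpha> j) = 2 * (\<Sum>j \<in> {1..M}. t * real j * q_rec \<alpha> j)"
        by (simp add: sum_distrib_left mult.assoc)
      then have "1 + 2 * (\<Sum>j \<in> {1..M}. t * real j * q_rec \<alpha> j) \<le> c" using c(2) by simp
      with P have "(1 + (\<Sum>j \<in> {1..M}. q_rec \<alpha> j)) * (1 + 2 * (\<Sum>j \<in> {1..M}. t * real j * q_rec \<alpha> j)) \<le> (\<Prod>j \<in> {1..M}. 1 + r j) * c"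
        using sums[of M] by (intro mult_mono) linarith+
      moreover have "total_weight 1 1 (\<lambda>l. 2 * t * real l) (truncate_family M \<alpha>) \<le> total_weight 1 1 (\<lambda>l. 2 * t * real l) \<alpha>"
        unfolding SUP by (rule SUP_upper) simp
      then have "ennreal ((\<Prod>j \<in> {1..M}. 1 + r j) * c) \<le> ennreal B"
        using fin unfolding B_def c(1) by simp
      then have "(\<Prod>j \<in> {1..M}. 1 + r j) * c \<le> B" by (subst (asm) ennreal_le_iff) (simp_all add: B_def)
      ultimately show ?thesis by simp
    qed
    have "(\<Sum>j \<in> {1..M}. q_rec \<alpha> j) \<le> B \<and> (\<Sum>j \<in> {1..M}. t * real j * q_rec \<alpha> j) \<le> B" for M
    proof -
      let ?x = "\<Sum>j \<in> {1..M}. q_rec \<alpha> j" and ?y = "\<Sum>j \<in> {1..M}. t * real j * q_rec \<alpha> j"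
      have "0 \<le> ?x * ?y" using sums[of M] by simp
      moreover have "(1 + ?x) * (1 + 2 * ?y) = 1 + ?x + 2 * ?y + 2 * (?x * ?y)" by (simp add: algebra_simps)
      ultimately show ?thesis using B[of M] sums[of M] by linarith
    qed
    then show "q_rec \<alpha> summable_on {1..} \<and> (\<lambda>j. t * real j * q_rec \<alpha> j) summable_on {1..}"
      using q t0 by (intro conjI summable_on_atLeast_1I[where B = B]) auto
  next
    assume S: "q_rec \<alpha> summable_on {1..} \<and> (\<lambda>j. t * real j * q_rec \<alpha> j) summable_on {1..}"
    obtain B1 where B1: "\<And>M. (\<Sum>j \<in> {1..M}. q_rec \<alpha> j) \<le> B1" using summable_on_atLeast_1D(1)[of "q_rec \<alpha>"] S q by blast
    obtain B2 where B2: "\<And>M. (\<Sum>j \<in> {1..M}. t * real j * q_rec \<alpha> j) \<le> B2"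
      using summable_on_atLeast_1D(1)[of "\<lambda>j. t * real j * q_rec \<alpha> j"] S q t0 by (meson mult_nonneg_nonneg of_nat_0_le_iff)
    obtain C where C: "0 \<le> C" "\<And>j. 1 \<le> j \<Longrightarrow> r j \<le> C * q_rec \<alpha> j" using odds_bound[of "q_rec \<alpha>"] S q unfolding r_def by blast
    have "total_weight 1 1 (\<lambda>l. 2 * t * real l) (truncate_family M \<alpha>) \<le> ennreal (exp (C * B1) * exp (2 * C * B2))" for M
    proof -
      obtain c where c: "total_weight 1 1 (\<lambda>l. 2 * t * real l) (truncate_family M \<alpha>) = ennreal ((\<Prod>j \<in> {1..M}. 1 + r j) * c)"
        "1 + (\<Sum>j \<in> {1..M}. 2 * t * real j * q_rec \<alpha> j) \<le> c" "c \<le> (\<Prod>j \<in> {1..M}. 1 + 2 * t * real j * r j)"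
        using trunc[of M] by blast
      have "0 \<le> (\<Sum>j \<in> {1..M}. 2 * t * real j * q_rec \<alpha> j)" using q t0 by (intro sum_nonneg) auto
      then have c0: "0 \<le> c" using c(2) by simp
      have "(\<Prod>j \<in> {1..M}. 1 + r j) \<le> exp (\<Sum>j \<in> {1..M}. r j)" using r by (intro prod_one_plus_le_exp) auto
      also have "(\<Sum>j \<in> {1..M}. r j) \<le> (\<Sum>j \<in> {1..M}. C * q_rec \<alpha> j)" using C by (intro sum_mono) auto
      also have "\<dots> \<le> C * B1" using B1[of M] C(1) by (simp add: mult_left_mono flip: sum_distrib_left)
      finally have 1: "(\<Prod>j \<in> {1..M}. 1 + r j) \<le> exp (C * B1)" by simp
      have "c \<le> exp (\<Sum>j \<in> {1..M}. 2 * t * real j * r j)"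
        using c(3) prod_one_plus_le_exp[of "{1..M}" "\<lambda>j. 2 * t * real j * r j"] r t0 by fastforce
      also have "(\<Sum>j \<in> {1..M}. 2 * t * real j * r j) \<le> (\<Sum>j \<in> {1..M}. 2 * t * real j * (C * q_rec \<alpha> j))"
        using C t0 by (intro sum_mono mult_left_mono) auto
      also have "\<dots> = 2 * C * (\<Sum>j \<in> {1..M}. t * real j * q_rec \<alpha> j)" by (simp add: sum_distrib_left mult_ac)
      also have "\<dots> \<le> 2 * C * B2" using B2[of M] C(1) by (intro mult_left_mono) auto
      finally have 2: "c \<le> exp (2 * C * B2)" by simp
      show ?thesis unfolding c(1) using 1 2 c0 by (intro ennreal_leI mult_mono) auto
    qed
    then have "total_weight 1 1 (\<lambda>l. 2 * t * real l) \<alpha> \<le> ennreal (exp (C * B1) * exp (2 * C * B2))"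
      unfolding SUP by (intro SUP_least)
    then show "total_weight 1 1 (\<lambda>l. 2 * t * real l) \<alpha> < \<infinity>" by (simp add: order.strict_trans1)
  qed
qed

text \<open>At \<open>t = 0\<close> the lower and the upper bound for \<open>c\<close> are both
  1.\<close>

lemma total_weight_unit:
  assumes "\<And>l. 1 \<le> l \<Longrightarrow> 0 \<le> \<alpha> l" "\<And>j. 1 \<le> j \<Longrightarrow> q_rec \<alpha> j < 1"
  shows "total_weight 1 1 (\<lambda>_. 0) \<alpha> = (SUP M. ennreal (\<Prod>j \<in> {1..M}. 1 / (1 - q_rec \<alpha> j)))"
proof -
  have "total_weight 1 1 (\<lambda>_. 0) (truncate_family M \<alpha>) = ennreal (\<Prod>j \<in> {1..M}. 1 / (1 - q_rec \<alpha> j))" for M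
    using total_weight_truncate[of \<alpha> 0 M] assms by auto
  then show ?thesis using total_weight_eq_SUP[of \<alpha> "\<lambda>_. 0" 1] assms(1) by simp
qed

lemma total_weight_cong:
  assumes "0 < k" "\<And>l. k \<le> l \<Longrightarrow> d l = d' l"
  shows "total_weight k c d \<beta> = total_weight k c d' \<beta>"
proof -
  have "list_weight c d \<beta> (soliton_sizes xs) = list_weight c d' \<beta> (soliton_sizes xs)" if "xs \<in> run_lists k" for xs
  proof -
    have "map d (soliton_sizes xs) = map d' (soliton_sizes xs)" using set_soliton_sizes[OF that assms(1)] assms(2) by (intro map_cong) auto
    then show ?thesis unfolding list_weight_def by (simp only:)
  qed
  then show ?thesis unfolding total_weight_def by (intro nn_integral_cong) simp
qed

text \<open>By induction the smaller sizes can be summed out. The remaining total is finite, but it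
  would be infinite if its smallest weight, which is \<open>q_rec \<alpha> k\<close>, were at least
  1.\<close>

lemma q_rec_less_1:
  assumes "\<And>l. 1 \<le> l \<Longrightarrow> 0 \<le> \<alpha> l" "total_weight 1 1 (\<lambda>_. 0) \<alpha> < \<infinity>" "1 \<le> k"
  shows "q_rec \<alpha> k < 1"
  using assms(3)
proof (induction k rule: less_induct)
  case (less k)
  then have IH: "q_rec \<alpha> j < 1" if "1 \<le> j" "j < k" for j using that by auto
  define Q where "Q = (\<Prod>j \<in> {1..<k}. 1 / (1 - q_rec \<alpha> j))"
  have Q: "0 < Q" unfolding Q_def using IH by (intro prod_pos) auto
  have "\<exists>c d. total_weight 1 1 (\<lambda>l. 2 * 0 * real l) \<alpha> = ennreal Q * total_weight k c d (beta \<alpha> k) \<and>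
    1 + (\<Sum>j \<in> {1..<k}. 2 * 0 * real j * q_rec \<alpha> j) \<le> c \<and>
    c \<le> (\<Prod>j \<in> {1..<k}. 1 + 2 * 0 * real j * (q_rec \<alpha> j / (1 - q_rec \<alpha> j))) \<and>
    (\<forall>l \<ge> k. 2 * 0 * real l \<le> d l \<and> d l \<le> 2 * 0 * real l * c)"
    unfolding Q_def by (rule total_weight_iterate) (use assms(1) less.prems IH in auto)
  then obtain c d where cd: "total_weight 1 1 (\<lambda>l. 2 * 0 * real l) \<alpha> = ennreal Q * total_weight k c d (beta \<alpha> k)"
    "1 + (\<Sum>j \<in> {1..<k}. 2 * 0 * real j * q_rec \<alpha> j) \<le> c"
    "c \<le> (\<Prod>j \<in> {1..<k}. 1 + 2 * 0 * real j * (q_rec \<alpha> j / (1 - q_rec \<alpha> j)))"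
    "\<forall>l \<ge> k. 2 * 0 * real l \<le> d l \<and> d l \<le> 2 * 0 * real l * c"
    by (elim exE conjE) (rule that; assumption)
  have c: "c = 1" using cd(2,3) by simp
  have d: "d l = 0" if "k \<le> l" for l using cd(4) that by (auto intro: antisym)
  have "total_weight k c d (beta \<alpha> k) = total_weight k 1 (\<lambda>_. 0) (beta \<alpha> k)"
    using total_weight_cong[of k d "\<lambda>_. 0"] less.prems c d by auto
  then have "ennreal Q * total_weight k 1 (\<lambda>_. 0) (beta \<alpha> k) < \<infinity>" using cd(1) assms(2) by simp
  then have "total_weight k 1 (\<lambda>_. 0) (beta \<alpha> k) \<noteq> \<infinity>" using Q by (auto simp: ennreal_mult_top)
  then show "q_rec \<alpha> k < 1" using total_weight_eq_top[of k "beta \<alpha> k"] less.prems by (force simp: beta_diag)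
qed

section \<open>The two families of measures\<close>

lemma member_le_sum_list_nat: "l \<in> set ls \<Longrightarrow> l \<le> sum_list (ls :: nat list)"
  by (intro member_le_sum_list) auto

lemma prod_list_eq_prod_count:
  fixes f :: "nat \<Rightarrow> real"
  assumes "\<forall>l \<in> set ls. 1 \<le> l \<and> l \<le> B"
  shows "(\<Prod>l\<leftarrow>ls. f l) = (\<Prod>k<B. f (Suc k) ^ count_list ls (Suc k))"
  using assms
proof (induction ls)
  case (Cons l ls)
  \<comment> \<open>An entry \<open>l\<close> acts on index \<open>l - 1\<close>, since index
    \<open>k\<close> stands for size \<open>Suc k\<close>.\<close>
  have "(\<Prod>k<B. f (Suc k) ^ count_list (l # ls) (Suc k)) =
    (\<Prod>k<B. (if k = l - 1 then f l else 1) * f (Suc k) ^ count_list ls (Suc k))"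
    using Cons.prems by (intro prod.cong) auto
  also have "\<dots> = f l * (\<Prod>k<B. f (Suc k) ^ count_list ls (Suc k))"
    using Cons.prems unfolding prod.distrib by (subst prod.delta) auto
  finally show ?case using Cons by simp
qed simp

lemma sum_list_eq_sum_count:
  assumes "\<forall>l \<in> set ls. 1 \<le> l \<and> l \<le> B"
  shows "sum_list ls = (\<Sum>k<B. Suc k * count_list ls (Suc k))"
  using assms
proof (induction ls)
  case (Cons l ls)
  have "(\<Sum>k<B. Suc k * count_list (l # ls) (Suc k)) =
    (\<Sum>k<B. (if k = l - 1 then l else 0) + Suc k * count_list ls (Suc k))"
    using Cons.prems by (intro sum.cong) auto
  also have "\<dots> = l + (\<Sum>k<B. Suc k * count_list ls (Suc k))"
    using Cons.prems unfolding sum.distrib by (subst sum.delta) auto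
  finally show ?case using Cons by simp
qed simp

lemma soliton_sizes_bounds:
  assumes "xs \<in> run_lists 1"
  shows "\<forall>l \<in> set (soliton_sizes xs). 1 \<le> l \<and> l \<le> sum_list (soliton_sizes xs)"
  using set_soliton_sizes[OF assms] member_le_sum_list_nat by auto

lemma count_list_soliton_sizes_eq_0: "sum_list (soliton_sizes xs) \<le> k \<Longrightarrow> count_list (soliton_sizes xs) (Suc k) = 0"
  using member_le_sum_list_nat[of "Suc k" "soliton_sizes xs"] by (auto simp: count_list_0_iff)

lemma alpha_weight_excursion_of:
  assumes xs: "xs \<in> run_lists 1"
  shows "alpha_weight \<alpha> (excursion_of xs) = ennreal (\<Prod>l\<leftarrow>soliton_sizes xs. \<alpha> l)"
proof -
  have "(\<Prod>k. \<alpha> (Suc k) ^ num_solitons (Suc k) (excursion_of xs)) =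
    (\<Prod>k<sum_list (soliton_sizes xs). \<alpha> (Suc k) ^ num_solitons (Suc k) (excursion_of xs))"
    by (rule prodinf_finite) (auto simp: num_solitons_excursion_of[OF xs] count_list_soliton_sizes_eq_0)
  also have "\<dots> = (\<Prod>l\<leftarrow>soliton_sizes xs. \<alpha> l)"
    using prod_list_eq_prod_count[OF soliton_sizes_bounds[OF xs], of \<alpha>] by (simp add: num_solitons_excursion_of[OF xs])
  finally show ?thesis by (simp add: alpha_weight_def)
qed

lemma infsum_excursions:
  fixes f :: "int list \<Rightarrow> ennreal"
  shows "(\<Sum>\<^sub>\<infinity>e \<in> excursions. f e) = (\<integral>\<^sup>+xs. f (excursion_of xs) \<partial>count_space (run_lists 1))"
  using nn_integral_bij_count_space[OF bij_betw_excursion_of, of f]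
  by (subst infsum_ennreal_eq_nn_integral) auto

lemma partition_function_eq: "partition_function \<alpha> = total_weight 1 1 (\<lambda>_. 0) \<alpha>"
proof -
  have [simp]: "(\<Sum>l\<leftarrow>ls. 0 :: real) = 0" for ls :: "nat list" by (induction ls) auto
  show ?thesis unfolding partition_function_def total_weight_def infsum_excursions
    by (intro nn_integral_cong) (simp add: alpha_weight_excursion_of list_weight_def)
qed

lemma partition_function_ge_1: "1 \<le> partition_function \<alpha>"
  using total_weight_ge[of 1 1 "\<lambda>_. 0" \<alpha>] by (simp add: partition_function_eq)

text \<open>Exchanging sums, the mean length is \<open>I / Z\<close>, where \<open>I\<close> is the
  sum of all lengths with the weights \<open>w\<close>; constant 1 and slopes \<open>2 * l\<close>
  give \<open>Z + I\<close>. Since \<open>Z\<close> is finite and at least 1, both are finite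
  exactly if \<open>I\<close> is.\<close>

lemma mean_length_finite_iff:
  assumes Z: "partition_function \<alpha> < \<infinity>" and \<alpha>: "\<And>l. 1 \<le> l \<Longrightarrow> 0 \<le> \<alpha> l"
  shows "(\<Sum>\<^sub>\<infinity>k \<in> {1..}. of_nat (2 * k) * rho \<alpha> k) < \<infinity> \<longleftrightarrow>
    total_weight 1 1 (\<lambda>l. 2 * real l) \<alpha> < \<infinity>"
proof -
  define Z where "Z = partition_function \<alpha>"
  define w where "w xs = ennreal (\<Prod>l\<leftarrow>soliton_sizes xs. \<alpha> l)" for xs
  define I where "I = (\<integral>\<^sup>+xs. of_nat (2 * sum_list (soliton_sizes xs)) * w xs \<partial>count_space (run_lists 1))"
  have Z0: "Z \<noteq> 0" "Z \<noteq> \<infinity>" using assms partition_function_ge_1[of \<alpha>] by (auto simp: Z_def)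
  have bij: "bij_betw Suc UNIV {1..}"
    by (rule bij_betw_byWitness[where f' = "\<lambda>n. n - 1"]) auto
  have rho: "rho \<alpha> k = (\<integral>\<^sup>+xs. of_nat (count_list (soliton_sizes xs) k) * (w xs / Z) \<partial>count_space (run_lists 1))" for k
    unfolding rho_def infsum_excursions
    by (intro nn_integral_cong) (simp add: num_solitons_excursion_of nu_weight_def alpha_weight_excursion_of w_def Z_def)
  have "(\<Sum>\<^sub>\<infinity>k \<in> {1..}. of_nat (2 * k) * rho \<alpha> k) = (\<Sum>i. of_nat (2 * Suc i) * rho \<alpha> (Suc i))"
    using nn_integral_bij_count_space[OF bij, of "\<lambda>k. of_nat (2 * k) * rho \<alpha> k"]
    by (subst infsum_ennreal_eq_nn_integral) (simp_all add: nn_integral_count_space_nat)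
  also have "\<dots> = (\<Sum>i. \<integral>\<^sup>+xs. of_nat (2 * Suc i) * (of_nat (count_list (soliton_sizes xs) (Suc i)) * (w xs / Z)) \<partial>count_space (run_lists 1))"
    unfolding rho by (intro suminf_cong nn_integral_cmult[symmetric]) simp
  also have "\<dots> = (\<integral>\<^sup>+xs. (\<Sum>i. of_nat (2 * Suc i) * (of_nat (count_list (soliton_sizes xs) (Suc i)) * (w xs / Z))) \<partial>count_space (run_lists 1))"
    by (rule nn_integral_suminf[symmetric]) simp
  also have "\<dots> = (\<integral>\<^sup>+xs. of_nat (2 * sum_list (soliton_sizes xs)) * w xs * inverse Z \<partial>count_space (run_lists 1))"
  proof (intro nn_integral_cong)
    fix xs assume "xs \<in> space (count_space (run_lists 1))"
    then have xs: "xs \<in> run_lists 1" by simp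
    have "(\<Sum>i. of_nat (2 * Suc i) * (of_nat (count_list (soliton_sizes xs) (Suc i)) * (w xs / Z))) =
      (\<Sum>i<sum_list (soliton_sizes xs). of_nat (2 * Suc i) * (of_nat (count_list (soliton_sizes xs) (Suc i)) * (w xs / Z)))"
      by (rule suminf_finite) (auto simp: count_list_soliton_sizes_eq_0)
    also have "\<dots> = (\<Sum>i<sum_list (soliton_sizes xs). of_nat (2 * (Suc i * count_list (soliton_sizes xs) (Suc i)))) * (w xs / Z)"
      unfolding sum_distrib_right by (intro sum.cong refl) (simp only: of_nat_mult mult.assoc)
    also have "(\<Sum>i<sum_list (soliton_sizes xs). of_nat (2 * (Suc i * count_list (soliton_sizes xs) (Suc i)))) =
      (of_nat (2 * sum_list (soliton_sizes xs)) :: ennreal)"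
      by (simp only: of_nat_sum[symmetric] sum_distrib_left[symmetric] sum_list_eq_sum_count[OF soliton_sizes_bounds[OF xs], symmetric])
    finally show "(\<Sum>i. of_nat (2 * Suc i) * (of_nat (count_list (soliton_sizes xs) (Suc i)) * (w xs / Z))) =
      of_nat (2 * sum_list (soliton_sizes xs)) * w xs * inverse Z"
      by (simp add: divide_ennreal_def mult.assoc)
  qed
  also have "\<dots> = I * inverse Z" unfolding I_def by (rule nn_integral_multc) simp
  finally have S: "(\<Sum>\<^sub>\<infinity>k \<in> {1..}. of_nat (2 * k) * rho \<alpha> k) = I * inverse Z" .
  have "inverse Z < top" "inverse Z \<noteq> 0" using Z0 by (auto simp flip: less_top)
  then have "(\<Sum>\<^sub>\<infinity>k \<in> {1..}. of_nat (2 * k) * rho \<alpha> k) < \<infinity> \<longleftrightarrow> I < \<infinity>"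
    unfolding S ennreal_mult_less_top infinity_ennreal_def by auto
  moreover have "total_weight 1 1 (\<lambda>l. 2 * real l) \<alpha> = Z + I"
  proof -
    have weight_plus: "ennreal ((1 + real n) * P) = ennreal P + of_nat n * ennreal P" if "0 \<le> P" for P n
      using that by (simp add: distrib_right ennreal_plus ennreal_mult ennreal_of_nat_eq_real_of_nat)
    have "total_weight 1 1 (\<lambda>l. 2 * real l) \<alpha> = (\<integral>\<^sup>+xs. w xs + of_nat (2 * sum_list (soliton_sizes xs)) * w xs \<partial>count_space (run_lists 1))"
      unfolding total_weight_def
    proof (intro nn_integral_cong)
      fix xs assume "xs \<in> space (count_space (run_lists 1))"
      then have "0 \<le> (\<Prod>l\<leftarrow>soliton_sizes xs. \<alpha> l)"
        using set_soliton_sizes[of xs 1] \<alpha> by (intro list_weight_nonneg(2)[where d = "\<lambda>_. 0" and c = 0]) auto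
      moreover have "(\<Sum>l\<leftarrow>ls. 2 * real l) = real (2 * sum_list ls)" for ls by (induction ls) auto
      ultimately show "ennreal (list_weight 1 (\<lambda>l. 2 * real l) \<alpha> (soliton_sizes xs)) = w xs + of_nat (2 * sum_list (soliton_sizes xs)) * w xs"
        unfolding list_weight_def w_def
        using weight_plus[of "\<Prod>l\<leftarrow>soliton_sizes xs. \<alpha> l" "2 * sum_list (soliton_sizes xs)"] by (simp only:)
    qed
    also have "\<dots> = (\<integral>\<^sup>+xs. w xs \<partial>count_space (run_lists 1)) + I" unfolding I_def by (rule nn_integral_add) auto
    also have "(\<integral>\<^sup>+xs. w xs \<partial>count_space (run_lists 1)) = Z"
      unfolding Z_def partition_function_def infsum_excursions w_def
      by (intro nn_integral_cong) (simp add: alpha_weight_excursion_of)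
    finally show ?thesis .
  qed
  ultimately show ?thesis using Z0 by (simp add: less_top)
qed

section \<open>The parameter transformation and its inverse\<close>

lemma param_families_bounds: "\<alpha> \<in> param_families \<Longrightarrow> 1 \<le> k \<Longrightarrow> 0 \<le> \<alpha> k \<and> \<alpha> k < 1"
  using PiE_mem[of \<alpha> "{1..}" "\<lambda>_. {0..<1}" k] by (simp add: param_families_def)

lemma param_families_undefined: "\<alpha> \<in> param_families \<Longrightarrow> \<not> 1 \<le> k \<Longrightarrow> \<alpha> k = undefined"
  using PiE_arb[of \<alpha> "{1..}" "\<lambda>_. {0..<1}" k] by (simp add: param_families_def)

lemma q_rec_nonneg:
  assumes "\<alpha> \<in> param_families" "1 \<le> k" "\<And>j. 1 \<le> j \<Longrightarrow> j < k \<Longrightarrow> q_rec \<alpha> j < 1"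
  shows "0 \<le> q_rec \<alpha> k"
  using beta_nonneg[of \<alpha> k k] param_families_bounds[OF assms(1,2)] assms(3) by (simp add: beta_diag)

lemma q_rec_alpha_of_q:
  assumes "q \<in> param_families" "1 \<le> k"
  shows "q_rec (alpha_of_q q) k = q k"
  using assms(2)
proof (induction k rule: less_induct)
  case (less k)
  have "(\<Prod>j \<in> {1..<k}. (1 - q_rec (alpha_of_q q) j) ^ (2 * (k - j))) = (\<Prod>j \<in> {1..<k}. (1 - q j) ^ (2 * (k - j)))"
    using less.IH by (intro prod.cong) auto
  moreover have "(\<Prod>j \<in> {1..<k}. (1 - q j) ^ (2 * (k - j))) \<noteq> 0"
    using param_families_bounds[OF assms(1)] by (force simp: prod_zero_iff)
  ultimately show ?case using less.prems by (subst q_rec.simps) (simp add: alpha_of_q_def)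
qed

lemma q_of_alpha_alpha_of_q: "q \<in> param_families \<Longrightarrow> q_of_alpha (alpha_of_q q) = q"
  using param_families_undefined[of q] by (intro ext) (simp add: q_of_alpha_def q_rec_alpha_of_q restrict_def)

text \<open>The bound on \<open>q_rec\<close> keeps the denominators away from 0, where division
  returns 0 and \<alpha> could not be recovered.\<close>

lemma alpha_of_q_q_of_alpha:
  assumes "\<alpha> \<in> param_families" "\<And>k. 1 \<le> k \<Longrightarrow> q_rec \<alpha> k < 1"
  shows "alpha_of_q (q_of_alpha \<alpha>) = \<alpha>"
proof
  fix k
  show "alpha_of_q (q_of_alpha \<alpha>) k = \<alpha> k"
  proof (cases "1 \<le> k")
    case True
    have "(\<Prod>l \<in> {1..<k}. (1 - q_of_alpha \<alpha> l) ^ (2 * (k - l))) = (\<Prod>l \<in> {1..<k}. (1 - q_rec \<alpha> l) ^ (2 * (k - l)))"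
      by (intro prod.cong) (auto simp: q_of_alpha_def)
    moreover have "(\<Prod>l \<in> {1..<k}. (1 - q_rec \<alpha> l) ^ (2 * (k - l))) \<noteq> 0"
      using assms(2) by (force simp: prod_zero_iff)
    ultimately show ?thesis using True q_rec.simps[of \<alpha> k] by (simp add: alpha_of_q_def q_of_alpha_def)
  next
    case False
    then show ?thesis using param_families_undefined[OF assms(1)] by (simp add: alpha_of_q_def)
  qed
qed

lemma alpha_of_q_in_param_families:
  assumes "q \<in> param_families"
  shows "alpha_of_q q \<in> param_families"
proof -
  have "0 \<le> alpha_of_q q k \<and> alpha_of_q q k < 1" if k: "1 \<le> k" for k
  proof -
    define P where "P = (\<Prod>l \<in> {1..<k}. (1 - q l) ^ (2 * (k - l)))"
    have "0 \<le> (1 - q l) ^ (2 * (k - l)) \<and> (1 - q l) ^ (2 * (k - l)) \<le> 1" if "l \<in> {1..<k}" for l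
      using param_families_bounds[OF assms, of l] that by (auto intro!: power_le_one)
    then have P: "0 \<le> P" "P \<le> 1" unfolding P_def by (auto intro!: prod_nonneg prod_le_1)
    have "q k * P \<le> q k * 1" using param_families_bounds[OF assms k] P by (intro mult_left_mono) auto
    moreover have "alpha_of_q q k = q k * P" using k by (simp add: alpha_of_q_def P_def)
    ultimately show ?thesis using param_families_bounds[OF assms k] P by simp
  qed
  then show ?thesis by (auto simp: param_families_def alpha_of_q_def)
qed

text \<open>A family \<alpha> in the parameter range may well have
  \<open>q_rec \<alpha> k \<ge> 1\<close>; the bijections rely on finiteness of the partition
  function to exclude this.\<close>

lemma A_set_q_rec:
  assumes "\<alpha> \<in> A_set"
  shows "\<And>k. 1 \<le> k \<Longrightarrow> q_rec \<alpha> k < 1" "q_of_alpha \<alpha> \<in> param_families"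
proof -
  have \<alpha>: "\<alpha> \<in> param_families" "total_weight 1 1 (\<lambda>_. 0) \<alpha> < \<infinity>"
    using assms by (auto simp: A_set_def partition_function_eq)
  show *: "q_rec \<alpha> k < 1" if "1 \<le> k" for k
    by (rule q_rec_less_1) (use \<alpha> that param_families_bounds in auto)
  show "q_of_alpha \<alpha> \<in> param_families"
    using * q_rec_nonneg[OF \<alpha>(1)] by (auto simp: param_families_def q_of_alpha_def)
qed

lemma summable_on_of_nat_mult_imp:
  fixes q :: "nat \<Rightarrow> real"
  assumes "(\<lambda>k. real k * q k) summable_on {1..}" "\<And>k. 1 \<le> k \<Longrightarrow> 0 \<le> q k"
  shows "q summable_on {1..}"
proof -
  obtain B where "\<And>M. (\<Sum>j \<in> {1..M}. real j * q j) \<le> B" using summable_on_atLeast_1D(1)[OF assms(1)] assms(2) by auto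
  moreover have "(\<Sum>j \<in> {1..M}. q j) \<le> (\<Sum>j \<in> {1..M}. real j * q j)" for M
  proof (rule sum_mono)
    fix j assume "j \<in> {1..M}"
    then have "1 * q j \<le> real j * q j" using assms(2) by (intro mult_right_mono) auto
    then show "q j \<le> real j * q j" by simp
  qed
  ultimately have "(\<Sum>j \<in> {1..M}. q j) \<le> B" for M by (rule order.trans[rotated])
  then show ?thesis using assms(2) by (intro summable_on_atLeast_1I) auto
qed

text \<open>The finiteness criterion at \<open>t = 0\<close> gives the first equivalence, at
  \<open>t = 1\<close> the second, where the mean length is expressed as a total weight.\<close>

lemma set_membership_iff:
  assumes \<alpha>: "\<alpha> \<in> param_families" and q: "q \<in> param_families" "q = q_of_alpha \<alpha>"
  shows "\<alpha> \<in> A_set \<longleftrightarrow> q \<in> Q_set" "\<alpha> \<in> A_plus_set \<longleftrightarrow> q \<in> Q_plus_set"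
proof -
  have eq: "q_rec \<alpha> k = q k" if "1 \<le> k" for k using that q(2) by (simp add: q_of_alpha_def)
  have b: "0 \<le> q_rec \<alpha> k \<and> q_rec \<alpha> k < 1" if "1 \<le> k" for k
    using param_families_bounds[OF q(1) that] eq[OF that] by simp
  have \<alpha>0: "0 \<le> \<alpha> l" if "1 \<le> l" for l using param_families_bounds[OF \<alpha> that] by simp
  have s: "q_rec \<alpha> summable_on {1..} \<longleftrightarrow> q summable_on {1..}"
    "(\<lambda>j. real j * q_rec \<alpha> j) summable_on {1..} \<longleftrightarrow> (\<lambda>j. real j * q j) summable_on {1..}"
    using eq by (auto intro!: summable_on_cong)
  show A: "\<alpha> \<in> A_set \<longleftrightarrow> q \<in> Q_set"
    using total_weight_finite_iff[of \<alpha> 0] \<alpha> \<alpha>0 q(1) b s(1) by (simp add: A_set_def Q_set_def partition_function_eq)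
  have "\<alpha> \<in> A_plus_set \<longleftrightarrow> \<alpha> \<in> A_set \<and> total_weight 1 1 (\<lambda>l. 2 * real l) \<alpha> < \<infinity>"
    using mean_length_finite_iff[of \<alpha>] \<alpha>0 by (auto simp: A_plus_set_def A_set_def)
  also have "\<dots> \<longleftrightarrow> q \<in> Q_set \<and> q summable_on {1..} \<and> (\<lambda>j. real j * q j) summable_on {1..}"
    using total_weight_finite_iff[of \<alpha> 1] \<alpha>0 b s A by simp
  also have "\<dots> \<longleftrightarrow> q \<in> Q_plus_set"
    using summable_on_of_nat_mult_imp[of q] q(1) param_families_bounds[OF q(1)] by (auto simp: Q_set_def Q_plus_set_def)
  finally show "\<alpha> \<in> A_plus_set \<longleftrightarrow> q \<in> Q_plus_set" .
qed

text \<open>Summability of \<open>q\<close> gives the infinite product a nonzero limit. The finite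
  products of \<open>1 / (1 - q j)\<close> increase, so their supremum is the reciprocal of that
  limit.\<close>

lemma partition_function_eq_prodinf:
  assumes "\<alpha> \<in> A_set" "q = q_of_alpha \<alpha>"
  shows "convergent_prod (\<lambda>k. 1 - q (Suc k))" "0 < (\<Prod>k. 1 - q (Suc k))"
    "partition_function \<alpha> = ennreal (1 / (\<Prod>k. 1 - q (Suc k)))"
proof -
  have \<alpha>: "\<alpha> \<in> param_families" using assms by (simp add: A_set_def)
  have q: "q \<in> param_families" "q \<in> Q_set"
    using A_set_q_rec[OF assms(1)] set_membership_iff(1)[OF \<alpha>] assms by auto
  have b: "0 \<le> q (Suc k)" "q (Suc k) < 1" for k using param_families_bounds[OF q(1), of "Suc k"] by auto
  have "summable (\<lambda>k. q (Suc k))"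
    using q param_families_bounds[OF q(1)] by (intro summable_on_atLeast_1D(2)) (auto simp: Q_set_def)
  then have "convergent_prod (\<lambda>k. 1 + - q (Suc k))"
    using b by (intro summable_imp_convergent_prod_real) (auto simp: less_imp_neq)
  then show conv: "convergent_prod (\<lambda>k. 1 - q (Suc k))" by simp
  define p where "p = (\<Prod>k. 1 - q (Suc k))"
  have lim: "(\<lambda>M. \<Prod>k\<le>M. 1 - q (Suc k)) \<longlonglongrightarrow> p" unfolding p_def by (rule convergent_prod_LIMSEQ[OF conv])
  have "p \<noteq> 0" unfolding p_def using b by (intro prodinf_nonzero[OF conv]) (auto simp: less_imp_neq)
  moreover have "0 \<le> p"
    using lim by (rule LIMSEQ_le_const) (use b in \<open>auto intro!: prod_nonneg simp: less_imp_le\<close>)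
  ultimately have p: "0 < p" by simp
  then show "0 < (\<Prod>k. 1 - q (Suc k))" by (simp add: p_def)
  define F where "F M = (\<Prod>j \<in> {1..M}. 1 / (1 - q j))" for M
  have F: "F (Suc M) = 1 / (\<Prod>k\<le>M. 1 - q (Suc k))" for M
    unfolding F_def using prod.shift_bounds_cl_Suc_ivl[of "\<lambda>j. 1 / (1 - q j)" 0 M]
    by (simp add: prod_dividef atLeast0AtMost)
  have "(\<lambda>M. F (Suc M)) \<longlonglongrightarrow> 1 / p" unfolding F using lim p by (intro tendsto_intros) auto
  then have "F \<longlonglongrightarrow> 1 / p" by (rule LIMSEQ_imp_Suc)
  then have "(\<lambda>M. ennreal (F M)) \<longlonglongrightarrow> ennreal (1 / p)" by (rule tendsto_ennrealI)
  moreover have "incseq (\<lambda>M. ennreal (F M))"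
  proof (rule incseq_SucI)
    fix M
    have "0 \<le> F M" unfolding F_def using param_families_bounds[OF q(1)] by (intro prod_nonneg) (auto simp: less_imp_le)
    then have "F M * 1 \<le> F M * (1 / (1 - q (Suc M)))" using b[of M] by (intro mult_left_mono) auto
    then show "ennreal (F M) \<le> ennreal (F (Suc M))" by (intro ennreal_leI) (simp add: F_def)
  qed
  ultimately have "(SUP M. ennreal (F M)) = ennreal (1 / p)" using LIMSEQ_SUP LIMSEQ_unique by blast
  moreover have "(\<Prod>j \<in> {1..M}. 1 / (1 - q_rec \<alpha> j)) = F M" for M
    unfolding F_def using assms(2) by (intro prod.cong) (auto simp: q_of_alpha_def)
  ultimately show "partition_function \<alpha> = ennreal (1 / (\<Prod>k. 1 - q (Suc k)))"
    unfolding partition_function_eq p_def[symmetric]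
    using total_weight_unit[of \<alpha>] param_families_bounds[OF \<alpha>] A_set_q_rec(1)[OF assms(1)] by simp
qed

text \<open>Exchanges two products: in \<open>alpha_of_q q l\<close> the factor
  \<open>1 - q k\<close> has exponent \<open>2 * (l - k)\<close>, the number of
  \<open>k\<close>-slots on an \<open>l\<close>-soliton. The truncated exponents vanish for
  \<open>k \<ge> l\<close>, so one bound \<open>B\<close> serves all sizes.\<close>

lemma prod_list_alpha_of_q:
  assumes "\<forall>l \<in> set ls. 1 \<le> l \<and> l \<le> B"
  shows "(\<Prod>l\<leftarrow>ls. alpha_of_q q l) =
    (\<Prod>k<B. q (Suc k) ^ count_list ls (Suc k) * (1 - q (Suc k)) ^ (\<Sum>l\<leftarrow>ls. 2 * (l - Suc k)))"
proof -
  have alpha: "alpha_of_q q l = q l * (\<Prod>k<B. (1 - q (Suc k)) ^ (2 * (l - Suc k)))" if l: "1 \<le> l" "l \<le> B" for l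
  proof -
    have "(\<Prod>j \<in> {1..<l}. (1 - q j) ^ (2 * (l - j))) = (\<Prod>k \<in> {0..<l - 1}. (1 - q (Suc k)) ^ (2 * (l - Suc k)))"
      using prod.shift_bounds_Suc_ivl[of "\<lambda>j. (1 - q j) ^ (2 * (l - j))" 0 "l - 1"] l by simp
    also have "\<dots> = (\<Prod>k<B. (1 - q (Suc k)) ^ (2 * (l - Suc k)))"
      using l by (intro prod.mono_neutral_left) auto
    finally show ?thesis using l by (simp add: alpha_of_q_def)
  qed
  have "(\<Prod>l\<leftarrow>ls. alpha_of_q q l) = (\<Prod>l\<leftarrow>ls. q l) * (\<Prod>k<B. (1 - q (Suc k)) ^ (\<Sum>l\<leftarrow>ls. 2 * (l - Suc k)))"
    using assms by (induction ls) (auto simp: alpha power_add prod.distrib)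
  then show ?thesis by (simp add: prod_list_eq_prod_count[OF assms] prod.distrib)
qed

text \<open>Equality holds excursion by excursion: the slots on solitons turn the powers of
  \<open>q\<close> into those of \<alpha>, and the slot at box 0 leaves one factor
  \<open>1 - q k\<close> per level, whose product is the reciprocal of the partition
  function.\<close>

lemma nu_eq_phi:
  assumes "\<alpha> \<in> A_set" "q = q_of_alpha \<alpha>"
  shows "nu \<alpha> = phi q"
proof -
  have \<alpha>: "\<alpha> \<in> param_families" "alpha_of_q q = \<alpha>"
    using assms alpha_of_q_q_of_alpha A_set_q_rec(1) by (auto simp: A_set_def)
  define p where "p = (\<Prod>k. 1 - q (Suc k))"
  note Z = partition_function_eq_prodinf[OF assms, folded p_def]
  have "nu_weight \<alpha> e = phi_weight q e" if e: "e \<in> excursions" for e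
  proof -
    obtain xs where xs: "xs \<in> run_lists 1" "e = excursion_of xs" using excursion_of_surj[OF e] by blast
    define B where "B = sum_list (soliton_sizes xs)"
    define a where "a k = q (Suc k) ^ count_list (soliton_sizes xs) (Suc k) * (1 - q (Suc k)) ^ (\<Sum>l\<leftarrow>soliton_sizes xs. 2 * (l - Suc k))" for k
    have a1: "a k = 1" if "k \<notin> {..<B}" for k
    proof -
      have "l - Suc k = 0" if "l \<in> set (soliton_sizes xs)" for l
        using soliton_sizes_bounds[OF xs(1)] that \<open>k \<notin> {..<B}\<close> by (fastforce simp: B_def)
      then have "(\<Sum>l\<leftarrow>soliton_sizes xs. 2 * (l - Suc k)) = (\<Sum>l\<leftarrow>soliton_sizes xs. 0)" by (intro arg_cong[where f = sum_list] map_cong) auto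
      then have "(\<Sum>l\<leftarrow>soliton_sizes xs. 2 * (l - Suc k)) = 0" by simp
      moreover have "count_list (soliton_sizes xs) (Suc k) = 0" using count_list_soliton_sizes_eq_0[of xs k] that by (simp add: B_def)
      ultimately show ?thesis by (simp only: a_def power_0 mult_1)
    qed
    have w: "prodinf a = (\<Prod>l\<leftarrow>soliton_sizes xs. \<alpha> l)"
      using prodinf_finite[OF finite_lessThan a1] prod_list_alpha_of_q[OF soliton_sizes_bounds[OF xs(1)], of q]
      by (simp add: \<alpha>(2) B_def a_def[symmetric])
    have "(\<Prod>k. q (Suc k) ^ slot_diagram_norm e (Suc k) * (1 - q (Suc k)) ^ num_slots e (Suc k)) =
      (\<Prod>k. a k * (1 - q (Suc k)))"
      unfolding a_def xs(2) slot_diagram_norm_excursion_of[OF xs(1)] num_solitons_excursion_of(1)[OF xs(1)]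
        slots_excursion_of(1)[OF xs(1)] by (simp add: mult.commute mult.left_commute)
    \<comment> \<open>\<open>a\<close> is 1 from index \<open>B\<close> on, so both products
      converge and the infinite product splits.\<close>
    also have "\<dots> = prodinf a * p"
      unfolding p_def by (intro prodinf_mult[symmetric] Z(1) convergent_prod_finite[OF finite_lessThan a1])
    finally have "phi_weight q e = ennreal ((\<Prod>l\<leftarrow>soliton_sizes xs. \<alpha> l) * p)" by (simp add: phi_weight_def w)
    moreover have "nu_weight \<alpha> e = ennreal ((\<Prod>l\<leftarrow>soliton_sizes xs. \<alpha> l) * p)"
    proof -
      have "0 \<le> (\<Prod>l\<leftarrow>soliton_sizes xs. \<alpha> l)"
        using set_soliton_sizes[OF xs(1)] param_families_bounds[OF \<alpha>(1)]
        by (intro list_weight_nonneg(2)[where d = "\<lambda>_. 0" and c = 0]) auto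
      then show ?thesis using Z(2) by (simp add: nu_weight_def xs(2) alpha_weight_excursion_of[OF xs(1)] Z(3) divide_ennreal)
    qed
    ultimately show ?thesis by simp
  qed
  then show ?thesis unfolding nu_def phi_def point_measure_def
    by (intro density_cong) (auto simp: AE_count_space)
qed

theorem theorem1:
  shows "(\<forall>\<alpha> \<in> param_families. \<forall>q \<in> param_families.
            (q = q_of_alpha \<alpha> \<longleftrightarrow> \<alpha> = alpha_of_q q) \<and>
            (q = q_of_alpha \<alpha> \<longrightarrow>
               (\<alpha> \<in> A_set \<longleftrightarrow> q \<in> Q_set) \<and>
               (\<alpha> \<in> A_plus_set \<longleftrightarrow> q \<in> Q_plus_set) \<and>
               (\<alpha> \<in> A_set \<longrightarrow> nu \<alpha> = phi q))) \<and>
         (\<forall>\<alpha> \<in> A_set. alpha_of_q (q_of_alpha \<alpha>) = \<alpha>) \<and>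
         (\<forall>q \<in> Q_set. q_of_alpha (alpha_of_q q) = q) \<and>
         bij_betw q_of_alpha A_set Q_set \<and> bij_betw alpha_of_q Q_set A_set \<and>
         bij_betw q_of_alpha A_plus_set Q_plus_set \<and> bij_betw alpha_of_q Q_plus_set A_plus_set"
proof -
  have param: "A_set \<subseteq> param_families" "Q_set \<subseteq> param_families" "Q_plus_set \<subseteq> param_families" "A_plus_set \<subseteq> A_set"
    by (auto simp: A_set_def Q_set_def Q_plus_set_def A_plus_set_def)
  have inv1: "alpha_of_q (q_of_alpha \<alpha>) = \<alpha>" if "\<alpha> \<in> A_set" for \<alpha>
    using alpha_of_q_q_of_alpha A_set_q_rec(1)[OF that] param that by blast
  have inv2: "q_of_alpha (alpha_of_q q) = q" if "q \<in> param_families" for q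
    using q_of_alpha_alpha_of_q[OF that] .
  have equiv: "q = q_of_alpha \<alpha> \<longleftrightarrow> \<alpha> = alpha_of_q q" if "\<alpha> \<in> param_families" "q \<in> param_families" for \<alpha> q
  proof
    assume q: "q = q_of_alpha \<alpha>"
    \<comment> \<open>Here the bound comes from \<open>q\<close> being a parameter family, not from
      \<alpha> in \<open>A_set\<close>.\<close>
    then have "q_rec \<alpha> k < 1" if "1 \<le> k" for k
      using param_families_bounds[OF \<open>q \<in> param_families\<close> that] that by (simp add: q_of_alpha_def)
    then show "\<alpha> = alpha_of_q q" using alpha_of_q_q_of_alpha[OF that(1)] q by simp
  qed (use inv2 that in auto)
  have AQ: "q_of_alpha \<alpha> \<in> Q_set" "\<alpha> \<in> A_plus_set \<Longrightarrow> q_of_alpha \<alpha> \<in> Q_plus_set" if "\<alpha> \<in> A_set" for \<alpha>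
    using set_membership_iff[of \<alpha> "q_of_alpha \<alpha>"] A_set_q_rec(2)[OF that] that param by auto
  have QA: "q \<in> Q_set \<Longrightarrow> alpha_of_q q \<in> A_set" "q \<in> Q_plus_set \<Longrightarrow> alpha_of_q q \<in> A_plus_set" if "q \<in> param_families" for q
    using set_membership_iff[of "alpha_of_q q" q] alpha_of_q_in_param_families[OF that] inv2[OF that] that by auto
  have "bij_betw q_of_alpha A_set Q_set" "bij_betw alpha_of_q Q_set A_set"
    by (rule bij_betw_byWitness[where f' = alpha_of_q], use inv1 inv2 param AQ QA in auto)
      (rule bij_betw_byWitness[where f' = q_of_alpha], use inv1 inv2 param AQ QA in auto)
  moreover have "bij_betw q_of_alpha A_plus_set Q_plus_set" "bij_betw alpha_of_q Q_plus_set A_plus_set"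
    by (rule bij_betw_byWitness[where f' = alpha_of_q], use inv1 inv2 param AQ QA in auto)
      (rule bij_betw_byWitness[where f' = q_of_alpha], use inv1 inv2 param AQ QA in auto)
  ultimately show ?thesis
    using equiv set_membership_iff nu_eq_phi inv1 inv2 param by (auto simp del: One_nat_def)
qed

end
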